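(* Assume function extensionality. Let $(f,I,J)$ be a quasi-idempotent on a type $X$, and let $(A,r,s,H)$ be the splitting constructed in the context. Then for every $x:X$ we have $\mathsf{ap}_s(H(r(x))) = I(x)$. That is, the witness of pre-idempotence induced by the splitting equals $I$.
   Context: We work in intensional Martin-Löf type theory. We write $p\cdot q$ for path concatenation, $p^{-1}$ for inverse, and $\mathsf{ap}_f$ for action on paths. A quasi-idempotent on $X$ is a triple with $f:X\to X$, $I:\prod_{x:X}(f(f(x))=f(x))$ and $J:\prod_{x:X}(\mathsf{ap}_f(I(x))=I(f(x)))$. The splitting is defined as follows: - $A := \sum_{a:\mathbb{N}\to X}\prod_{n:\mathbb{N}}(f(a_{n+1})=a_n)$; - $s(a,\alpha):=a_0$; - $r(x):=(\lambda n.\,f(x),\lambda n.\,I(x))$. $H:\prod_{u:A}(r(s(u))=u)$ is defined as follows. By function extensionality, a path $(a,\alpha)=(c,\gamma)$ in $A$ is given by a family $\xi_n:a_n=c_n$ with proofs $\alpha_n\cdot\xi_n=\mathsf{ap}_f(\xi_{n+1})\cdot\gamma_n$. For $(a,\alpha):A$ put $b_n:=f(f(a_{n+1}))$ and $\beta_n:=\mathsf{ap}_{f\circ f}(\alpha_{n+1})$. - Let $p_1:(b,\beta)=(a,\alpha)$ be a path with family $\xi_n:=I(a_{n+1})\cdot\alpha_n$. - Let $p_2:(b,\beta)=r(s(a,\alpha))$ be a path with family $\xi'_0:=\mathsf{ap}_f(\alpha_0)$ and $\xi'_{n+1}:=\mathsf{ap}_f(\alpha_{n+1})\cdot I(a_{n+1})^{-1}\cdot\xi'_n$.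 The commutativity proofs for $p_1$ and $p_2$ exist using naturality of $I$ and $J$, and any choice is fixed. Then $H(a,\alpha):=p_2^{-1}\cdot p_1$. *)

theory Defs
  imports Main
begin

section \<open>Raw syntax\<close>

text \<open>
  Intensional Martin-Loef type theory is embedded deeply, with de Bruijn indices; types are
  terms that inhabit a universe. A shallow embedding into HOL functions would admit
  motives defined by HOL equality and so make every identity proof reflexivity.

  Binding: \<open>PiT A B\<close>, \<open>Lam A b\<close>, \<open>SigT A B\<close> bind one variable in their second argument;
  \<open>Split C g p\<close> binds one variable in \<open>C\<close> and two in \<open>g\<close>;
  \<open>NatRec C c0 cs n\<close> binds one variable in \<open>C\<close> and two in \<open>cs\<close>;
  \<open>IdRec C c a b p\<close> binds three variables (the two end points and the path) in \<open>C\<close> and one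
  in \<open>c\<close>. Index 0 is the innermost, i.e. the last bound, variable.
\<close>

datatype tm =
    Var nat
  | Univ nat
  | PiT tm tm
  | Lam tm tm
  | App tm tm  (infixl \<open>\<bullet>\<close> 90)
  | SigT tm tm
  | Pair tm tm
  | Split tm tm tm
  | NatT
  | Zero
  | Succ tm
  | NatRec tm tm tm tm
  | IdT tm tm tm
  | Refl tm
  | IdRec tm tm tm tm tm

fun up_ren :: "(nat \<Rightarrow> nat) \<Rightarrow> nat \<Rightarrow> nat" where
  "up_ren \<rho> 0 = 0"
| "up_ren \<rho> (Suc n) = Suc (\<rho> n)"

primrec rename :: "(nat \<Rightarrow> nat) \<Rightarrow> tm \<Rightarrow> tm" where
  "rename \<rho> (Var n) = Var (\<rho> n)"
| "rename \<rho> (Univ i) = Univ i"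
| "rename \<rho> (PiT A B) = PiT (rename \<rho> A) (rename (up_ren \<rho>) B)"
| "rename \<rho> (Lam A b) = Lam (rename \<rho> A) (rename (up_ren \<rho>) b)"
| "rename \<rho> (App f a) = App (rename \<rho> f) (rename \<rho> a)"
| "rename \<rho> (SigT A B) = SigT (rename \<rho> A) (rename (up_ren \<rho>) B)"
| "rename \<rho> (Pair a b) = Pair (rename \<rho> a) (rename \<rho> b)"
| "rename \<rho> (Split C g p) =
     Split (rename (up_ren \<rho>) C) (rename (up_ren (up_ren \<rho>)) g) (rename \<rho> p)"
| "rename \<rho> NatT = NatT"
| "rename \<rho> Zero = Zero"
| "rename \<rho> (Succ n) = Succ (rename \<rho> n)"
| "rename \<rho> (NatRec C c0 cs n) =
     NatRec (rename (up_ren \<rho>) C) (rename \<rho> c0) (rename (up_ren (up_ren \<rho>)) cs) (rename \<rho> n)"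
| "rename \<rho> (IdT A a b) = IdT (rename \<rho> A) (rename \<rho> a) (rename \<rho> b)"
| "rename \<rho> (Refl a) = Refl (rename \<rho> a)"
| "rename \<rho> (IdRec C c a b p) =
     IdRec (rename (up_ren (up_ren (up_ren \<rho>))) C) (rename (up_ren \<rho>) c)
       (rename \<rho> a) (rename \<rho> b) (rename \<rho> p)"

definition weaken :: "tm \<Rightarrow> nat \<Rightarrow> tm"  (infixl \<open>\<up>\<close> 110) where
  "t \<up> k = rename (\<lambda>n. n + k) t"

fun scons :: "tm \<Rightarrow> (nat \<Rightarrow> tm) \<Rightarrow> nat \<Rightarrow> tm"  (infixr \<open>\<rhd>\<close> 65) where
  "(t \<rhd> \<sigma>) 0 = t"
| "(t \<rhd> \<sigma>) (Suc n) = \<sigma> n"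

definition up :: "(nat \<Rightarrow> tm) \<Rightarrow> nat \<Rightarrow> tm" where
  "up \<sigma> = Var 0 \<rhd> (\<lambda>n. \<sigma> n \<up> 1)"

primrec subst :: "(nat \<Rightarrow> tm) \<Rightarrow> tm \<Rightarrow> tm" where
  "subst \<sigma> (Var n) = \<sigma> n"
| "subst \<sigma> (Univ i) = Univ i"
| "subst \<sigma> (PiT A B) = PiT (subst \<sigma> A) (subst (up \<sigma>) B)"
| "subst \<sigma> (Lam A b) = Lam (subst \<sigma> A) (subst (up \<sigma>) b)"
| "subst \<sigma> (App f a) = App (subst \<sigma> f) (subst \<sigma> a)"
| "subst \<sigma> (SigT A B) = SigT (subst \<sigma> A) (subst (up \<sigma>) B)"
| "subst \<sigma> (Pair a b) = Pair (subst \<sigma> a) (subst \<sigma> b)"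
| "subst \<sigma> (Split C g p) =
     Split (subst (up \<sigma>) C) (subst (up (up \<sigma>)) g) (subst \<sigma> p)"
| "subst \<sigma> NatT = NatT"
| "subst \<sigma> Zero = Zero"
| "subst \<sigma> (Succ n) = Succ (subst \<sigma> n)"
| "subst \<sigma> (NatRec C c0 cs n) =
     NatRec (subst (up \<sigma>) C) (subst \<sigma> c0) (subst (up (up \<sigma>)) cs) (subst \<sigma> n)"
| "subst \<sigma> (IdT A a b) = IdT (subst \<sigma> A) (subst \<sigma> a) (subst \<sigma> b)"
| "subst \<sigma> (Refl a) = Refl (subst \<sigma> a)"
| "subst \<sigma> (IdRec C c a b p) =
     IdRec (subst (up (up (up \<sigma>))) C) (subst (up \<sigma>) c)
       (subst \<sigma> a) (subst \<sigma> b) (subst \<sigma> p)"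

definition subst1 :: "tm \<Rightarrow> tm \<Rightarrow> tm" where
  "subst1 t a = subst (a \<rhd> Var) t"

definition subst2 :: "tm \<Rightarrow> tm \<Rightarrow> tm \<Rightarrow> tm" where
  "subst2 t a b = subst (b \<rhd> a \<rhd> Var) t"

definition subst3 :: "tm \<Rightarrow> tm \<Rightarrow> tm \<Rightarrow> tm \<Rightarrow> tm" where
  "subst3 t a b c = subst (c \<rhd> b \<rhd> a \<rhd> Var) t"


section \<open>Judgements\<close>

text \<open>
  The rules are those of the HoTT book (appendix, second presentation), restricted to
  universes a la Russell (cumulative), \<open>\<Pi>\<close> (with \<open>\<eta>\<close>), \<open>\<Sigma>\<close> (with its dependent eliminator
  and without judgemental \<open>\<eta>\<close>), natural numbers and intensional identity types.
  There is no equality reflection, no uniqueness of identity proofs, no univalence, and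
  function extensionality is not built in. Contexts are lists, the last declared type
  being the head.
\<close>

inductive
  wf_ctx :: "tm list \<Rightarrow> bool" and
  has_type :: "tm list \<Rightarrow> tm \<Rightarrow> tm \<Rightarrow> bool"  (\<open>_ \<turnstile> _ \<^bold>: _\<close> [60, 60, 60] 50) and
  jdg_eq :: "tm list \<Rightarrow> tm \<Rightarrow> tm \<Rightarrow> tm \<Rightarrow> bool"  (\<open>_ \<turnstile> _ \<doteq> _ \<^bold>: _\<close> [60, 60, 60, 60] 50)
where
  ctx_empty: "wf_ctx []"
| ctx_extend: "\<Gamma> \<turnstile> A \<^bold>: Univ i \<Longrightarrow> wf_ctx (A # \<Gamma>)"

| var: "wf_ctx \<Gamma> \<Longrightarrow> n < length \<Gamma> \<Longrightarrow> \<Gamma> \<turnstile> Var n \<^bold>: (\<Gamma> ! n) \<up> (Suc n)"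
| conv: "\<Gamma> \<turnstile> a \<^bold>: A \<Longrightarrow> \<Gamma> \<turnstile> A \<doteq> B \<^bold>: Univ i \<Longrightarrow> \<Gamma> \<turnstile> a \<^bold>: B"
| eq_conv: "\<Gamma> \<turnstile> a \<doteq> b \<^bold>: A \<Longrightarrow> \<Gamma> \<turnstile> A \<doteq> B \<^bold>: Univ i \<Longrightarrow> \<Gamma> \<turnstile> a \<doteq> b \<^bold>: B"
| eq_refl: "\<Gamma> \<turnstile> a \<^bold>: A \<Longrightarrow> \<Gamma> \<turnstile> a \<doteq> a \<^bold>: A"
| eq_sym: "\<Gamma> \<turnstile> a \<doteq> b \<^bold>: A \<Longrightarrow> \<Gamma> \<turnstile> b \<doteq> a \<^bold>: A"
| eq_trans: "\<Gamma> \<turnstile> a \<doteq> b \<^bold>: A \<Longrightarrow> \<Gamma> \<turnstile> b \<doteq> c \<^bold>: A \<Longrightarrow> \<Gamma> \<turnstile> a \<doteq> c \<^bold>: A"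

| univ: "wf_ctx \<Gamma> \<Longrightarrow> \<Gamma> \<turnstile> Univ i \<^bold>: Univ (Suc i)"
| cumul: "\<Gamma> \<turnstile> A \<^bold>: Univ i \<Longrightarrow> \<Gamma> \<turnstile> A \<^bold>: Univ (Suc i)"
| eq_cumul: "\<Gamma> \<turnstile> A \<doteq> B \<^bold>: Univ i \<Longrightarrow> \<Gamma> \<turnstile> A \<doteq> B \<^bold>: Univ (Suc i)"

| pi_form: "\<Gamma> \<turnstile> A \<^bold>: Univ i \<Longrightarrow> A # \<Gamma> \<turnstile> B \<^bold>: Univ i \<Longrightarrow> \<Gamma> \<turnstile> PiT A B \<^bold>: Univ i"
| pi_intro: "A # \<Gamma> \<turnstile> b \<^bold>: B \<Longrightarrow> \<Gamma> \<turnstile> Lam A b \<^bold>: PiT A B"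
| pi_elim: "\<Gamma> \<turnstile> f \<^bold>: PiT A B \<Longrightarrow> \<Gamma> \<turnstile> a \<^bold>: A \<Longrightarrow> \<Gamma> \<turnstile> f \<bullet> a \<^bold>: subst1 B a"
| pi_comp: "A # \<Gamma> \<turnstile> b \<^bold>: B \<Longrightarrow> \<Gamma> \<turnstile> a \<^bold>: A \<Longrightarrow>
    \<Gamma> \<turnstile> Lam A b \<bullet> a \<doteq> subst1 b a \<^bold>: subst1 B a"
| pi_uniq: "\<Gamma> \<turnstile> f \<^bold>: PiT A B \<Longrightarrow> \<Gamma> \<turnstile> f \<doteq> Lam A (f\<up>1 \<bullet> Var 0) \<^bold>: PiT A B"
| pi_form_cong: "\<Gamma> \<turnstile> A \<doteq> A' \<^bold>: Univ i \<Longrightarrow> A # \<Gamma> \<turnstile> B \<doteq> B' \<^bold>: Univ i \<Longrightarrow>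
    \<Gamma> \<turnstile> PiT A B \<doteq> PiT A' B' \<^bold>: Univ i"
| pi_intro_cong: "\<Gamma> \<turnstile> A \<doteq> A' \<^bold>: Univ i \<Longrightarrow> A # \<Gamma> \<turnstile> b \<doteq> b' \<^bold>: B \<Longrightarrow>
    \<Gamma> \<turnstile> Lam A b \<doteq> Lam A' b' \<^bold>: PiT A B"
| pi_elim_cong: "\<Gamma> \<turnstile> f \<doteq> f' \<^bold>: PiT A B \<Longrightarrow> \<Gamma> \<turnstile> a \<doteq> a' \<^bold>: A \<Longrightarrow>
    \<Gamma> \<turnstile> f \<bullet> a \<doteq> f' \<bullet> a' \<^bold>: subst1 B a"

| sig_form: "\<Gamma> \<turnstile> A \<^bold>: Univ i \<Longrightarrow> A # \<Gamma> \<turnstile> B \<^bold>: Univ i \<Longrightarrow> \<Gamma> \<turnstile> SigT A B \<^bold>: Univ i"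
| sig_intro: "A # \<Gamma> \<turnstile> B \<^bold>: Univ i \<Longrightarrow> \<Gamma> \<turnstile> a \<^bold>: A \<Longrightarrow> \<Gamma> \<turnstile> b \<^bold>: subst1 B a \<Longrightarrow>
    \<Gamma> \<turnstile> Pair a b \<^bold>: SigT A B"
| sig_elim: "SigT A B # \<Gamma> \<turnstile> C \<^bold>: Univ i \<Longrightarrow>
    B # A # \<Gamma> \<turnstile> g \<^bold>: subst (Pair (Var 1) (Var 0) \<rhd> (\<lambda>n. Var (n + 2))) C \<Longrightarrow>
    \<Gamma> \<turnstile> p \<^bold>: SigT A B \<Longrightarrow>
    \<Gamma> \<turnstile> Split C g p \<^bold>: subst1 C p"
| sig_comp: "SigT A B # \<Gamma> \<turnstile> C \<^bold>: Univ i \<Longrightarrow>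
    B # A # \<Gamma> \<turnstile> g \<^bold>: subst (Pair (Var 1) (Var 0) \<rhd> (\<lambda>n. Var (n + 2))) C \<Longrightarrow>
    \<Gamma> \<turnstile> a \<^bold>: A \<Longrightarrow> \<Gamma> \<turnstile> b \<^bold>: subst1 B a \<Longrightarrow>
    \<Gamma> \<turnstile> Split C g (Pair a b) \<doteq> subst2 g a b \<^bold>: subst1 C (Pair a b)"
| sig_form_cong: "\<Gamma> \<turnstile> A \<doteq> A' \<^bold>: Univ i \<Longrightarrow> A # \<Gamma> \<turnstile> B \<doteq> B' \<^bold>: Univ i \<Longrightarrow>
    \<Gamma> \<turnstile> SigT A B \<doteq> SigT A' B' \<^bold>: Univ i"
| sig_intro_cong: "A # \<Gamma> \<turnstile> B \<^bold>: Univ i \<Longrightarrow> \<Gamma> \<turnstile> a \<doteq> a' \<^bold>: A \<Longrightarrow>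
    \<Gamma> \<turnstile> b \<doteq> b' \<^bold>: subst1 B a \<Longrightarrow>
    \<Gamma> \<turnstile> Pair a b \<doteq> Pair a' b' \<^bold>: SigT A B"
| sig_elim_cong: "SigT A B # \<Gamma> \<turnstile> C \<doteq> C' \<^bold>: Univ i \<Longrightarrow>
    B # A # \<Gamma> \<turnstile> g \<doteq> g' \<^bold>: subst (Pair (Var 1) (Var 0) \<rhd> (\<lambda>n. Var (n + 2))) C \<Longrightarrow>
    \<Gamma> \<turnstile> p \<doteq> p' \<^bold>: SigT A B \<Longrightarrow>
    \<Gamma> \<turnstile> Split C g p \<doteq> Split C' g' p' \<^bold>: subst1 C p"

| nat_form: "wf_ctx \<Gamma> \<Longrightarrow> \<Gamma> \<turnstile> NatT \<^bold>: Univ 0"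
| nat_zero: "wf_ctx \<Gamma> \<Longrightarrow> \<Gamma> \<turnstile> Zero \<^bold>: NatT"
| nat_succ: "\<Gamma> \<turnstile> n \<^bold>: NatT \<Longrightarrow> \<Gamma> \<turnstile> Succ n \<^bold>: NatT"
| nat_elim: "NatT # \<Gamma> \<turnstile> C \<^bold>: Univ i \<Longrightarrow> \<Gamma> \<turnstile> c0 \<^bold>: subst1 C Zero \<Longrightarrow>
    C # NatT # \<Gamma> \<turnstile> cs \<^bold>: subst (Succ (Var 1) \<rhd> (\<lambda>n. Var (n + 2))) C \<Longrightarrow>
    \<Gamma> \<turnstile> n \<^bold>: NatT \<Longrightarrow>
    \<Gamma> \<turnstile> NatRec C c0 cs n \<^bold>: subst1 C n"
| nat_comp_zero: "NatT # \<Gamma> \<turnstile> C \<^bold>: Univ i \<Longrightarrow> \<Gamma> \<turnstile> c0 \<^bold>: subst1 C Zero \<Longrightarrow>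
    C # NatT # \<Gamma> \<turnstile> cs \<^bold>: subst (Succ (Var 1) \<rhd> (\<lambda>n. Var (n + 2))) C \<Longrightarrow>
    \<Gamma> \<turnstile> NatRec C c0 cs Zero \<doteq> c0 \<^bold>: subst1 C Zero"
| nat_comp_succ: "NatT # \<Gamma> \<turnstile> C \<^bold>: Univ i \<Longrightarrow> \<Gamma> \<turnstile> c0 \<^bold>: subst1 C Zero \<Longrightarrow>
    C # NatT # \<Gamma> \<turnstile> cs \<^bold>: subst (Succ (Var 1) \<rhd> (\<lambda>n. Var (n + 2))) C \<Longrightarrow>
    \<Gamma> \<turnstile> n \<^bold>: NatT \<Longrightarrow>
    \<Gamma> \<turnstile> NatRec C c0 cs (Succ n) \<doteq> subst2 cs n (NatRec C c0 cs n) \<^bold>: subst1 C (Succ n)"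
| nat_succ_cong: "\<Gamma> \<turnstile> n \<doteq> n' \<^bold>: NatT \<Longrightarrow> \<Gamma> \<turnstile> Succ n \<doteq> Succ n' \<^bold>: NatT"
| nat_elim_cong: "NatT # \<Gamma> \<turnstile> C \<doteq> C' \<^bold>: Univ i \<Longrightarrow> \<Gamma> \<turnstile> c0 \<doteq> c0' \<^bold>: subst1 C Zero \<Longrightarrow>
    C # NatT # \<Gamma> \<turnstile> cs \<doteq> cs' \<^bold>: subst (Succ (Var 1) \<rhd> (\<lambda>n. Var (n + 2))) C \<Longrightarrow>
    \<Gamma> \<turnstile> n \<doteq> n' \<^bold>: NatT \<Longrightarrow>
    \<Gamma> \<turnstile> NatRec C c0 cs n \<doteq> NatRec C' c0' cs' n' \<^bold>: subst1 C n"

| id_form: "\<Gamma> \<turnstile> A \<^bold>: Univ i \<Longrightarrow> \<Gamma> \<turnstile> a \<^bold>: A \<Longrightarrow> \<Gamma> \<turnstile> b \<^bold>: A \<Longrightarrow> \<Gamma> \<turnstile> IdT A a b \<^bold>: Univ i"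
| id_intro: "\<Gamma> \<turnstile> A \<^bold>: Univ i \<Longrightarrow> \<Gamma> \<turnstile> a \<^bold>: A \<Longrightarrow> \<Gamma> \<turnstile> Refl a \<^bold>: IdT A a a"
| id_elim: "IdT (A\<up>2) (Var 1) (Var 0) # A\<up>1 # A # \<Gamma> \<turnstile> C \<^bold>: Univ i \<Longrightarrow>
    A # \<Gamma> \<turnstile> c \<^bold>: subst (Refl (Var 0) \<rhd> Var 0 \<rhd> Var 0 \<rhd> (\<lambda>n. Var (n + 1))) C \<Longrightarrow>
    \<Gamma> \<turnstile> a \<^bold>: A \<Longrightarrow> \<Gamma> \<turnstile> b \<^bold>: A \<Longrightarrow> \<Gamma> \<turnstile> p \<^bold>: IdT A a b \<Longrightarrow>
    \<Gamma> \<turnstile> IdRec C c a b p \<^bold>: subst3 C a b p"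
| id_comp: "IdT (A\<up>2) (Var 1) (Var 0) # A\<up>1 # A # \<Gamma> \<turnstile> C \<^bold>: Univ i \<Longrightarrow>
    A # \<Gamma> \<turnstile> c \<^bold>: subst (Refl (Var 0) \<rhd> Var 0 \<rhd> Var 0 \<rhd> (\<lambda>n. Var (n + 1))) C \<Longrightarrow>
    \<Gamma> \<turnstile> a \<^bold>: A \<Longrightarrow>
    \<Gamma> \<turnstile> IdRec C c a a (Refl a) \<doteq> subst1 c a \<^bold>: subst3 C a a (Refl a)"
| id_form_cong: "\<Gamma> \<turnstile> A \<doteq> A' \<^bold>: Univ i \<Longrightarrow> \<Gamma> \<turnstile> a \<doteq> a' \<^bold>: A \<Longrightarrow> \<Gamma> \<turnstile> b \<doteq> b' \<^bold>: A \<Longrightarrow>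
    \<Gamma> \<turnstile> IdT A a b \<doteq> IdT A' a' b' \<^bold>: Univ i"
| id_intro_cong: "\<Gamma> \<turnstile> A \<^bold>: Univ i \<Longrightarrow> \<Gamma> \<turnstile> a \<doteq> a' \<^bold>: A \<Longrightarrow>
    \<Gamma> \<turnstile> Refl a \<doteq> Refl a' \<^bold>: IdT A a a"
| id_elim_cong: "IdT (A\<up>2) (Var 1) (Var 0) # A\<up>1 # A # \<Gamma> \<turnstile> C \<doteq> C' \<^bold>: Univ i \<Longrightarrow>
    A # \<Gamma> \<turnstile> c \<doteq> c' \<^bold>: subst (Refl (Var 0) \<rhd> Var 0 \<rhd> Var 0 \<rhd> (\<lambda>n. Var (n + 1))) C \<Longrightarrow>
    \<Gamma> \<turnstile> a \<doteq> a' \<^bold>: A \<Longrightarrow> \<Gamma> \<turnstile> b \<doteq> b' \<^bold>: A \<Longrightarrow> \<Gamma> \<turnstile> p \<doteq> p' \<^bold>: IdT A a b \<Longrightarrow>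
    \<Gamma> \<turnstile> IdRec C c a b p \<doteq> IdRec C' c' a' b' p' \<^bold>: subst3 C a b p"


section \<open>Paths\<close>

text \<open>
  The definitions from here on are object-level terms with meta-level parameters. A parameter
  used under \<open>k\<close> binders is weakened by \<open>\<up>k\<close>.
\<close>

definition arr :: "tm \<Rightarrow> tm \<Rightarrow> tm" where
  "arr A B = PiT A (B\<up>1)"

definition path_inv :: "tm \<Rightarrow> tm \<Rightarrow> tm \<Rightarrow> tm \<Rightarrow> tm" where
  "path_inv A x y p = IdRec (IdT (A\<up>3) (Var 1) (Var 2)) (Refl (Var 0)) x y p"

text \<open>For \<open>p : x = y\<close> and \<open>q : y = z\<close>, by path induction on \<open>p\<close>.\<close>

definition path_concat :: "tm \<Rightarrow> tm \<Rightarrow> tm \<Rightarrow> tm \<Rightarrow> tm \<Rightarrow> tm \<Rightarrow> tm" where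
  "path_concat A x y z p q =
     IdRec (arr (IdT (A\<up>3) (Var 1) (z\<up>3)) (IdT (A\<up>3) (Var 2) (z\<up>3)))
       (Lam (IdT (A\<up>1) (Var 0) (z\<up>1)) (Var 0)) x y p \<bullet> q"

definition ap :: "tm \<Rightarrow> tm \<Rightarrow> tm \<Rightarrow> tm \<Rightarrow> tm \<Rightarrow> tm" where
  "ap B f x y p =
     IdRec (IdT (B\<up>3) (f\<up>3 \<bullet> Var 2) (f\<up>3 \<bullet> Var 1)) (Refl (f\<up>1 \<bullet> Var 0)) x y p"

definition transport :: "tm \<Rightarrow> tm \<Rightarrow> tm \<Rightarrow> tm \<Rightarrow> tm \<Rightarrow> tm" where
  "transport P x y p u =
     IdRec (arr (P\<up>3 \<bullet> Var 2) (P\<up>3 \<bullet> Var 1)) (Lam (P\<up>1 \<bullet> Var 0) (Var 0)) x y p \<bullet> u"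

text \<open>The right unit law, of type \<open>p \<cdot> refl = p\<close>.\<close>

definition right_unit :: "tm \<Rightarrow> tm \<Rightarrow> tm \<Rightarrow> tm \<Rightarrow> tm" where
  "right_unit A x y p =
     IdRec (IdT (IdT (A\<up>3) (Var 2) (Var 1))
              (path_concat (A\<up>3) (Var 2) (Var 1) (Var 1) (Var 0) (Refl (Var 1))) (Var 0))
       (Refl (Refl (Var 0))) x y p"

definition pr1 :: "tm \<Rightarrow> tm \<Rightarrow> tm" where
  "pr1 A p = Split (A\<up>1) (Var 1) p"

text \<open>\<open>B\<close> is a family over \<open>A\<close>, i.e. lives under one more binder than \<open>A\<close>.\<close>

definition pr2 :: "tm \<Rightarrow> tm \<Rightarrow> tm \<Rightarrow> tm" where
  "pr2 A B p = Split (subst (pr1 (A\<up>1) (Var 0) \<rhd> (\<lambda>n. Var (n + 1))) B) (Var 0) p"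


section \<open>Function extensionality\<close>

text \<open>In this section the type family \<open>B\<close> is a term of type \<open>A \<rightarrow> Univ i\<close>.\<close>

definition pi_fam :: "tm \<Rightarrow> tm \<Rightarrow> tm" where
  "pi_fam A B = PiT A (B\<up>1 \<bullet> Var 0)"

definition homotopy :: "tm \<Rightarrow> tm \<Rightarrow> tm \<Rightarrow> tm \<Rightarrow> tm" where
  "homotopy A B g h = PiT A (IdT (B\<up>1 \<bullet> Var 0) (g\<up>1 \<bullet> Var 0) (h\<up>1 \<bullet> Var 0))"

definition happly :: "tm \<Rightarrow> tm \<Rightarrow> tm \<Rightarrow> tm \<Rightarrow> tm" where
  "happly A B g h =
     Lam (IdT (pi_fam A B) g h)
       (IdRec (homotopy (A\<up>4) (B\<up>4) (Var 2) (Var 1))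
          (Lam (A\<up>2) (Refl (Var 1 \<bullet> Var 0))) (g\<up>1) (h\<up>1) (Var 0))"

text \<open>The family of a right (left) inverse: \<open>Var 0\<close> is the candidate inverse.\<close>

definition rinv_fam :: "tm \<Rightarrow> tm \<Rightarrow> tm" where
  "rinv_fam B f = PiT (B\<up>1) (IdT (B\<up>2) (f\<up>2 \<bullet> (Var 1 \<bullet> Var 0)) (Var 0))"

definition linv_fam :: "tm \<Rightarrow> tm \<Rightarrow> tm" where
  "linv_fam A f = PiT (A\<up>1) (IdT (A\<up>2) (Var 1 \<bullet> (f\<up>2 \<bullet> Var 0)) (Var 0))"

definition rinv :: "tm \<Rightarrow> tm \<Rightarrow> tm \<Rightarrow> tm" where
  "rinv A B f = SigT (arr B A) (rinv_fam B f)"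

definition linv :: "tm \<Rightarrow> tm \<Rightarrow> tm \<Rightarrow> tm" where
  "linv A B f = SigT (arr B A) (linv_fam A f)"

definition isequiv :: "tm \<Rightarrow> tm \<Rightarrow> tm \<Rightarrow> tm" where
  "isequiv A B f = SigT (rinv A B f) ((linv A B f)\<up>1)"

text \<open>
  Function extensionality for the \<open>i\<close>-th universe, saying that \<open>happly\<close> is an equivalence:
  \<open>\<Pi>(A : Univ i) (B : A \<rightarrow> Univ i) (g h : \<Pi>x. B x). isequiv (happly g h)\<close>.
\<close>

definition FunExt :: "nat \<Rightarrow> tm" where
  "FunExt i =
     PiT (Univ i) (PiT (arr (Var 0) (Univ i))
       (PiT (pi_fam (Var 1) (Var 0)) (PiT (pi_fam (Var 2) (Var 1))
         (isequiv (IdT (pi_fam (Var 3) (Var 2)) (Var 1) (Var 0))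
            (homotopy (Var 3) (Var 2) (Var 1) (Var 0))
            (happly (Var 3) (Var 2) (Var 1) (Var 0))))))"

definition funext_rinv :: "tm \<Rightarrow> tm \<Rightarrow> tm \<Rightarrow> tm \<Rightarrow> tm \<Rightarrow> tm" where
  "funext_rinv fe A B g h =
     pr1 (rinv (IdT (pi_fam A B) g h) (homotopy A B g h) (happly A B g h))
       (fe \<bullet> A \<bullet> B \<bullet> g \<bullet> h)"

text \<open>The path \<open>g = h\<close> obtained from a homotopy \<open>\<xi>\<close>.\<close>

definition funext :: "tm \<Rightarrow> tm \<Rightarrow> tm \<Rightarrow> tm \<Rightarrow> tm \<Rightarrow> tm \<Rightarrow> tm" where
  "funext fe A B g h \<xi> =
     pr1 (arr (homotopy A B g h) (IdT (pi_fam A B) g h)) (funext_rinv fe A B g h) \<bullet> \<xi>"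

text \<open>The accompanying path \<open>happly (funext \<xi>) = \<xi>\<close>.\<close>

definition happly_funext :: "tm \<Rightarrow> tm \<Rightarrow> tm \<Rightarrow> tm \<Rightarrow> tm \<Rightarrow> tm \<Rightarrow> tm" where
  "happly_funext fe A B g h \<xi> =
     pr2 (arr (homotopy A B g h) (IdT (pi_fam A B) g h))
       (rinv_fam (homotopy A B g h) (happly A B g h)) (funext_rinv fe A B g h) \<bullet> \<xi>"


section \<open>Quasi-idempotents and their splitting\<close>

definition preidem_type :: "tm \<Rightarrow> tm \<Rightarrow> tm" where
  "preidem_type X f =
     PiT X (IdT (X\<up>1) (f\<up>1 \<bullet> (f\<up>1 \<bullet> Var 0)) (f\<up>1 \<bullet> Var 0))"

definition coherence_type :: "tm \<Rightarrow> tm \<Rightarrow> tm \<Rightarrow> tm" where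
  "coherence_type X f I =
     PiT X
       (IdT (IdT (X\<up>1) (f\<up>1 \<bullet> (f\<up>1 \<bullet> (f\<up>1 \<bullet> Var 0))) (f\<up>1 \<bullet> (f\<up>1 \<bullet> Var 0)))
          (ap (X\<up>1) (f\<up>1) (f\<up>1 \<bullet> (f\<up>1 \<bullet> Var 0)) (f\<up>1 \<bullet> Var 0) (I\<up>1 \<bullet> Var 0))
          (I\<up>1 \<bullet> (f\<up>1 \<bullet> Var 0)))"

definition quasi_idempotent :: "tm list \<Rightarrow> tm \<Rightarrow> tm \<Rightarrow> tm \<Rightarrow> tm \<Rightarrow> bool" where
  "quasi_idempotent \<Gamma> X f I J \<longleftrightarrow>
     \<Gamma> \<turnstile> f \<^bold>: arr X X \<and> \<Gamma> \<turnstile> I \<^bold>: preidem_type X f \<and> \<Gamma> \<turnstile> J \<^bold>: coherence_type X f I"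

text \<open>For a sequence \<open>a : \<nat> \<rightarrow> X\<close>, the type \<open>\<Pi>n. f (a (n+1)) = a n\<close>.\<close>

definition compat :: "tm \<Rightarrow> tm \<Rightarrow> tm \<Rightarrow> tm" where
  "compat X f a =
     PiT NatT (IdT (X\<up>1) (f\<up>1 \<bullet> (a\<up>1 \<bullet> Succ (Var 0))) (a\<up>1 \<bullet> Var 0))"

definition split_type :: "tm \<Rightarrow> tm \<Rightarrow> tm" where
  "split_type X f = SigT (arr NatT X) (compat (X\<up>1) (f\<up>1) (Var 0))"

definition section_map :: "tm \<Rightarrow> tm \<Rightarrow> tm" where
  "section_map X f = Lam (split_type X f) (Split (X\<up>2) (Var 1 \<bullet> Zero) (Var 0))"

definition retraction_map :: "tm \<Rightarrow> tm \<Rightarrow> tm \<Rightarrow> tm" where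
  "retraction_map X f I =
     Lam X (Pair (Lam NatT (f\<up>2 \<bullet> Var 1)) (Lam NatT (I\<up>2 \<bullet> Var 1)))"


subsection \<open>Paths in the splitting from families of paths\<close>

text \<open>
  The type \<open>\<Pi>n. \<alpha> n \<cdot> \<xi> n = ap f (\<xi> (n+1)) \<cdot> \<gamma> n\<close> of commutativity proofs for a family
  \<open>\<xi> n : a n = c n\<close> and points \<open>(a, \<alpha>)\<close>, \<open>(c, \<gamma>)\<close> of the splitting.
\<close>

definition comm_type :: "tm \<Rightarrow> tm \<Rightarrow> tm \<Rightarrow> tm \<Rightarrow> tm \<Rightarrow> tm \<Rightarrow> tm \<Rightarrow> tm" where
  "comm_type X f a \<alpha> c \<gamma> \<xi> =
     (let X' = X\<up>1; f' = f\<up>1; n = Var 0;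
          an = a\<up>1 \<bullet> n; an1 = a\<up>1 \<bullet> Succ n; cn = c\<up>1 \<bullet> n; cn1 = c\<up>1 \<bullet> Succ n
      in PiT NatT
           (IdT (IdT X' (f' \<bullet> an1) cn)
              (path_concat X' (f' \<bullet> an1) an cn (\<alpha>\<up>1 \<bullet> n) (\<xi>\<up>1 \<bullet> n))
              (path_concat X' (f' \<bullet> an1) (f' \<bullet> cn1) cn
                 (ap X' f' an1 cn1 (\<xi>\<up>1 \<bullet> Succ n)) (\<gamma>\<up>1 \<bullet> n))))"

definition seq_happly :: "tm \<Rightarrow> tm \<Rightarrow> tm \<Rightarrow> tm" where
  "seq_happly X a c = happly NatT (Lam NatT (X\<up>1)) a c"

text \<open>
  Motive and reflexivity case of a path induction on \<open>e : a = c\<close> that proves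
  \<open>\<Pi>\<alpha> \<gamma>. (\<Pi>n. \<alpha> n \<cdot> happly e n = ap f (happly e (n+1)) \<cdot> \<gamma> n) \<rightarrow> (a, \<alpha>) = (c, \<gamma>)\<close>.
  The motive binds \<open>a, c, e\<close> and then \<open>\<alpha>, \<gamma>\<close> and the commutativity proof.
  The reflexivity case binds \<open>a, \<alpha>, \<gamma>, \<theta>\<close>, where \<open>\<theta> n\<close> has, up to judgemental equality,
  type \<open>\<alpha> n \<cdot> refl = \<gamma> n\<close>; function extensionality gives \<open>\<alpha> = \<gamma>\<close>, to which
  \<open>ap (\<lambda>\<delta>. (a, \<delta>))\<close> is applied.
\<close>

definition split_path_motive :: "tm \<Rightarrow> tm \<Rightarrow> tm" where
  "split_path_motive X f =
     PiT (compat (X\<up>3) (f\<up>3) (Var 2))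
       (PiT (compat (X\<up>4) (f\<up>4) (Var 2))
         (PiT (comm_type (X\<up>5) (f\<up>5) (Var 4) (Var 1) (Var 3) (Var 0)
                 (seq_happly (X\<up>5) (Var 4) (Var 3) \<bullet> Var 2))
           (IdT ((split_type X f)\<up>6) (Pair (Var 5) (Var 2)) (Pair (Var 4) (Var 1)))))"

definition split_path_base :: "tm \<Rightarrow> tm \<Rightarrow> tm \<Rightarrow> tm" where
  "split_path_base fe X f =
     Lam (compat (X\<up>1) (f\<up>1) (Var 0))
       (Lam (compat (X\<up>2) (f\<up>2) (Var 1))
         (Lam (comm_type (X\<up>3) (f\<up>3) (Var 2) (Var 1) (Var 2) (Var 0)
                 (seq_happly (X\<up>3) (Var 2) (Var 2) \<bullet> Refl (Var 2)))
           (ap ((split_type X f)\<up>4)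
              (Lam (compat (X\<up>4) (f\<up>4) (Var 3)) (Pair (Var 4) (Var 0)))
              (Var 2) (Var 1)
              (funext (fe\<up>4) NatT
                 (Lam NatT (IdT (X\<up>5) (f\<up>5 \<bullet> (Var 4 \<bullet> Succ (Var 0))) (Var 4 \<bullet> Var 0)))
                 (Var 2) (Var 1)
                 (Lam NatT
                    (let X' = X\<up>5; a = Var 4; \<alpha> = Var 3; \<gamma> = Var 2; \<theta> = Var 1; n = Var 0;
                         src = f\<up>5 \<bullet> (a \<bullet> Succ n); tgt = a \<bullet> n; T = IdT X' src tgt;
                         p = path_concat X' src tgt tgt (\<alpha> \<bullet> n) (Refl tgt)
                     in path_concat T (\<alpha> \<bullet> n) p (\<gamma> \<bullet> n)
                          (path_inv T p (\<alpha> \<bullet> n) (right_unit X' src tgt (\<alpha> \<bullet> n)))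
                          (\<theta> \<bullet> n)))))))"

text \<open>
  The path \<open>(a, \<alpha>) = (c, \<gamma>)\<close> given by a family \<open>\<xi>\<close> with commutativity proofs \<open>\<theta>\<close>: the path
  induction above is applied to \<open>funext \<xi>\<close>, with \<open>\<theta>\<close> transported along \<open>\<xi> = happly (funext \<xi>)\<close>.
\<close>

definition split_path ::
  "tm \<Rightarrow> tm \<Rightarrow> tm \<Rightarrow> tm \<Rightarrow> tm \<Rightarrow> tm \<Rightarrow> tm \<Rightarrow> tm \<Rightarrow> tm \<Rightarrow> tm" where
  "split_path fe X f a \<alpha> c \<gamma> \<xi> \<theta> =
     (let B = Lam NatT (X\<up>1);
          e = funext fe NatT B a c \<xi>;
          h = seq_happly X a c \<bullet> e;
          T = homotopy NatT B a c;
          P = Lam T (comm_type (X\<up>1) (f\<up>1) (a\<up>1) (\<alpha>\<up>1) (c\<up>1) (\<gamma>\<up>1) (Var 0))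
      in IdRec (split_path_motive X f) (split_path_base fe X f) a c e \<bullet> \<alpha> \<bullet> \<gamma> \<bullet>
           transport P \<xi> h (path_inv T h \<xi> (happly_funext fe NatT B a c \<xi>)) \<theta>)"


subsection \<open>The homotopy H\<close>

definition b_seq :: "tm \<Rightarrow> tm \<Rightarrow> tm" where
  "b_seq f a = Lam NatT (f\<up>1 \<bullet> (f\<up>1 \<bullet> (a\<up>1 \<bullet> Succ (Var 0))))"

definition beta_seq :: "tm \<Rightarrow> tm \<Rightarrow> tm \<Rightarrow> tm \<Rightarrow> tm" where
  "beta_seq X f a \<alpha> =
     Lam NatT
       (ap (X\<up>1) (Lam (X\<up>1) (f\<up>2 \<bullet> (f\<up>2 \<bullet> Var 0)))
          (f\<up>1 \<bullet> (a\<up>1 \<bullet> Succ (Succ (Var 0)))) (a\<up>1 \<bullet> Succ (Var 0))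
          (\<alpha>\<up>1 \<bullet> Succ (Var 0)))"

definition xi1 :: "tm \<Rightarrow> tm \<Rightarrow> tm \<Rightarrow> tm \<Rightarrow> tm \<Rightarrow> tm" where
  "xi1 X f I a \<alpha> =
     (let f' = f\<up>1; n = Var 0; an = a\<up>1 \<bullet> n; an1 = a\<up>1 \<bullet> Succ n
      in Lam NatT
           (path_concat (X\<up>1) (f' \<bullet> (f' \<bullet> an1)) (f' \<bullet> an1) an (I\<up>1 \<bullet> an1) (\<alpha>\<up>1 \<bullet> n)))"

text \<open>In the step case, \<open>n\<close> is the predecessor and \<open>ih\<close> the value of the family at \<open>n\<close>.\<close>

definition xi2 :: "tm \<Rightarrow> tm \<Rightarrow> tm \<Rightarrow> tm \<Rightarrow> tm \<Rightarrow> tm" where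
  "xi2 X f I a \<alpha> =
     Lam NatT
       (NatRec
         (IdT (X\<up>2) (f\<up>2 \<bullet> (f\<up>2 \<bullet> (a\<up>2 \<bullet> Succ (Var 0)))) (f\<up>2 \<bullet> (a\<up>2 \<bullet> Zero)))
         (ap (X\<up>1) (f\<up>1) (f\<up>1 \<bullet> (a\<up>1 \<bullet> Succ Zero)) (a\<up>1 \<bullet> Zero) (\<alpha>\<up>1 \<bullet> Zero))
         (let X' = X\<up>3; f' = f\<up>3; n = Var 1; ih = Var 0;
              fa0 = f' \<bullet> (a\<up>3 \<bullet> Zero); an1 = a\<up>3 \<bullet> Succ n; an2 = a\<up>3 \<bullet> Succ (Succ n)
          in path_concat X' (f' \<bullet> (f' \<bullet> an2)) (f' \<bullet> (f' \<bullet> an1)) fa0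
               (path_concat X' (f' \<bullet> (f' \<bullet> an2)) (f' \<bullet> an1) (f' \<bullet> (f' \<bullet> an1))
                  (ap X' f' (f' \<bullet> an2) an1 (\<alpha>\<up>3 \<bullet> Succ n))
                  (path_inv X' (f' \<bullet> (f' \<bullet> an1)) (f' \<bullet> an1) (I\<up>3 \<bullet> an1)))
               ih)
         (Var 0))"

text \<open>The components of \<open>r (s (a, \<alpha>))\<close>.\<close>

definition rs_seq :: "tm \<Rightarrow> tm \<Rightarrow> tm" where
  "rs_seq f a = Lam NatT (f\<up>1 \<bullet> (a\<up>1 \<bullet> Zero))"

definition rs_path :: "tm \<Rightarrow> tm \<Rightarrow> tm" where
  "rs_path I a = Lam NatT (I\<up>1 \<bullet> (a\<up>1 \<bullet> Zero))"

text \<open>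
  The types of the commutativity proofs for \<open>p1\<close> and \<open>p2\<close>, for all \<open>a\<close> (\<open>Var 1\<close>) and
  \<open>\<alpha>\<close> (\<open>Var 0\<close>).
\<close>

definition comm1_type :: "tm \<Rightarrow> tm \<Rightarrow> tm \<Rightarrow> tm" where
  "comm1_type X f I =
     PiT (arr NatT X) (PiT (compat (X\<up>1) (f\<up>1) (Var 0))
       (let X' = X\<up>2; f' = f\<up>2; I' = I\<up>2; a = Var 1; \<alpha> = Var 0
        in comm_type X' f' (b_seq f' a) (beta_seq X' f' a \<alpha>) a \<alpha> (xi1 X' f' I' a \<alpha>)))"

definition comm2_type :: "tm \<Rightarrow> tm \<Rightarrow> tm \<Rightarrow> tm" where
  "comm2_type X f I =
     PiT (arr NatT X) (PiT (compat (X\<up>1) (f\<up>1) (Var 0))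
       (let X' = X\<up>2; f' = f\<up>2; I' = I\<up>2; a = Var 1; \<alpha> = Var 0
        in comm_type X' f' (b_seq f' a) (beta_seq X' f' a \<alpha>) (rs_seq f' a) (rs_path I' a)
             (xi2 X' f' I' a \<alpha>)))"

definition path1 :: "tm \<Rightarrow> tm \<Rightarrow> tm \<Rightarrow> tm \<Rightarrow> tm \<Rightarrow> tm \<Rightarrow> tm \<Rightarrow> tm" where
  "path1 fe X f I c1 a \<alpha> =
     split_path fe X f (b_seq f a) (beta_seq X f a \<alpha>) a \<alpha> (xi1 X f I a \<alpha>) (c1 \<bullet> a \<bullet> \<alpha>)"

definition path2 :: "tm \<Rightarrow> tm \<Rightarrow> tm \<Rightarrow> tm \<Rightarrow> tm \<Rightarrow> tm \<Rightarrow> tm \<Rightarrow> tm" where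
  "path2 fe X f I c2 a \<alpha> =
     split_path fe X f (b_seq f a) (beta_seq X f a \<alpha>) (rs_seq f a) (rs_path I a)
       (xi2 X f I a \<alpha>) (c2 \<bullet> a \<bullet> \<alpha>)"

text \<open>\<open>H : \<Pi>(u : A). r (s u) = u\<close>, by \<open>\<Sigma>\<close>-induction, with \<open>H (a, \<alpha>) := p2\<inverse> \<cdot> p1\<close>.\<close>

definition split_htpy :: "tm \<Rightarrow> tm \<Rightarrow> tm \<Rightarrow> tm \<Rightarrow> tm \<Rightarrow> tm \<Rightarrow> tm" where
  "split_htpy fe X f I c1 c2 =
     (let A = split_type X f; s = section_map X f; r = retraction_map X f I
      in Lam A
           (Split (IdT (A\<up>2) (r\<up>2 \<bullet> (s\<up>2 \<bullet> Var 0)) (Var 0))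
             (let a = Var 1; \<alpha> = Var 0; A' = A\<up>3;
                  rs = r\<up>3 \<bullet> (s\<up>3 \<bullet> Pair a \<alpha>);
                  b = Pair (b_seq (f\<up>3) a) (beta_seq (X\<up>3) (f\<up>3) a \<alpha>);
                  p1 = path1 (fe\<up>3) (X\<up>3) (f\<up>3) (I\<up>3) (c1\<up>3) a \<alpha>;
                  p2 = path2 (fe\<up>3) (X\<up>3) (f\<up>3) (I\<up>3) (c2\<up>3) a \<alpha>
              in path_concat A' rs b (Pair a \<alpha>) (path_inv A' b rs p2) p1)
             (Var 0)))"

end

theory Submission
  imports Defs
begin

text \<open>
  At \<open>r x\<close>, the family \<open>a\<close> is constantly \<open>f x\<close> and \<open>\<alpha>\<close> constantly \<open>I x\<close>, and \<open>H (r x)\<close>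
  computes to \<open>p2\<inverse> \<cdot> p1\<close>. Applying \<open>s\<close> to a path in the splitting that is built from a family \<open>\<xi>\<close>
  gives \<open>\<xi> 0\<close>: this is a path induction on \<open>funext \<xi>\<close> followed by \<open>happly (funext \<xi>) = \<xi>\<close>, and it
  does not depend on the commutativity proofs. Hence \<open>ap s p1 = I (f x) \<cdot> I x\<close>, while
  \<open>ap s p2 = ap f (I x)\<close>, which is \<open>I (f x)\<close> by \<open>J\<close>. So \<open>ap s (p2\<inverse> \<cdot> p1)\<close> is
  \<open>I (f x)\<inverse> \<cdot> (I (f x) \<cdot> I x) = I x\<close>.

  Typing derivations are built from derived rules. Regularity of the judgements (every term in a
  derivable judgement is well-typed, every type well-formed) keeps the premises of these rules few;
  it needs that substitution preserves all judgements. Propositional equalities are only recorded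
  as inhabitedness of an identity type, so that no proof terms have to be written down.
\<close>

text \<open>The coherence \<open>J\<close> is what makes the two families match. At
  \<open>r x\<close> and index 0 the first family is \<open>I (f x)\<close> followed by
  \<open>I x\<close>, the second is \<open>ap f (I x)\<close>, and cancelling \<open>p2\<close>
  against \<open>p1\<close> requires the latter to be \<open>I (f x)\<close>.

  The commutativity proofs have types that mention the end points and the path between the
  sequences, so an induction on that path can only be carried out with \<open>\<alpha>\<close>,
  \<open>\<gamma>\<close> and the commutativity proof generalised.

  The main friction is syntactic. Terms such as \<open>path_concat\<close> and \<open>ap\<close>
  record their end points, while expressions like \<open>b 0\<close>, \<open>s (a, \<alpha>)\<close>
  or \<open>r (s u)\<close> are merely judgementally equal to what they compute to. Each comparison
  of paths therefore passes through congruence in the recorded end points and conversion of the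
  identity type. As \<Sigma> has no judgemental uniqueness rule, \<open>s\<close> and
  \<open>H\<close> compute on pairs only, and \<open>r x\<close> has to be replaced by the pair to
  which it reduces before anything can be evaluated.\<close>

section \<open>Substitution calculus\<close>

text \<open>Keeps weakenings in the form \<open>t \<up> numeral\<close>, in which the rewrite rules below are stated.\<close>

declare One_nat_def [simp del] add_2_eq_Suc [simp del] add_2_eq_Suc' [simp del]

lemma up_ren_Suc' [simp]: "up_ren \<rho> (n + 1) = \<rho> n + 1"
  by (simp flip: Suc_eq_plus1)

text \<open>Composed shifts leave arguments \<open>n + k\<close> with a literal \<open>k\<close>. As
  literals are kept from unfolding to \<open>Suc\<close>, the defining equations of
  \<open>\<rhd>\<close> would not match them.\<close>

lemma scons_add [simp]:
  "(t \<rhd> \<sigma>) (n + 1) = \<sigma> n"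
  "(t \<rhd> \<sigma>) (n + numeral k) = \<sigma> (n + pred_numeral k)"
  "(t \<rhd> \<sigma>) (numeral k + n) = \<sigma> (pred_numeral k + n)"
  by (simp_all add: numeral_eq_Suc flip: Suc_eq_plus1)

lemma up_ren_comp: "up_ren \<rho> \<circ> up_ren \<rho>' = up_ren (\<rho> \<circ> \<rho>')"
proof
  fix n show "(up_ren \<rho> \<circ> up_ren \<rho>') n = up_ren (\<rho> \<circ> \<rho>') n" by (cases n) auto
qed

text \<open>First rung of a ladder of composition laws: since \<open>up\<close> is itself defined by
  renaming, passing under a binder in the laws that involve substitution relies on the laws for
  renaming.\<close>

lemma rename_rename: "rename \<rho> (rename \<rho>' t) = rename (\<rho> \<circ> \<rho>') t"
  by (induction t arbitrary: \<rho> \<rho>') (simp_all add: up_ren_comp)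

lemma up_comp_ren: "up \<sigma> \<circ> up_ren \<rho> = up (\<sigma> \<circ> \<rho>)"
proof
  fix n show "(up \<sigma> \<circ> up_ren \<rho>) n = up (\<sigma> \<circ> \<rho>) n" by (cases n) (auto simp: up_def)
qed

lemma subst_rename: "subst \<sigma> (rename \<rho> t) = subst (\<sigma> \<circ> \<rho>) t"
  by (induction t arbitrary: \<sigma> \<rho>) (simp_all add: up_comp_ren)

lemma ren_comp_up: "rename (up_ren \<rho>) \<circ> up \<sigma> = up (rename \<rho> \<circ> \<sigma>)"
proof
  fix n show "(rename (up_ren \<rho>) \<circ> up \<sigma>) n = up (rename \<rho> \<circ> \<sigma>) n"
    by (cases n) (auto simp: up_def weaken_def rename_rename comp_def)
qed

lemma rename_subst: "rename \<rho> (subst \<sigma> t) = subst (rename \<rho> \<circ> \<sigma>) t"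
  by (induction t arbitrary: \<sigma> \<rho>) (simp_all add: ren_comp_up)

lemma subst_comp_up: "subst (up \<sigma>) \<circ> up \<tau> = up (subst \<sigma> \<circ> \<tau>)"
proof
  fix n show "(subst (up \<sigma>) \<circ> up \<tau>) n = up (subst \<sigma> \<circ> \<tau>) n"
    by (cases n) (auto simp: up_def weaken_def subst_rename rename_subst comp_def)
qed

text \<open>The induction uses function composition; the exported form exposes the index, so that
  the composite can be computed variable by variable.\<close>

lemma subst_subst: "subst \<sigma> (subst \<tau> t) = subst (\<lambda>n. subst \<sigma> (\<tau> n)) t"
proof -
  have "subst \<sigma> (subst \<tau> t) = subst (subst \<sigma> \<circ> \<tau>) t"
    by (induction t arbitrary: \<sigma> \<tau>) (simp_all add: subst_comp_up)
  then show ?thesis by (simp add: comp_def)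
qed

lemma up_Var: "up Var = Var"
proof
  fix n show "up Var n = Var n" by (cases n) (auto simp: up_def weaken_def)
qed

lemma subst_Var [simp]: "subst Var t = t"
  by (induction t) (simp_all add: up_Var)

lemma up_ren_eq_up: "up (\<lambda>n. Var (\<rho> n)) = (\<lambda>n. Var (up_ren \<rho> n))"
proof
  fix n show "up (\<lambda>n. Var (\<rho> n)) n = Var (up_ren \<rho> n)"
    by (cases n) (auto simp: up_def weaken_def)
qed

text \<open>From here on renaming is absorbed into substitution, and \<open>subst_subst\<close>
  serves as the single composition law.\<close>

lemma rename_eq_subst: "rename \<rho> t = subst (\<lambda>n. Var (\<rho> n)) t"
  by (induction t arbitrary: \<rho>) (simp_all add: up_ren_eq_up)

section \<open>Weakening as a substitution, and its normal forms\<close>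

lemma weaken_eq_subst: "t \<up> k = subst (\<lambda>n. Var (n + k)) t"
  by (simp add: weaken_def rename_eq_subst)

lemma weaken_0 [simp]: "t \<up> 0 = t"
  by (simp add: weaken_eq_subst)

lemma weaken_weaken [simp]: "t \<up> k \<up> m = t \<up> (k + m)"
  by (simp add: weaken_eq_subst subst_subst add.assoc)

lemma subst_weaken: "subst \<sigma> (t \<up> k) = subst (\<lambda>n. \<sigma> (n + k)) t"
  by (simp add: weaken_eq_subst subst_subst)

lemma up_0 [simp]: "up \<sigma> 0 = Var 0"
  by (simp add: up_def)

lemma up_Suc [simp]: "up \<sigma> (Suc n) = \<sigma> n \<up> 1"
  by (simp add: up_def)

lemma up_numeral [simp]: "up \<sigma> (numeral n) = \<sigma> (pred_numeral n) \<up> 1"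
  by (simp add: numeral_eq_Suc)

lemma up_1 [simp]: "up \<sigma> 1 = \<sigma> 0 \<up> 1"
  by (simp add: One_nat_def)

lemma up_add [simp]:
  "up \<sigma> (n + 1) = \<sigma> n \<up> 1"
  "up \<sigma> (n + numeral k) = \<sigma> (n + pred_numeral k) \<up> 1"
  "up \<sigma> (numeral k + n) = \<sigma> (pred_numeral k + n) \<up> 1"
  by (simp_all add: numeral_eq_Suc flip: Suc_eq_plus1)

lemma scons_numeral [simp]: "(t \<rhd> \<sigma>) (numeral n) = \<sigma> (pred_numeral n)"
  by (simp add: numeral_eq_Suc)

lemma scons_1 [simp]: "(t \<rhd> \<sigma>) 1 = \<sigma> 0"
  by (simp add: One_nat_def)

lemma subst_scons_weaken_Suc: "subst (a \<rhd> \<sigma>) (t \<up> Suc k) = subst \<sigma> (t \<up> k)"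
  by (simp add: subst_weaken)

lemma subst_up_weaken_Suc: "subst (up \<sigma>) (t \<up> Suc k) = (subst \<sigma> (t \<up> k)) \<up> 1"
  by (simp add: subst_weaken) (simp add: weaken_eq_subst subst_subst)

text \<open>Each use cancels one substituted term against one unit of a literal shift, so that
  \<open>X\<up>5\<close> returns to \<open>X\<close> once five variables have been
  instantiated.\<close>

lemma subst_scons_weaken [simp]:
  "subst (a \<rhd> \<sigma>) (t \<up> numeral k) = subst \<sigma> (t \<up> pred_numeral k)"
  "subst (a \<rhd> \<sigma>) (t \<up> 1) = subst \<sigma> t"
  using subst_scons_weaken_Suc[of a \<sigma> t 0]
  by (simp_all add: numeral_eq_Suc subst_scons_weaken_Suc One_nat_def)

lemma subst_up_weaken [simp]:
  "subst (up \<sigma>) (t \<up> numeral k) = (subst \<sigma> (t \<up> pred_numeral k)) \<up> 1"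
  "subst (up \<sigma>) (t \<up> 1) = (subst \<sigma> t) \<up> 1"
  using subst_up_weaken_Suc[of \<sigma> t 0]
  by (simp_all add: numeral_eq_Suc subst_up_weaken_Suc One_nat_def)

lemma subst_shift [simp]: "subst (\<lambda>n. Var (n + k)) t = t \<up> k"
  by (simp add: weaken_eq_subst)

text \<open>Under a binder the bound variable must stay fixed, so the body receives the lifted shift
  instead of a weakening.\<close>

lemma weaken_simps [simp]:
  "Var n \<up> k = Var (n + k)"
  "Univ i \<up> k = Univ i"
  "(PiT A B) \<up> k = PiT (A \<up> k) (subst (up (\<lambda>n. Var (n + k))) B)"
  "(Lam A b) \<up> k = Lam (A \<up> k) (subst (up (\<lambda>n. Var (n + k))) b)"
  "(f \<bullet> a) \<up> k = (f \<up> k) \<bullet> (a \<up> k)"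
  "(SigT A B) \<up> k = SigT (A \<up> k) (subst (up (\<lambda>n. Var (n + k))) B)"
  "(Pair a b) \<up> k = Pair (a \<up> k) (b \<up> k)"
  "(Split C g p) \<up> k = Split (subst (up (\<lambda>n. Var (n + k))) C)
     (subst (up (up (\<lambda>n. Var (n + k)))) g) (p \<up> k)"
  "NatT \<up> k = NatT"
  "Zero \<up> k = Zero"
  "Succ t \<up> k = Succ (t \<up> k)"
  "(NatRec C c0 cs t) \<up> k = NatRec (subst (up (\<lambda>n. Var (n + k))) C) (c0 \<up> k)
     (subst (up (up (\<lambda>n. Var (n + k)))) cs) (t \<up> k)"
  "(IdT A a b) \<up> k = IdT (A \<up> k) (a \<up> k) (b \<up> k)"
  "(Refl a) \<up> k = Refl (a \<up> k)"
  "(IdRec C c a b p) \<up> k = IdRec (subst (up (up (up (\<lambda>n. Var (n + k))))) C)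
     (subst (up (\<lambda>n. Var (n + k))) c) (a \<up> k) (b \<up> k) (p \<up> k)"
  by (simp_all add: weaken_eq_subst del: subst_shift)

lemma subst_eqI: "(\<And>n. \<sigma> n = \<tau> n) \<Longrightarrow> subst \<sigma> t = subst \<tau> t"
  by presburger

text \<open>Reduces an interchange of two substitutions to a check on variables, where only finitely
  many bound indices behave specially.\<close>

lemma subst_subst_eqI: "(\<And>n. subst \<sigma> (\<tau> n) = subst \<sigma>' (\<tau>' n)) \<Longrightarrow>
    subst \<sigma> (subst \<tau> t) = subst \<sigma>' (subst \<tau>' t)"
  by (simp add: subst_subst)

text \<open>Three is the largest number of variables bound at once, namely by the motive of
  \<open>IdRec\<close>.\<close>

lemma nat_cases3: "n = 0 \<or> n = 1 \<or> n = 2 \<or> (\<exists>m. n = Suc (Suc (Suc m)))"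
  by (metis One_nat_def not0_implies_Suc numeral_2_eq_2)

lemma subst_subst1: "subst \<sigma> (subst1 B a) = subst1 (subst (up \<sigma>) B) (subst \<sigma> a)"
  unfolding subst1_def
proof (rule subst_subst_eqI)
  fix n show "subst \<sigma> ((a \<rhd> Var) n) = subst (subst \<sigma> a \<rhd> Var) (up \<sigma> n)"
    by (cases n) simp_all
qed

lemma subst_subst2:
  "subst \<sigma> (subst2 B a b) = subst2 (subst (up (up \<sigma>)) B) (subst \<sigma> a) (subst \<sigma> b)"
  unfolding subst2_def
proof (rule subst_subst_eqI)
  fix n show "subst \<sigma> ((b \<rhd> a \<rhd> Var) n) =
    subst (subst \<sigma> b \<rhd> subst \<sigma> a \<rhd> Var) (up (up \<sigma>) n)"
    using nat_cases3[of n] by auto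
qed

lemma subst_subst3:
  "subst \<sigma> (subst3 B a b c) =
    subst3 (subst (up (up (up \<sigma>))) B) (subst \<sigma> a) (subst \<sigma> b) (subst \<sigma> c)"
  unfolding subst3_def
proof (rule subst_subst_eqI)
  fix n show "subst \<sigma> ((c \<rhd> b \<rhd> a \<rhd> Var) n) =
    subst (subst \<sigma> c \<rhd> subst \<sigma> b \<rhd> subst \<sigma> a \<rhd> Var) (up (up (up \<sigma>)) n)"
    using nat_cases3[of n] by auto
qed

text \<open>The branch of \<open>sig_elim\<close> is typed at the motive instantiated by the pair of
  its two bound variables; stability of the rule needs substitution to commute with this. The
  analogous facts for \<open>nat_elim\<close> and \<open>id_elim\<close> follow.\<close>

lemma subst_pair_inst:
  "subst (up (up \<sigma>)) (subst (Pair (Var 1) (Var 0) \<rhd> (\<lambda>n. Var (n + 2))) C) =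
    subst (Pair (Var 1) (Var 0) \<rhd> (\<lambda>n. Var (n + 2))) (subst (up \<sigma>) C)"
proof (rule subst_subst_eqI)
  fix n show "subst (up (up \<sigma>)) ((Pair (Var 1) (Var 0) \<rhd> (\<lambda>n. Var (n + 2))) n) =
    subst (Pair (Var 1) (Var 0) \<rhd> (\<lambda>n. Var (n + 2))) (up \<sigma> n)"
    by (cases n) simp_all
qed

lemma subst_succ_inst:
  "subst (up (up \<sigma>)) (subst (Succ (Var 1) \<rhd> (\<lambda>n. Var (n + 2))) C) =
    subst (Succ (Var 1) \<rhd> (\<lambda>n. Var (n + 2))) (subst (up \<sigma>) C)"
proof (rule subst_subst_eqI)
  fix n show "subst (up (up \<sigma>)) ((Succ (Var 1) \<rhd> (\<lambda>n. Var (n + 2))) n) =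
    subst (Succ (Var 1) \<rhd> (\<lambda>n. Var (n + 2))) (up \<sigma> n)"
    by (cases n) simp_all
qed

lemma subst_refl_inst:
  "subst (up \<sigma>) (subst (Refl (Var 0) \<rhd> Var 0 \<rhd> Var 0 \<rhd> (\<lambda>n. Var (n + 1))) C) =
    subst (Refl (Var 0) \<rhd> Var 0 \<rhd> Var 0 \<rhd> (\<lambda>n. Var (n + 1))) (subst (up (up (up \<sigma>))) C)"
proof (rule subst_subst_eqI)
  fix n show "subst (up \<sigma>) ((Refl (Var 0) \<rhd> Var 0 \<rhd> Var 0 \<rhd> (\<lambda>n. Var (n + 1))) n) =
    subst (Refl (Var 0) \<rhd> Var 0 \<rhd> Var 0 \<rhd> (\<lambda>n. Var (n + 1))) (up (up (up \<sigma>)) n)"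
    using nat_cases3[of n] by auto
qed

section \<open>Substitution preserves the judgements\<close>

lemma wf_ctx_Cons: "wf_ctx (A # \<Gamma>) \<longleftrightarrow> (\<exists>i. \<Gamma> \<turnstile> A \<^bold>: Univ i)"
  by (auto elim: wf_ctx.cases intro: ctx_extend)

text \<open>Generalised to all tails because rules such as \<open>pi_intro\<close> have premises in
  the extended context only, of which the context of the conclusion is a tail.\<close>

lemma wf_drop_of_jdg:
  "wf_ctx \<Gamma> \<Longrightarrow> wf_ctx (drop k \<Gamma>)"
  "\<Gamma> \<turnstile> a \<^bold>: A \<Longrightarrow> wf_ctx (drop k \<Gamma>)"
  "\<Gamma> \<turnstile> a \<doteq> b \<^bold>: A \<Longrightarrow> wf_ctx (drop k \<Gamma>)"
  apply (induction arbitrary: k and k and k rule: wf_ctx_has_type_jdg_eq.inducts)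
  apply simp_all
    apply (rule ctx_empty)
   apply (metis ctx_extend drop0 drop_Suc_Cons not0_implies_Suc)
  apply (metis drop_Suc_Cons)
  done

lemma wf_of_jdg:
  "\<Gamma> \<turnstile> a \<^bold>: A \<Longrightarrow> wf_ctx \<Gamma>" "\<Gamma> \<turnstile> a \<doteq> b \<^bold>: A \<Longrightarrow> wf_ctx \<Gamma>"
  using wf_drop_of_jdg(2,3) by (metis drop0)+

lemma wf_ctx_tail: "wf_ctx (A # \<Gamma>) \<Longrightarrow> wf_ctx \<Gamma>"
  using wf_ctx_Cons wf_of_jdg(1) by blast

text \<open>Supplies the premise of \<open>ok_up\<close> whenever a substitution is lifted over a
  declaration of the context.\<close>

primrec ctx_stable :: "(tm list \<Rightarrow> (nat \<Rightarrow> tm) \<Rightarrow> tm list \<Rightarrow> bool) \<Rightarrow> tm list \<Rightarrow> bool" where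
  "ctx_stable ok [] \<longleftrightarrow> True"
| "ctx_stable ok (A # \<Gamma>) \<longleftrightarrow>
     ctx_stable ok \<Gamma> \<and> (\<forall>\<Delta> \<sigma>. ok \<Delta> \<sigma> \<Gamma> \<longrightarrow> (\<exists>i. \<Delta> \<turnstile> subst \<sigma> A \<^bold>: Univ i))"

definition ty_stable :: "(tm list \<Rightarrow> (nat \<Rightarrow> tm) \<Rightarrow> tm list \<Rightarrow> bool) \<Rightarrow> tm list \<Rightarrow> tm \<Rightarrow> tm \<Rightarrow> bool" where
  "ty_stable ok \<Gamma> a A \<longleftrightarrow> ctx_stable ok \<Gamma> \<and> (\<forall>\<Delta> \<sigma>. ok \<Delta> \<sigma> \<Gamma> \<longrightarrow> \<Delta> \<turnstile> subst \<sigma> a \<^bold>: subst \<sigma> A)"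

definition eq_stable ::
  "(tm list \<Rightarrow> (nat \<Rightarrow> tm) \<Rightarrow> tm list \<Rightarrow> bool) \<Rightarrow> tm list \<Rightarrow> tm \<Rightarrow> tm \<Rightarrow> tm \<Rightarrow> bool" where
  "eq_stable ok \<Gamma> a b A \<longleftrightarrow>
     ctx_stable ok \<Gamma> \<and> (\<forall>\<Delta> \<sigma>. ok \<Delta> \<sigma> \<Gamma> \<longrightarrow> \<Delta> \<turnstile> subst \<sigma> a \<doteq> subst \<sigma> b \<^bold>: subst \<sigma> A)"

text \<open>
  The substitution lemma is proved for any class \<open>ok\<close> of well-typed substitutions closed under
  \<open>up\<close>, so that one induction serves first for renamings and then, once weakening is available,
  for all substitutions. Contexts are part of the induction since several congruence rules lack
  a premise that the type of a bound variable is well-formed.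
\<close>

locale subst_class =
  fixes ok :: "tm list \<Rightarrow> (nat \<Rightarrow> tm) \<Rightarrow> tm list \<Rightarrow> bool"
  assumes ok_var: "ok \<Delta> \<sigma> \<Gamma> \<Longrightarrow> n < length \<Gamma> \<Longrightarrow> \<Delta> \<turnstile> \<sigma> n \<^bold>: subst \<sigma> ((\<Gamma> ! n) \<up> Suc n)"
    and ok_wf: "ok \<Delta> \<sigma> \<Gamma> \<Longrightarrow> wf_ctx \<Delta>"
    and ok_up: "ok \<Delta> \<sigma> \<Gamma> \<Longrightarrow> \<Delta> \<turnstile> subst \<sigma> A \<^bold>: Univ i \<Longrightarrow> ok (subst \<sigma> A # \<Delta>) (up \<sigma>) (A # \<Gamma>)"
begin

lemma up1: "ctx_stable ok (A # \<Gamma>) \<Longrightarrow> ok \<Delta> \<sigma> \<Gamma> \<Longrightarrow> ok (subst \<sigma> A # \<Delta>) (up \<sigma>) (A # \<Gamma>)"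
  using ok_up by (metis ctx_stable.simps(2))

lemma up2: "ctx_stable ok (B # A # \<Gamma>) \<Longrightarrow> ok \<Delta> \<sigma> \<Gamma> \<Longrightarrow>
    ok (subst (up \<sigma>) B # subst \<sigma> A # \<Delta>) (up (up \<sigma>)) (B # A # \<Gamma>)"
  by (metis up1 ctx_stable.simps(2))

text \<open>Gives the substituted context of an identity motive in the normal form that
  \<open>id_elim\<close> expects.\<close>

lemma up3: "ctx_stable ok (IdT (A\<up>2) (Var 1) (Var 0) # A\<up>1 # A # \<Gamma>) \<Longrightarrow> ok \<Delta> \<sigma> \<Gamma> \<Longrightarrow>
    ok (IdT (subst \<sigma> A\<up>2) (Var 1) (Var 0) # subst \<sigma> A\<up>1 # subst \<sigma> A # \<Delta>) (up (up (up \<sigma>)))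
      (IdT (A\<up>2) (Var 1) (Var 0) # A\<up>1 # A # \<Gamma>)"
  using up1[of "IdT (A\<up>2) (Var 1) (Var 0)" "A\<up>1 # A # \<Gamma>" "subst \<sigma> A\<up>1 # subst \<sigma> A # \<Delta>" "up (up \<sigma>)"]
    up2[of "A\<up>1" A \<Gamma> \<Delta> \<sigma>] by (simp del: ctx_stable.simps) (simp)

lemma ty_stableD0: "ty_stable ok \<Gamma> b B \<Longrightarrow> ok \<Delta> \<sigma> \<Gamma> \<Longrightarrow>
    \<Delta> \<turnstile> subst \<sigma> b \<^bold>: subst \<sigma> B"
  using ok_wf unfolding ty_stable_def by blast

lemma ty_stableD1: "ty_stable ok (A # \<Gamma>) b B \<Longrightarrow> ok \<Delta> \<sigma> \<Gamma> \<Longrightarrow>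
    subst \<sigma> A # \<Delta> \<turnstile> subst (up \<sigma>) b \<^bold>: subst (up \<sigma>) B"
  using up1 unfolding ty_stable_def by blast

lemma ty_stableD2: "ty_stable ok (C # A # \<Gamma>) b B \<Longrightarrow> ok \<Delta> \<sigma> \<Gamma> \<Longrightarrow>
    subst (up \<sigma>) C # subst \<sigma> A # \<Delta> \<turnstile> subst (up (up \<sigma>)) b \<^bold>: subst (up (up \<sigma>)) B"
  using up2 unfolding ty_stable_def by blast

lemma ty_stableD3: "ty_stable ok (IdT (A\<up>2) (Var 1) (Var 0) # A\<up>1 # A # \<Gamma>) b B \<Longrightarrow> ok \<Delta> \<sigma> \<Gamma> \<Longrightarrow>
    IdT (subst \<sigma> A\<up>2) (Var 1) (Var 0) # subst \<sigma> A\<up>1 # subst \<sigma> A # \<Delta> \<turnstile> subst (up (up (up \<sigma>))) b \<^bold>: subst (up (up (up \<sigma>))) B"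
  using up3 unfolding ty_stable_def by blast

lemma eq_stableD0: "eq_stable ok \<Gamma> a b B \<Longrightarrow> ok \<Delta> \<sigma> \<Gamma> \<Longrightarrow>
    \<Delta> \<turnstile> subst \<sigma> a \<doteq> subst \<sigma> b \<^bold>: subst \<sigma> B"
  using ok_wf unfolding eq_stable_def by blast

lemma eq_stableD1: "eq_stable ok (A # \<Gamma>) a b B \<Longrightarrow> ok \<Delta> \<sigma> \<Gamma> \<Longrightarrow>
    subst \<sigma> A # \<Delta> \<turnstile> subst (up \<sigma>) a \<doteq> subst (up \<sigma>) b \<^bold>: subst (up \<sigma>) B"
  using up1 unfolding eq_stable_def by blast

lemma eq_stableD2: "eq_stable ok (C # A # \<Gamma>) a b B \<Longrightarrow> ok \<Delta> \<sigma> \<Gamma> \<Longrightarrow>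
    subst (up \<sigma>) C # subst \<sigma> A # \<Delta> \<turnstile> subst (up (up \<sigma>)) a \<doteq> subst (up (up \<sigma>)) b \<^bold>: subst (up (up \<sigma>)) B"
  using up2 unfolding eq_stable_def by blast

lemma eq_stableD3: "eq_stable ok (IdT (A\<up>2) (Var 1) (Var 0) # A\<up>1 # A # \<Gamma>) a b B \<Longrightarrow> ok \<Delta> \<sigma> \<Gamma> \<Longrightarrow>
    IdT (subst \<sigma> A\<up>2) (Var 1) (Var 0) # subst \<sigma> A\<up>1 # subst \<sigma> A # \<Delta> \<turnstile> subst (up (up (up \<sigma>))) a \<doteq> subst (up (up (up \<sigma>))) b \<^bold>: subst (up (up (up \<sigma>))) B"
  using up3 unfolding eq_stable_def by blast

lemma ty_stableI: "ctx_stable ok \<Gamma> \<Longrightarrow> (\<And>\<Delta> \<sigma>. ok \<Delta> \<sigma> \<Gamma> \<Longrightarrow> \<Delta> \<turnstile> subst \<sigma> a \<^bold>: subst \<sigma> A) \<Longrightarrow> ty_stable ok \<Gamma> a A"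
  by (simp add: ty_stable_def)

lemma eq_stableI: "ctx_stable ok \<Gamma> \<Longrightarrow> (\<And>\<Delta> \<sigma>. ok \<Delta> \<sigma> \<Gamma> \<Longrightarrow> \<Delta> \<turnstile> subst \<sigma> a \<doteq> subst \<sigma> b \<^bold>: subst \<sigma> A) \<Longrightarrow>
    eq_stable ok \<Gamma> a b A"
  by (simp add: eq_stable_def)

lemma ctx_stable_of:
  "ty_stable ok \<Gamma> a A \<Longrightarrow> ctx_stable ok \<Gamma>"
  "eq_stable ok \<Gamma> a b A \<Longrightarrow> ctx_stable ok \<Gamma>"
  "ctx_stable ok (A # \<Gamma>) \<Longrightarrow> ctx_stable ok \<Gamma>"
  by (simp_all add: ty_stable_def eq_stable_def)

text \<open>Every rule is stable because a substitution instance of it is again the same rule: the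
  equations in \<open>S\<close> move the substitution through the instantiated motives. Stability of
  the context is read off a premise, with \<open>C(3)\<close> removing the variables that the
  premise binds.\<close>

lemma jdg_stable:
  "wf_ctx \<Gamma> \<Longrightarrow> ctx_stable ok \<Gamma>"
  "\<Gamma> \<turnstile> a \<^bold>: A \<Longrightarrow> ty_stable ok \<Gamma> a A"
  "\<Gamma> \<turnstile> a \<doteq> b \<^bold>: A \<Longrightarrow> eq_stable ok \<Gamma> a b A"
proof (induction rule: wf_ctx_has_type_jdg_eq.inducts)
  note S = subst.simps subst_subst1 subst_subst2 subst_subst3 subst_pair_inst subst_succ_inst
    subst_refl_inst subst_up_weaken up_0
  note C = ctx_stable_of
  {
    case ctx_empty show ?case by simp
  next
    case ctx_extend then show ?case by (auto simp: ty_stable_def)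
  next
    case var then show ?case using ok_var by (auto intro: ty_stableI)
  next
    case conv show ?case
      by (rule ty_stableI[OF C(2)[OF conv.IH(2)]], (unfold S)?, rule wf_ctx_has_type_jdg_eq.conv[OF
        ty_stableD0[OF conv.IH(1), unfolded S]
        eq_stableD0[OF conv.IH(2), unfolded S]])
  next
    case eq_conv show ?case
      by (rule eq_stableI[OF C(2)[OF eq_conv.IH(2)]], (unfold S)?, rule wf_ctx_has_type_jdg_eq.eq_conv[OF
        eq_stableD0[OF eq_conv.IH(1), unfolded S]
        eq_stableD0[OF eq_conv.IH(2), unfolded S]])
  next
    case eq_refl show ?case
      by (rule eq_stableI[OF C(1)[OF eq_refl.IH(1)]], (unfold S)?, rule wf_ctx_has_type_jdg_eq.eq_refl[OF
        ty_stableD0[OF eq_refl.IH(1), unfolded S]])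
  next
    case eq_sym show ?case
      by (rule eq_stableI[OF C(2)[OF eq_sym.IH(1)]], (unfold S)?, rule wf_ctx_has_type_jdg_eq.eq_sym[OF
        eq_stableD0[OF eq_sym.IH(1), unfolded S]])
  next
    case eq_trans show ?case
      by (rule eq_stableI[OF C(2)[OF eq_trans.IH(2)]], (unfold S)?, rule wf_ctx_has_type_jdg_eq.eq_trans[OF
        eq_stableD0[OF eq_trans.IH(1), unfolded S]
        eq_stableD0[OF eq_trans.IH(2), unfolded S]])
  next
    case univ then show ?case by (auto simp: ty_stable_def intro!: wf_ctx_has_type_jdg_eq.univ intro: ok_wf)
  next
    case cumul show ?case
      by (rule ty_stableI[OF C(1)[OF cumul.IH(1)]], (unfold S)?, rule wf_ctx_has_type_jdg_eq.cumul[OF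
        ty_stableD0[OF cumul.IH(1), unfolded S]])
  next
    case eq_cumul show ?case
      by (rule eq_stableI[OF C(2)[OF eq_cumul.IH(1)]], (unfold S)?, rule wf_ctx_has_type_jdg_eq.eq_cumul[OF
        eq_stableD0[OF eq_cumul.IH(1), unfolded S]])
  next
    case pi_form show ?case
      by (rule ty_stableI[OF C(3)[OF C(1)[OF pi_form.IH(2)]]], (unfold S)?, rule wf_ctx_has_type_jdg_eq.pi_form[OF
        ty_stableD0[OF pi_form.IH(1), unfolded S]
        ty_stableD1[OF pi_form.IH(2), unfolded S]])
  next
    case pi_intro show ?case
      by (rule ty_stableI[OF C(3)[OF C(1)[OF pi_intro.IH(1)]]], (unfold S)?, rule wf_ctx_has_type_jdg_eq.pi_intro[OF
        ty_stableD1[OF pi_intro.IH(1), unfolded S]])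
  next
    case pi_elim show ?case
      by (rule ty_stableI[OF C(1)[OF pi_elim.IH(2)]], (unfold S)?, rule wf_ctx_has_type_jdg_eq.pi_elim[OF
        ty_stableD0[OF pi_elim.IH(1), unfolded S]
        ty_stableD0[OF pi_elim.IH(2), unfolded S]])
  next
    case pi_comp show ?case
      by (rule eq_stableI[OF C(1)[OF pi_comp.IH(2)]], (unfold S)?, rule wf_ctx_has_type_jdg_eq.pi_comp[OF
        ty_stableD1[OF pi_comp.IH(1), unfolded S]
        ty_stableD0[OF pi_comp.IH(2), unfolded S]])
  next
    case pi_uniq show ?case
      by (rule eq_stableI[OF C(1)[OF pi_uniq.IH(1)]], (unfold S)?, rule wf_ctx_has_type_jdg_eq.pi_uniq[OF
        ty_stableD0[OF pi_uniq.IH(1), unfolded S]])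
  next
    case pi_form_cong show ?case
      by (rule eq_stableI[OF C(3)[OF C(2)[OF pi_form_cong.IH(2)]]], (unfold S)?, rule wf_ctx_has_type_jdg_eq.pi_form_cong[OF
        eq_stableD0[OF pi_form_cong.IH(1), unfolded S]
        eq_stableD1[OF pi_form_cong.IH(2), unfolded S]])
  next
    case pi_intro_cong show ?case
      by (rule eq_stableI[OF C(3)[OF C(2)[OF pi_intro_cong.IH(2)]]], (unfold S)?, rule wf_ctx_has_type_jdg_eq.pi_intro_cong[OF
        eq_stableD0[OF pi_intro_cong.IH(1), unfolded S]
        eq_stableD1[OF pi_intro_cong.IH(2), unfolded S]])
  next
    case pi_elim_cong show ?case
      by (rule eq_stableI[OF C(2)[OF pi_elim_cong.IH(2)]], (unfold S)?, rule wf_ctx_has_type_jdg_eq.pi_elim_cong[OF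
        eq_stableD0[OF pi_elim_cong.IH(1), unfolded S]
        eq_stableD0[OF pi_elim_cong.IH(2), unfolded S]])
  next
    case sig_form show ?case
      by (rule ty_stableI[OF C(3)[OF C(1)[OF sig_form.IH(2)]]], (unfold S)?, rule wf_ctx_has_type_jdg_eq.sig_form[OF
        ty_stableD0[OF sig_form.IH(1), unfolded S]
        ty_stableD1[OF sig_form.IH(2), unfolded S]])
  next
    case sig_intro show ?case
      by (rule ty_stableI[OF C(1)[OF sig_intro.IH(3)]], (unfold S)?, rule wf_ctx_has_type_jdg_eq.sig_intro[OF
        ty_stableD1[OF sig_intro.IH(1), unfolded S]
        ty_stableD0[OF sig_intro.IH(2), unfolded S]
        ty_stableD0[OF sig_intro.IH(3), unfolded S]])
  next
    case sig_elim show ?case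
      by (rule ty_stableI[OF C(1)[OF sig_elim.IH(3)]], (unfold S)?, rule wf_ctx_has_type_jdg_eq.sig_elim[OF
        ty_stableD1[OF sig_elim.IH(1), unfolded S]
        ty_stableD2[OF sig_elim.IH(2), unfolded S]
        ty_stableD0[OF sig_elim.IH(3), unfolded S]])
  next
    case sig_comp show ?case
      by (rule eq_stableI[OF C(1)[OF sig_comp.IH(4)]], (unfold S)?, rule wf_ctx_has_type_jdg_eq.sig_comp[OF
        ty_stableD1[OF sig_comp.IH(1), unfolded S]
        ty_stableD2[OF sig_comp.IH(2), unfolded S]
        ty_stableD0[OF sig_comp.IH(3), unfolded S]
        ty_stableD0[OF sig_comp.IH(4), unfolded S]])
  next
    case sig_form_cong show ?case
      by (rule eq_stableI[OF C(3)[OF C(2)[OF sig_form_cong.IH(2)]]], (unfold S)?, rule wf_ctx_has_type_jdg_eq.sig_form_cong[OF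
        eq_stableD0[OF sig_form_cong.IH(1), unfolded S]
        eq_stableD1[OF sig_form_cong.IH(2), unfolded S]])
  next
    case sig_intro_cong show ?case
      by (rule eq_stableI[OF C(2)[OF sig_intro_cong.IH(3)]], (unfold S)?, rule wf_ctx_has_type_jdg_eq.sig_intro_cong[OF
        ty_stableD1[OF sig_intro_cong.IH(1), unfolded S]
        eq_stableD0[OF sig_intro_cong.IH(2), unfolded S]
        eq_stableD0[OF sig_intro_cong.IH(3), unfolded S]])
  next
    case sig_elim_cong show ?case
      by (rule eq_stableI[OF C(2)[OF sig_elim_cong.IH(3)]], (unfold S)?, rule wf_ctx_has_type_jdg_eq.sig_elim_cong[OF
        eq_stableD1[OF sig_elim_cong.IH(1), unfolded S]
        eq_stableD2[OF sig_elim_cong.IH(2), unfolded S]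
        eq_stableD0[OF sig_elim_cong.IH(3), unfolded S]])
  next
    case nat_form then show ?case by (auto simp: ty_stable_def intro!: wf_ctx_has_type_jdg_eq.nat_form intro: ok_wf)
  next
    case nat_zero then show ?case by (auto simp: ty_stable_def intro!: wf_ctx_has_type_jdg_eq.nat_zero intro: ok_wf)
  next
    case nat_succ show ?case
      by (rule ty_stableI[OF C(1)[OF nat_succ.IH(1)]], (unfold S)?, rule wf_ctx_has_type_jdg_eq.nat_succ[OF
        ty_stableD0[OF nat_succ.IH(1), unfolded S]])
  next
    case nat_elim show ?case
      by (rule ty_stableI[OF C(1)[OF nat_elim.IH(4)]], (unfold S)?, rule wf_ctx_has_type_jdg_eq.nat_elim[OF
        ty_stableD1[OF nat_elim.IH(1), unfolded S]
        ty_stableD0[OF nat_elim.IH(2), unfolded S]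
        ty_stableD2[OF nat_elim.IH(3), unfolded S]
        ty_stableD0[OF nat_elim.IH(4), unfolded S]])
  next
    case nat_comp_zero show ?case
      by (rule eq_stableI[OF C(3)[OF C(3)[OF C(1)[OF nat_comp_zero.IH(3)]]]], (unfold S)?, rule wf_ctx_has_type_jdg_eq.nat_comp_zero[OF
        ty_stableD1[OF nat_comp_zero.IH(1), unfolded S]
        ty_stableD0[OF nat_comp_zero.IH(2), unfolded S]
        ty_stableD2[OF nat_comp_zero.IH(3), unfolded S]])
  next
    case nat_comp_succ show ?case
      by (rule eq_stableI[OF C(1)[OF nat_comp_succ.IH(4)]], (unfold S)?, rule wf_ctx_has_type_jdg_eq.nat_comp_succ[OF
        ty_stableD1[OF nat_comp_succ.IH(1), unfolded S]
        ty_stableD0[OF nat_comp_succ.IH(2), unfolded S]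
        ty_stableD2[OF nat_comp_succ.IH(3), unfolded S]
        ty_stableD0[OF nat_comp_succ.IH(4), unfolded S]])
  next
    case nat_succ_cong show ?case
      by (rule eq_stableI[OF C(2)[OF nat_succ_cong.IH(1)]], (unfold S)?, rule wf_ctx_has_type_jdg_eq.nat_succ_cong[OF
        eq_stableD0[OF nat_succ_cong.IH(1), unfolded S]])
  next
    case nat_elim_cong show ?case
      by (rule eq_stableI[OF C(2)[OF nat_elim_cong.IH(4)]], (unfold S)?, rule wf_ctx_has_type_jdg_eq.nat_elim_cong[OF
        eq_stableD1[OF nat_elim_cong.IH(1), unfolded S]
        eq_stableD0[OF nat_elim_cong.IH(2), unfolded S]
        eq_stableD2[OF nat_elim_cong.IH(3), unfolded S]
        eq_stableD0[OF nat_elim_cong.IH(4), unfolded S]])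
  next
    case id_form show ?case
      by (rule ty_stableI[OF C(1)[OF id_form.IH(3)]], (unfold S)?, rule wf_ctx_has_type_jdg_eq.id_form[OF
        ty_stableD0[OF id_form.IH(1), unfolded S]
        ty_stableD0[OF id_form.IH(2), unfolded S]
        ty_stableD0[OF id_form.IH(3), unfolded S]])
  next
    case id_intro show ?case
      by (rule ty_stableI[OF C(1)[OF id_intro.IH(2)]], (unfold S)?, rule wf_ctx_has_type_jdg_eq.id_intro[OF
        ty_stableD0[OF id_intro.IH(1), unfolded S]
        ty_stableD0[OF id_intro.IH(2), unfolded S]])
  next
    case id_elim show ?case
      by (rule ty_stableI[OF C(1)[OF id_elim.IH(5)]], (unfold S)?, rule wf_ctx_has_type_jdg_eq.id_elim[OF
        ty_stableD3[OF id_elim.IH(1), unfolded S]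
        ty_stableD1[OF id_elim.IH(2), unfolded S]
        ty_stableD0[OF id_elim.IH(3), unfolded S]
        ty_stableD0[OF id_elim.IH(4), unfolded S]
        ty_stableD0[OF id_elim.IH(5), unfolded S]])
  next
    case id_comp show ?case
      by (rule eq_stableI[OF C(1)[OF id_comp.IH(3)]], (unfold S)?, rule wf_ctx_has_type_jdg_eq.id_comp[OF
        ty_stableD3[OF id_comp.IH(1), unfolded S]
        ty_stableD1[OF id_comp.IH(2), unfolded S]
        ty_stableD0[OF id_comp.IH(3), unfolded S]])
  next
    case id_form_cong show ?case
      by (rule eq_stableI[OF C(2)[OF id_form_cong.IH(3)]], (unfold S)?, rule wf_ctx_has_type_jdg_eq.id_form_cong[OF
        eq_stableD0[OF id_form_cong.IH(1), unfolded S]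
        eq_stableD0[OF id_form_cong.IH(2), unfolded S]
        eq_stableD0[OF id_form_cong.IH(3), unfolded S]])
  next
    case id_intro_cong show ?case
      by (rule eq_stableI[OF C(2)[OF id_intro_cong.IH(2)]], (unfold S)?, rule wf_ctx_has_type_jdg_eq.id_intro_cong[OF
        ty_stableD0[OF id_intro_cong.IH(1), unfolded S]
        eq_stableD0[OF id_intro_cong.IH(2), unfolded S]])
  next
    case id_elim_cong show ?case
      by (rule eq_stableI[OF C(2)[OF id_elim_cong.IH(5)]], (unfold S)?, rule wf_ctx_has_type_jdg_eq.id_elim_cong[OF
        eq_stableD3[OF id_elim_cong.IH(1), unfolded S]
        eq_stableD1[OF id_elim_cong.IH(2), unfolded S]
        eq_stableD0[OF id_elim_cong.IH(3), unfolded S]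
        eq_stableD0[OF id_elim_cong.IH(4), unfolded S]
        eq_stableD0[OF id_elim_cong.IH(5), unfolded S]])
  }
qed

end

text \<open>Types are compared syntactically and images must be variables. Lifting under a binder
  then only shifts indices, so closure under \<open>up\<close> can be shown before weakening is
  known.\<close>

definition ren_ok :: "tm list \<Rightarrow> (nat \<Rightarrow> tm) \<Rightarrow> tm list \<Rightarrow> bool" where
  "ren_ok \<Delta> \<sigma> \<Gamma> \<longleftrightarrow> wf_ctx \<Delta> \<and> (\<forall>n < length \<Gamma>. \<exists>m < length \<Delta>. \<sigma> n = Var m \<and>
     (\<Delta> ! m) \<up> Suc m = subst \<sigma> ((\<Gamma> ! n) \<up> Suc n))"

interpretation renaming: subst_class ren_ok
proof
  fix \<Delta> \<Gamma> \<sigma> n assume "ren_ok \<Delta> \<sigma> \<Gamma>" "n < length \<Gamma>"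
  then show "\<Delta> \<turnstile> \<sigma> n \<^bold>: subst \<sigma> ((\<Gamma> ! n) \<up> Suc n)"
    unfolding ren_ok_def by (metis var)
next
  fix \<Delta> \<Gamma> \<sigma> assume "ren_ok \<Delta> \<sigma> \<Gamma>"
  then show "wf_ctx \<Delta>" by (simp add: ren_ok_def)
next
  fix \<Delta> \<Gamma> \<sigma> A i assume ok: "ren_ok \<Delta> \<sigma> \<Gamma>" and A: "\<Delta> \<turnstile> subst \<sigma> A \<^bold>: Univ i"
  show "ren_ok (subst \<sigma> A # \<Delta>) (up \<sigma>) (A # \<Gamma>)"
    unfolding ren_ok_def
  proof (intro conjI allI impI)
    show "wf_ctx (subst \<sigma> A # \<Delta>)" using A by (rule ctx_extend)
    fix n assume n: "n < length (A # \<Gamma>)"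
    show "\<exists>m<length (subst \<sigma> A # \<Delta>). up \<sigma> n = Var m \<and>
        ((subst \<sigma> A # \<Delta>) ! m) \<up> Suc m = subst (up \<sigma>) (((A # \<Gamma>) ! n) \<up> Suc n)"
    proof (cases n)
      case 0
      then show ?thesis by (intro exI[of _ 0]) (simp add: subst_up_weaken_Suc One_nat_def[symmetric])
    next
      case (Suc k)
      with n ok obtain m where m: "m < length \<Delta>" "\<sigma> k = Var m"
        "(\<Delta> ! m) \<up> Suc m = subst \<sigma> ((\<Gamma> ! k) \<up> Suc k)"
        unfolding ren_ok_def by auto
      have "(\<Delta> ! m) \<up> Suc (Suc m) = ((\<Delta> ! m) \<up> Suc m) \<up> 1" by (simp add: One_nat_def)
      with m Suc show ?thesis
        by (intro exI[of _ "Suc m"]) (simp add: subst_up_weaken_Suc)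
    qed
  qed
qed

lemma ren_ok_shift:
  assumes "wf_ctx (\<Delta> @ \<Gamma>)"
  shows "ren_ok (\<Delta> @ \<Gamma>) (\<lambda>n. Var (n + length \<Delta>)) \<Gamma>"
  using assms by (auto simp: ren_ok_def nth_append add.commute)

lemma weakening:
  assumes "wf_ctx (\<Delta> @ \<Gamma>)"
  shows "\<Gamma> \<turnstile> a \<^bold>: A \<Longrightarrow> \<Delta> @ \<Gamma> \<turnstile> a \<up> length \<Delta> \<^bold>: A \<up> length \<Delta>"
    and "\<Gamma> \<turnstile> a \<doteq> b \<^bold>: A \<Longrightarrow> \<Delta> @ \<Gamma> \<turnstile> a \<up> length \<Delta> \<doteq> b \<up> length \<Delta> \<^bold>: A \<up> length \<Delta>"
  using renaming.ty_stableD0[OF renaming.jdg_stable(2) ren_ok_shift[OF assms]]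
    renaming.eq_stableD0[OF renaming.jdg_stable(3) ren_ok_shift[OF assms]]
  by simp_all

lemma weakening1:
  assumes "wf_ctx (B # \<Gamma>)"
  shows "\<Gamma> \<turnstile> a \<^bold>: A \<Longrightarrow> B # \<Gamma> \<turnstile> a \<up> 1 \<^bold>: A \<up> 1"
    and "\<Gamma> \<turnstile> a \<doteq> b \<^bold>: A \<Longrightarrow> B # \<Gamma> \<turnstile> a \<up> 1 \<doteq> b \<up> 1 \<^bold>: A \<up> 1"
  using weakening[of "[B]" \<Gamma>] assms by (simp_all add: One_nat_def)

definition sub_ok :: "tm list \<Rightarrow> (nat \<Rightarrow> tm) \<Rightarrow> tm list \<Rightarrow> bool" where
  "sub_ok \<Delta> \<sigma> \<Gamma> \<longleftrightarrow> wf_ctx \<Delta> \<and> (\<forall>n < length \<Gamma>. \<Delta> \<turnstile> \<sigma> n \<^bold>: subst \<sigma> ((\<Gamma> ! n) \<up> Suc n))"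

lemma var0: "wf_ctx (A # \<Gamma>) \<Longrightarrow> A # \<Gamma> \<turnstile> Var 0 \<^bold>: A \<up> 1"
  using var[of "A # \<Gamma>" 0] by (simp add: One_nat_def)

text \<open>Lifting weakens the image of every old variable by the new declaration; this is where
  the weakening obtained from renamings enters.\<close>

interpretation substitution: subst_class sub_ok
proof
  fix \<Delta> \<Gamma> \<sigma> A i assume ok: "sub_ok \<Delta> \<sigma> \<Gamma>" and A: "\<Delta> \<turnstile> subst \<sigma> A \<^bold>: Univ i"
  have wf: "wf_ctx (subst \<sigma> A # \<Delta>)" using A by (rule ctx_extend)
  show "sub_ok (subst \<sigma> A # \<Delta>) (up \<sigma>) (A # \<Gamma>)"
    unfolding sub_ok_def
  proof (intro conjI allI impI wf)
    fix n assume n: "n < length (A # \<Gamma>)"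
    show "subst \<sigma> A # \<Delta> \<turnstile> up \<sigma> n \<^bold>: subst (up \<sigma>) (((A # \<Gamma>) ! n) \<up> Suc n)"
      using n ok weakening1[OF wf] var0[OF wf]
      by (cases n) (auto simp: sub_ok_def subst_up_weaken_Suc)
  qed
qed (auto simp: sub_ok_def)

lemma substitution:
  assumes "sub_ok \<Delta> \<sigma> \<Gamma>"
  shows "\<Gamma> \<turnstile> a \<^bold>: A \<Longrightarrow> \<Delta> \<turnstile> subst \<sigma> a \<^bold>: subst \<sigma> A"
    and "\<Gamma> \<turnstile> a \<doteq> b \<^bold>: A \<Longrightarrow> \<Delta> \<turnstile> subst \<sigma> a \<doteq> subst \<sigma> b \<^bold>: subst \<sigma> A"
  using substitution.ty_stableD0[OF substitution.jdg_stable(2) assms]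
    substitution.eq_stableD0[OF substitution.jdg_stable(3) assms] by simp_all

lemma sub_ok_Var: "wf_ctx \<Gamma> \<Longrightarrow> sub_ok \<Gamma> Var \<Gamma>"
  by (auto simp: sub_ok_def intro: var)

lemma sub_ok_shift:
  assumes "wf_ctx (\<Delta> @ \<Gamma>)" "k = length \<Delta>"
  shows "sub_ok (\<Delta> @ \<Gamma>) (\<lambda>n. Var (n + k)) \<Gamma>"
  using ren_ok_shift[OF assms(1)] renaming.ok_var renaming.ok_wf assms(2) unfolding sub_ok_def by blast

lemma sub_ok_shift1: "wf_ctx (A # \<Gamma>) \<Longrightarrow> sub_ok (A # \<Gamma>) (\<lambda>n. Var (n + 1)) \<Gamma>"
  using sub_ok_shift[of "[A]" \<Gamma> 1] by (simp add: One_nat_def)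

lemma sub_ok_scons: "sub_ok \<Delta> \<sigma> \<Gamma> \<Longrightarrow> \<Delta> \<turnstile> b \<^bold>: subst \<sigma> B \<Longrightarrow> sub_ok \<Delta> (b \<rhd> \<sigma>) (B # \<Gamma>)"
  unfolding sub_ok_def
proof (intro conjI allI impI; (elim conjE)?)
  fix n assume b: "\<Delta> \<turnstile> b \<^bold>: subst \<sigma> B" and n: "n < length (B # \<Gamma>)"
    and v: "\<forall>n<length \<Gamma>. \<Delta> \<turnstile> \<sigma> n \<^bold>: subst \<sigma> ((\<Gamma> ! n) \<up> Suc n)"
  show "\<Delta> \<turnstile> (b \<rhd> \<sigma>) n \<^bold>: subst (b \<rhd> \<sigma>) (((B # \<Gamma>) ! n) \<up> Suc n)"
    using b n v by (cases n) (auto simp: subst_scons_weaken_Suc)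
qed

lemma subst1_ty: "A # \<Gamma> \<turnstile> b \<^bold>: B \<Longrightarrow> \<Gamma> \<turnstile> a \<^bold>: A \<Longrightarrow> \<Gamma> \<turnstile> subst1 b a \<^bold>: subst1 B a"
  and subst1_eq: "A # \<Gamma> \<turnstile> b \<doteq> b' \<^bold>: B \<Longrightarrow> \<Gamma> \<turnstile> a \<^bold>: A \<Longrightarrow> \<Gamma> \<turnstile> subst1 b a \<doteq> subst1 b' a \<^bold>: subst1 B a"
  unfolding subst1_def
  by (auto intro!: substitution sub_ok_scons sub_ok_Var dest: wf_of_jdg)

section \<open>Presuppositions\<close>

lemma cumul_le: "\<Gamma> \<turnstile> A \<^bold>: Univ i \<Longrightarrow> i \<le> j \<Longrightarrow> \<Gamma> \<turnstile> A \<^bold>: Univ j"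
  by (erule dec_induct) (auto intro: cumul)

lemma eq_cumul_le: "\<Gamma> \<turnstile> A \<doteq> B \<^bold>: Univ i \<Longrightarrow> i \<le> j \<Longrightarrow> \<Gamma> \<turnstile> A \<doteq> B \<^bold>: Univ j"
  by (erule dec_induct) (auto intro: eq_cumul)

text \<open>Conversion and cumulativity alter the classifier but not the subject, so for a type
  former the hypotheses pass through them unchanged down to its formation rule.\<close>

lemma form_inv:
  "wf_ctx \<Gamma> \<Longrightarrow> True"
  "\<Gamma> \<turnstile> t \<^bold>: T \<Longrightarrow>
     (\<forall>A B. t = PiT A B \<or> t = SigT A B \<longrightarrow> (\<exists>i. \<Gamma> \<turnstile> A \<^bold>: Univ i \<and> A # \<Gamma> \<turnstile> B \<^bold>: Univ i)) \<and>
     (\<forall>A a b. t = IdT A a b \<longrightarrow> (\<exists>i. \<Gamma> \<turnstile> A \<^bold>: Univ i) \<and> \<Gamma> \<turnstile> a \<^bold>: A \<and> \<Gamma> \<turnstile> b \<^bold>: A)"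
  "\<Gamma> \<turnstile> t \<doteq> u \<^bold>: T \<Longrightarrow> True"
  by (induction rule: wf_ctx_has_type_jdg_eq.inducts) auto

text \<open>With the level hidden, formation rules can be combined for types at different levels;
  cumulativity raises both to the maximum.\<close>

definition is_ty :: "tm list \<Rightarrow> tm \<Rightarrow> bool" where
  "is_ty \<Gamma> A \<longleftrightarrow> (\<exists>i. \<Gamma> \<turnstile> A \<^bold>: Univ i)"

lemma is_tyI: "\<Gamma> \<turnstile> A \<^bold>: Univ i \<Longrightarrow> is_ty \<Gamma> A"
  by (auto simp: is_ty_def)

lemma is_ty_Pi_inv: "is_ty \<Gamma> (PiT A B) \<Longrightarrow> is_ty \<Gamma> A \<and> is_ty (A # \<Gamma>) B"
  and is_ty_Sig_inv: "is_ty \<Gamma> (SigT A B) \<Longrightarrow> is_ty \<Gamma> A \<and> is_ty (A # \<Gamma>) B"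
  and is_ty_Id_inv: "is_ty \<Gamma> (IdT A a b) \<Longrightarrow> is_ty \<Gamma> A \<and> \<Gamma> \<turnstile> a \<^bold>: A \<and> \<Gamma> \<turnstile> b \<^bold>: A"
  unfolding is_ty_def using form_inv(2) by blast+

lemma is_ty_common:
  assumes "is_ty \<Gamma> A" "is_ty \<Delta> B"
  obtains i where "\<Gamma> \<turnstile> A \<^bold>: Univ i" "\<Delta> \<turnstile> B \<^bold>: Univ i"
  using assms unfolding is_ty_def by (metis cumul_le max.cobounded1 max.cobounded2)

lemma is_ty_Pi: "is_ty (A # \<Gamma>) B \<Longrightarrow> is_ty \<Gamma> (PiT A B)"
  and is_ty_Sig: "is_ty (A # \<Gamma>) B \<Longrightarrow> is_ty \<Gamma> (SigT A B)"
proof -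
  assume B: "is_ty (A # \<Gamma>) B"
  then have "is_ty \<Gamma> A" by (metis is_ty_def wf_of_jdg(1) wf_ctx_Cons)
  with B obtain i where "\<Gamma> \<turnstile> A \<^bold>: Univ i" "A # \<Gamma> \<turnstile> B \<^bold>: Univ i"
    by (metis is_ty_common)
  then show "is_ty \<Gamma> (PiT A B)" "is_ty \<Gamma> (SigT A B)"
    by (auto intro: is_tyI pi_form sig_form)
qed

lemma is_ty_subst: "is_ty \<Gamma> A \<Longrightarrow> sub_ok \<Delta> \<sigma> \<Gamma> \<Longrightarrow> is_ty \<Delta> (subst \<sigma> A)"
  unfolding is_ty_def using substitution(1) by fastforce

lemma is_ty_subst1: "is_ty (A # \<Gamma>) B \<Longrightarrow> \<Gamma> \<turnstile> a \<^bold>: A \<Longrightarrow> is_ty \<Gamma> (subst1 B a)"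
  unfolding subst1_def by (auto intro!: is_ty_subst sub_ok_scons sub_ok_Var dest: wf_of_jdg)

lemma is_ty_ctx: "wf_ctx (A # \<Gamma>) \<Longrightarrow> is_ty \<Gamma> A"
  by (simp add: wf_ctx_Cons is_ty_def)

lemma is_ty_weak1: "wf_ctx (B # \<Gamma>) \<Longrightarrow> is_ty \<Gamma> A \<Longrightarrow> is_ty (B # \<Gamma>) (A \<up> 1)"
  unfolding is_ty_def using weakening1(1) by fastforce

lemma var_is_ty: "wf_ctx \<Gamma> \<Longrightarrow> n < length \<Gamma> \<Longrightarrow> is_ty \<Gamma> ((\<Gamma> ! n) \<up> Suc n)"
proof (induction \<Gamma> arbitrary: n)
  case (Cons A \<Gamma>)
  show ?case
  proof (cases n)
    case 0
    then show ?thesis using is_ty_weak1[OF Cons.prems(1) is_ty_ctx] Cons.prems by (simp add: One_nat_def)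
  next
    case (Suc m)
    then have "is_ty (A # \<Gamma>) ((\<Gamma> ! m) \<up> Suc m \<up> 1)"
      using Cons wf_ctx_tail by (intro is_ty_weak1) auto
    then show ?thesis using Suc by (simp add: One_nat_def)
  qed
qed simp

text \<open>Replacing the last declaration by an equal type is substitution along the identity
  \<open>Var\<close>, seen as a substitution between the two contexts. Well-formedness of
  \<open>A'\<close> is a premise since regularity is not yet available.\<close>

lemma sub_ok_ctx_conv:
  assumes "\<Gamma> \<turnstile> A \<doteq> A' \<^bold>: Univ i" "is_ty \<Gamma> A'"
  shows "sub_ok (A' # \<Gamma>) Var (A # \<Gamma>)"
proof -
  have wf: "wf_ctx (A' # \<Gamma>)" using assms(2) by (simp add: is_ty_def wf_ctx_Cons)
  have "A' # \<Gamma> \<turnstile> Var 0 \<^bold>: A \<up> 1"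
    using var0[OF wf] weakening1(2)[OF wf eq_sym[OF assms(1)]] by (auto intro: conv)
  \<comment> \<open>Writing the identity as an extension of the shift makes
    \<open>sub_ok_scons\<close> applicable.\<close>
  moreover have "(Var 0 \<rhd> (\<lambda>n. Var (n + 1))) = Var"
    using up_Var by (simp add: up_def)
  ultimately show ?thesis
    using sub_ok_scons[OF sub_ok_shift1[OF wf], of "Var 0" A] by simp
qed

lemma ctx_conv:
  assumes "\<Gamma> \<turnstile> A \<doteq> A' \<^bold>: Univ i" "is_ty \<Gamma> A'"
  shows "A # \<Gamma> \<turnstile> b \<^bold>: B \<Longrightarrow> A' # \<Gamma> \<turnstile> b \<^bold>: B"
    and "A # \<Gamma> \<turnstile> b \<doteq> b' \<^bold>: B \<Longrightarrow> A' # \<Gamma> \<turnstile> b \<doteq> b' \<^bold>: B"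
  using substitution[OF sub_ok_ctx_conv[OF assms]] by simp_all

text \<open>\<open>\<lambda>\<close>-abstracting turns the congruence rule for application into congruence of substitution.\<close>

lemma subst1_cong_Univ:
  assumes "A # \<Gamma> \<turnstile> B \<^bold>: Univ i" "\<Gamma> \<turnstile> a \<doteq> a' \<^bold>: A" "\<Gamma> \<turnstile> a \<^bold>: A" "\<Gamma> \<turnstile> a' \<^bold>: A"
  shows "\<Gamma> \<turnstile> subst1 B a \<doteq> subst1 B a' \<^bold>: Univ i"
proof -
  have U: "subst1 (Univ i) x = Univ i" for x by (simp add: subst1_def)
  have "\<Gamma> \<turnstile> Lam A B \<bullet> a \<doteq> Lam A B \<bullet> a' \<^bold>: Univ i"
    using pi_elim_cong[OF eq_refl[OF pi_intro[OF assms(1)]] assms(2)] by (simp add: U)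
  moreover have "\<Gamma> \<turnstile> Lam A B \<bullet> x \<doteq> subst1 B x \<^bold>: Univ i" if "\<Gamma> \<turnstile> x \<^bold>: A" for x
    using pi_comp[OF assms(1) that] by (simp add: U)
  ultimately show ?thesis using assms(3,4) by (meson eq_sym eq_trans)
qed

lemma sub_ok_up:
  assumes "sub_ok \<Delta> \<sigma> \<Gamma>" "wf_ctx (A # \<Gamma>)"
  shows "sub_ok (subst \<sigma> A # \<Delta>) (up \<sigma>) (A # \<Gamma>)"
  using substitution.ok_up[OF assms(1)] is_ty_subst[OF is_ty_ctx[OF assms(2)] assms(1)]
  by (auto simp: is_ty_def)

lemma subst_up_inst:
  "subst (b \<rhd> Var) (subst (up \<sigma>) t) = subst (b \<rhd> \<sigma>) t"
  unfolding subst_subst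
proof (rule subst_eqI)
  fix n show "subst (b \<rhd> Var) (up \<sigma> n) = (b \<rhd> \<sigma>) n" by (cases n) simp_all
qed

lemma subst_up_up_inst: "subst (up (b \<rhd> Var)) (subst (up (up \<sigma>)) t) = subst (up (b \<rhd> \<sigma>)) t"
  unfolding subst_subst
proof (rule subst_eqI)
  fix n show "subst (up (b \<rhd> Var)) (up (up \<sigma>) n) = up (b \<rhd> \<sigma>) n"
    using nat_cases3[of n] by auto
qed

text \<open>Successive beta-steps produce nested single substitutions, which
  \<open>subst_up_inst\<close> fuses into one simultaneous substitution. This is the form of
  \<open>subst3\<close>, and later of the reflexivity case of the path induction in the
  splitting.\<close>

lemma pi_comp3:
  assumes t: "C # B # A # \<Gamma> \<turnstile> t \<^bold>: T" and a: "\<Gamma> \<turnstile> a \<^bold>: A" and b: "\<Gamma> \<turnstile> b \<^bold>: subst (a \<rhd> Var) B"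
    and c: "\<Gamma> \<turnstile> c \<^bold>: subst (b \<rhd> a \<rhd> Var) C"
  shows "\<Gamma> \<turnstile> Lam A (Lam B (Lam C t)) \<bullet> a \<bullet> b \<bullet> c \<doteq> subst (c \<rhd> b \<rhd> a \<rhd> Var) t
    \<^bold>: subst (c \<rhd> b \<rhd> a \<rhd> Var) T"
proof -
  have wf: "wf_ctx (C # B # A # \<Gamma>)" "wf_ctx (B # A # \<Gamma>)" "wf_ctx \<Gamma>"
    using t wf_of_jdg wf_ctx_tail by blast+
  have s1: "sub_ok \<Gamma> (a \<rhd> Var) (A # \<Gamma>)" using a wf by (intro sub_ok_scons sub_ok_Var) simp_all
  have s2: "sub_ok \<Gamma> (b \<rhd> a \<rhd> Var) (B # A # \<Gamma>)" using b by (intro sub_ok_scons s1)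
  have "\<Gamma> \<turnstile> Lam A (Lam B (Lam C t)) \<bullet> a \<doteq> subst (a \<rhd> Var) (Lam B (Lam C t))
      \<^bold>: subst (a \<rhd> Var) (PiT B (PiT C T))"
    using pi_comp[OF pi_intro[OF pi_intro[OF t]] a] by (simp add: subst1_def)
  from pi_elim_cong[OF this[unfolded subst.simps] eq_refl[OF b]]
    pi_comp[OF substitution(1)[OF sub_ok_up[OF s1 wf(2)] pi_intro[OF t]] b]
  have "\<Gamma> \<turnstile> Lam A (Lam B (Lam C t)) \<bullet> a \<bullet> b \<doteq> subst (b \<rhd> a \<rhd> Var) (Lam C t)
      \<^bold>: subst (b \<rhd> a \<rhd> Var) (PiT C T)"
    unfolding subst1_def subst.simps subst_up_inst subst_up_up_inst by (rule eq_trans)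
  from pi_elim_cong[OF this[unfolded subst.simps] eq_refl[OF c]]
    pi_comp[OF substitution(1)[OF sub_ok_up[OF s2 wf(1)] t] c]
  show ?thesis unfolding subst1_def subst_up_inst by (rule eq_trans)
qed

lemma subst3_lam:
  assumes C: "IdT (A\<up>2) (Var 1) (Var 0) # A\<up>1 # A # \<Gamma> \<turnstile> C \<^bold>: Univ i"
    and "\<Gamma> \<turnstile> a \<^bold>: A" "\<Gamma> \<turnstile> b \<^bold>: A" "\<Gamma> \<turnstile> p \<^bold>: IdT A a b"
  shows "\<Gamma> \<turnstile> Lam A (Lam (A\<up>1) (Lam (IdT (A\<up>2) (Var 1) (Var 0)) C)) \<bullet> a \<bullet> b \<bullet> p \<doteq> subst3 C a b p
    \<^bold>: Univ i"
  using pi_comp3[OF C, of a b p] assms by (simp add: subst3_def)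

text \<open>The one-variable argument repeated: abstract all three variables, use congruence of
  application, beta-reduce. The path \<open>p'\<close> is typed over \<open>a'\<close> and
  \<open>b'\<close> as well, since the right-hand side is beta-reduced separately.\<close>

lemma subst3_cong_Univ:
  assumes C: "IdT (A\<up>2) (Var 1) (Var 0) # A\<up>1 # A # \<Gamma> \<turnstile> C \<^bold>: Univ i"
    and a: "\<Gamma> \<turnstile> a \<^bold>: A" and b: "\<Gamma> \<turnstile> b \<^bold>: A" and p: "\<Gamma> \<turnstile> p \<^bold>: IdT A a b"
    and a': "\<Gamma> \<turnstile> a' \<^bold>: A" and b': "\<Gamma> \<turnstile> b' \<^bold>: A" and p': "\<Gamma> \<turnstile> p' \<^bold>: IdT A a' b'"
    and ea: "\<Gamma> \<turnstile> a \<doteq> a' \<^bold>: A" and eb: "\<Gamma> \<turnstile> b \<doteq> b' \<^bold>: A" and ep: "\<Gamma> \<turnstile> p \<doteq> p' \<^bold>: IdT A a b"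
  shows "\<Gamma> \<turnstile> subst3 C a b p \<doteq> subst3 C a' b' p' \<^bold>: Univ i"
proof -
  let ?F = "Lam A (Lam (A\<up>1) (Lam (IdT (A\<up>2) (Var 1) (Var 0)) C))"
  have "\<Gamma> \<turnstile> ?F \<^bold>: PiT A (PiT (A\<up>1) (PiT (IdT (A\<up>2) (Var 1) (Var 0)) (Univ i)))"
    by (intro pi_intro C)
  from pi_elim_cong[OF eq_refl[OF this] ea]
  have "\<Gamma> \<turnstile> ?F \<bullet> a \<doteq> ?F \<bullet> a' \<^bold>: PiT A (PiT (IdT (A\<up>1) (a\<up>1) (Var 0)) (Univ i))"
    by (simp add: subst1_def)
  from pi_elim_cong[OF this eb]
  have "\<Gamma> \<turnstile> ?F \<bullet> a \<bullet> b \<doteq> ?F \<bullet> a' \<bullet> b' \<^bold>: PiT (IdT A a b) (Univ i)"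
    by (simp add: subst1_def)
  from pi_elim_cong[OF this ep]
  have "\<Gamma> \<turnstile> ?F \<bullet> a \<bullet> b \<bullet> p \<doteq> ?F \<bullet> a' \<bullet> b' \<bullet> p' \<^bold>: Univ i"
    by (simp add: subst1_def)
  with subst3_lam[OF C a b p] subst3_lam[OF C a' b' p'] show ?thesis
    by (meson eq_sym eq_trans)
qed

lemma sub_ok_pair:
  assumes "is_ty (A # \<Gamma>) B"
  shows "sub_ok (B # A # \<Gamma>) (Pair (Var 1) (Var 0) \<rhd> (\<lambda>n. Var (n + 2))) (SigT A B # \<Gamma>)"
proof -
  obtain i where B: "A # \<Gamma> \<turnstile> B \<^bold>: Univ i" using assms by (auto simp: is_ty_def)
  have wf1: "wf_ctx (A # \<Gamma>)" and wf2: "wf_ctx (B # A # \<Gamma>)"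
    using B wf_of_jdg ctx_extend by blast+
  have sh: "sub_ok (B # A # \<Gamma>) (\<lambda>n. Var (n + 2)) \<Gamma>"
    using sub_ok_shift[of "[B, A]" \<Gamma> 2] wf2 by simp
  obtain j where A: "\<Gamma> \<turnstile> A \<^bold>: Univ j" using wf1 by (auto simp: wf_ctx_Cons)
  have A2: "B # A # \<Gamma> \<turnstile> A\<up>2 \<^bold>: Univ j" using substitution(1)[OF sh A] by simp
  have up: "sub_ok (A\<up>2 # B # A # \<Gamma>) (up (\<lambda>n. Var (n + 2))) (A # \<Gamma>)"
    using substitution.ok_up[OF sh, of A j] A2 by simp
  have v1: "B # A # \<Gamma> \<turnstile> Var 1 \<^bold>: A\<up>2" using var[OF wf2, of 1] by (simp add: One_nat_def numeral_2_eq_2)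
  \<comment> \<open>The family moved past both variables and instantiated at the first of them is
    the declared type of \<open>Var 0\<close>, so the pair of the two variables is
    well-typed.\<close>
  have "subst1 (subst (up (\<lambda>n. Var (n + 2))) B) (Var 1) = B\<up>1"
    unfolding subst1_def weaken_eq_subst subst_subst
  proof (rule subst_eqI)
    fix n show "subst (Var 1 \<rhd> Var) (up (\<lambda>n. Var (n + 2)) n) = Var (n + 1)"
      by (cases n) (simp_all)
  qed
  then have "B # A # \<Gamma> \<turnstile> Pair (Var 1) (Var 0) \<^bold>: (SigT A B)\<up>2"
    using sig_intro[OF substitution(1)[OF up B, simplified] v1, of "Var 0"] var0[OF wf2] by simp
  then show ?thesis using sh by (intro sub_ok_scons) simp_all
qed

lemma sub_ok_succ:
  assumes "wf_ctx (C # NatT # \<Gamma>)"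
  shows "sub_ok (C # NatT # \<Gamma>) (Succ (Var 1) \<rhd> (\<lambda>n. Var (n + 2))) (NatT # \<Gamma>)"
proof -
  have "C # NatT # \<Gamma> \<turnstile> Var 1 \<^bold>: NatT" using var[OF assms, of 1] by simp
  moreover have "sub_ok (C # NatT # \<Gamma>) (\<lambda>n. Var (n + 2)) \<Gamma>"
    using sub_ok_shift[of "[C, NatT]" \<Gamma> 2] assms by simp
  ultimately show ?thesis by (intro sub_ok_scons) (auto intro: nat_succ)
qed

lemma sub_ok_refl:
  assumes "wf_ctx (A # \<Gamma>)"
  shows "sub_ok (A # \<Gamma>) (Refl (Var 0) \<rhd> Var 0 \<rhd> Var 0 \<rhd> (\<lambda>n. Var (n + 1)))
    (IdT (A\<up>2) (Var 1) (Var 0) # A\<up>1 # A # \<Gamma>)"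
proof -
  obtain i where "A # \<Gamma> \<turnstile> A\<up>1 \<^bold>: Univ i"
    using is_ty_weak1[OF assms is_ty_ctx[OF assms]] by (auto simp: is_ty_def)
  then show ?thesis using var0[OF assms]
    by (intro sub_ok_scons sub_ok_shift1 assms) (auto intro: id_intro)
qed

lemma sub_ok_id:
  assumes "\<Gamma> \<turnstile> a \<^bold>: A" "\<Gamma> \<turnstile> b \<^bold>: A" "\<Gamma> \<turnstile> p \<^bold>: IdT A a b"
  shows "sub_ok \<Gamma> (p \<rhd> b \<rhd> a \<rhd> Var) (IdT (A\<up>2) (Var 1) (Var 0) # A\<up>1 # A # \<Gamma>)"
  using assms wf_of_jdg(1)[OF assms(1)] by (intro sub_ok_scons sub_ok_Var) simp_all

lemma is_ty_Id: "is_ty \<Gamma> A \<Longrightarrow> \<Gamma> \<turnstile> a \<^bold>: A \<Longrightarrow> \<Gamma> \<turnstile> b \<^bold>: A \<Longrightarrow> is_ty \<Gamma> (IdT A a b)"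
  unfolding is_ty_def by (meson id_form)

lemma id_conv:
  assumes "is_ty \<Gamma> A" "\<Gamma> \<turnstile> a \<doteq> a' \<^bold>: A" "\<Gamma> \<turnstile> b \<doteq> b' \<^bold>: A"
  obtains i where "\<Gamma> \<turnstile> IdT A a b \<doteq> IdT A a' b' \<^bold>: Univ i"
  using assms unfolding is_ty_def by (meson eq_refl id_form_cong)

text \<open>The substantial cases are the congruence rules for eliminators. Their right-hand side is
  typed at its own instance of the motive and then converted back, along the change of arguments and
  along the change of motive.\<close>

lemma presuppositions:
  "wf_ctx \<Gamma> \<Longrightarrow> True"
  "\<Gamma> \<turnstile> a \<^bold>: A \<Longrightarrow> is_ty \<Gamma> A"
  "\<Gamma> \<turnstile> a \<doteq> b \<^bold>: A \<Longrightarrow> is_ty \<Gamma> A \<and> \<Gamma> \<turnstile> a \<^bold>: A \<and> \<Gamma> \<turnstile> b \<^bold>: A"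
proof (induction rule: wf_ctx_has_type_jdg_eq.inducts)
  case (var \<Gamma> n)
  then show ?case using var_is_ty by blast
next
  case (conv \<Gamma> a A B i)
  then show ?case by (auto intro: is_tyI)
next
  case (eq_conv \<Gamma> a b A B i)
  then show ?case by (auto intro: is_tyI wf_ctx_has_type_jdg_eq.conv)
next
  case (univ \<Gamma> i)
  then show ?case using is_tyI wf_ctx_has_type_jdg_eq.univ by blast
next
  case (cumul \<Gamma> A i)
  then show ?case using is_tyI wf_ctx_has_type_jdg_eq.univ wf_of_jdg(1) by blast
next
  case (eq_cumul \<Gamma> A B i)
  then show ?case using is_tyI wf_ctx_has_type_jdg_eq.univ wf_of_jdg(1) wf_ctx_has_type_jdg_eq.cumul by blast
next
  case (pi_form \<Gamma> A i B)
  then show ?case by simp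
next
  case (pi_intro A \<Gamma> b B)
  then show ?case by (auto intro: is_ty_Pi)
next
  case (pi_elim \<Gamma> f A B a)
  then show ?case using is_ty_Pi_inv is_ty_subst1 by blast
next
  case (pi_comp A \<Gamma> b B a)
  then show ?case
    using is_ty_subst1 subst1_ty wf_ctx_has_type_jdg_eq.pi_elim wf_ctx_has_type_jdg_eq.pi_intro by blast
next
  case (pi_uniq \<Gamma> f A B)
  have "wf_ctx (A # \<Gamma>)"
    using is_ty_Pi_inv[OF pi_uniq.IH] by (auto simp: is_ty_def wf_ctx_Cons)
  note v = var0[OF this] weakening1(1)[OF this pi_uniq.hyps]
  \<comment> \<open>Applying the weakened function to the fresh variable undoes the shift of the
    codomain, so the expansion of \<open>f\<close> has codomain \<open>B\<close> again.\<close>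
  have "subst1 (subst (up (\<lambda>n. Var (n + 1))) B) (Var 0) = subst Var B"
    unfolding subst1_def subst_subst
  proof (rule subst_eqI)
    fix n show "subst (Var 0 \<rhd> Var) (up (\<lambda>n. Var (n + 1)) n) = Var n" by (cases n) simp_all
  qed
  then have "A # \<Gamma> \<turnstile> f\<up>1 \<bullet> Var 0 \<^bold>: B"
    using wf_ctx_has_type_jdg_eq.pi_elim[OF v(2)[simplified] v(1)] by simp
  then show ?case using pi_uniq by (auto intro: wf_ctx_has_type_jdg_eq.pi_intro)
next
  case (pi_form_cong \<Gamma> A A' i B B')
  then show ?case using ctx_conv(1)[OF pi_form_cong.hyps(1)]
    by (auto intro!: wf_ctx_has_type_jdg_eq.pi_form intro: is_tyI)
next
  case (pi_intro_cong \<Gamma> A A' i b b' B)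
  then have A': "is_ty \<Gamma> A'" by (auto intro: is_tyI)
  obtain j where "A # \<Gamma> \<turnstile> B \<^bold>: Univ j" using pi_intro_cong.IH by (auto simp: is_ty_def)
  \<comment> \<open>The abstraction on the right has domain \<open>A'\<close> by itself; the
    conversion back to \<open>A\<close> takes place above the levels of both domain and
    codomain.\<close>
  then have "\<Gamma> \<turnstile> PiT A' B \<doteq> PiT A B \<^bold>: Univ (max i j)"
    using pi_intro_cong.hyps(1)
    by (meson wf_ctx_has_type_jdg_eq.eq_sym wf_ctx_has_type_jdg_eq.pi_form_cong eq_cumul_le cumul_le
        wf_ctx_has_type_jdg_eq.eq_refl max.cobounded1 max.cobounded2)
  moreover have "\<Gamma> \<turnstile> Lam A' b' \<^bold>: PiT A' B"
    using ctx_conv(1)[OF pi_intro_cong.hyps(1) A'] pi_intro_cong.IH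
    by (auto intro: wf_ctx_has_type_jdg_eq.pi_intro)
  ultimately show ?case using pi_intro_cong.IH
    by (auto intro: wf_ctx_has_type_jdg_eq.pi_intro wf_ctx_has_type_jdg_eq.conv is_ty_Pi)
next
  case (pi_elim_cong \<Gamma> f f' A B a a')
  then obtain i where B: "A # \<Gamma> \<turnstile> B \<^bold>: Univ i" using is_ty_Pi_inv is_ty_def by blast
  then have "\<Gamma> \<turnstile> subst1 B a \<doteq> subst1 B a' \<^bold>: Univ i"
    using subst1_cong_Univ pi_elim_cong by blast
  then show ?case using pi_elim_cong B
    by (meson wf_ctx_has_type_jdg_eq.pi_elim wf_ctx_has_type_jdg_eq.conv wf_ctx_has_type_jdg_eq.eq_sym
        is_ty_subst1 is_tyI)
next
  case (sig_form \<Gamma> A i B)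
  then show ?case by simp
next
  case (sig_intro A \<Gamma> B i a b)
  then show ?case using is_ty_Sig is_tyI by blast
next
  case (sig_elim A B \<Gamma> C i g p)
  then show ?case using is_ty_subst1 is_tyI by blast
next
  case (sig_comp A B \<Gamma> C i g a b)
  have B: "is_ty (A # \<Gamma>) B"
    using wf_of_jdg(1)[OF sig_comp.hyps(2)] is_ty_ctx by blast
  then have pr: "\<Gamma> \<turnstile> Pair a b \<^bold>: SigT A B"
    using sig_comp wf_ctx_has_type_jdg_eq.sig_intro is_ty_def by blast
  have "sub_ok \<Gamma> (b \<rhd> a \<rhd> Var) (B # A # \<Gamma>)"
    using sig_comp wf_of_jdg(1)[OF sig_comp.hyps(3)]
    by (intro sub_ok_scons sub_ok_Var) (simp_all add: subst1_def)
  from substitution(1)[OF this sig_comp.hyps(2)]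
  have "\<Gamma> \<turnstile> subst2 g a b \<^bold>: subst (b \<rhd> a \<rhd> Var) (subst (Pair (Var 1) (Var 0) \<rhd> (\<lambda>n. Var (n + 2))) C)"
    by (simp add: subst2_def)
  also have "subst (b \<rhd> a \<rhd> Var) (subst (Pair (Var 1) (Var 0) \<rhd> (\<lambda>n. Var (n + 2))) C) = subst1 C (Pair a b)"
    unfolding subst1_def subst_subst
  proof (rule subst_eqI)
    fix n show "subst (b \<rhd> a \<rhd> Var) ((Pair (Var 1) (Var 0) \<rhd> (\<lambda>n. Var (n + 2))) n) = (Pair a b \<rhd> Var) n"
      by (cases n) simp_all
  qed
  finally show ?case
    using pr sig_comp wf_ctx_has_type_jdg_eq.sig_elim is_ty_subst1 is_tyI by blast
next
  case (sig_form_cong \<Gamma> A A' i B B')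
  then show ?case using ctx_conv(1)[OF sig_form_cong.hyps(1)]
    by (auto intro!: wf_ctx_has_type_jdg_eq.sig_form intro: is_tyI)
next
  case (sig_intro_cong A \<Gamma> B i a a' b b')
  then have "\<Gamma> \<turnstile> subst1 B a \<doteq> subst1 B a' \<^bold>: Univ i"
    using subst1_cong_Univ by blast
  then show ?case using sig_intro_cong
    by (meson wf_ctx_has_type_jdg_eq.sig_intro wf_ctx_has_type_jdg_eq.conv is_ty_Sig is_tyI)
next
  case (sig_elim_cong A B \<Gamma> C C' i g g' p p')
  have B: "is_ty (A # \<Gamma>) B"
    using wf_of_jdg(2)[OF sig_elim_cong.hyps(2)] is_ty_ctx by blast
  have C: "SigT A B # \<Gamma> \<turnstile> C \<^bold>: Univ i" "SigT A B # \<Gamma> \<turnstile> C' \<^bold>: Univ i"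
    and p: "\<Gamma> \<turnstile> p \<^bold>: SigT A B" "\<Gamma> \<turnstile> p' \<^bold>: SigT A B" using sig_elim_cong by auto
  have "\<Gamma> \<turnstile> subst1 C p \<doteq> subst1 C' p \<^bold>: Univ i"
    using subst1_eq[OF sig_elim_cong.hyps(1) p(1)] by (simp add: subst1_def)
  moreover have "\<Gamma> \<turnstile> subst1 C' p \<doteq> subst1 C' p' \<^bold>: Univ i"
    using subst1_cong_Univ[OF C(2) sig_elim_cong.hyps(3) p] .
  \<comment> \<open>The branch \<open>g'\<close> is known at an instance of \<open>C\<close>; the
    same instantiation applied to the equality of the motives moves it to \<open>C'\<close>.\<close>
  moreover have "\<Gamma> \<turnstile> Split C' g' p' \<^bold>: subst1 C' p'"
    using substitution(2)[OF sub_ok_pair[OF B] sig_elim_cong.hyps(1)] sig_elim_cong.IH(2)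
    by (auto intro!: wf_ctx_has_type_jdg_eq.sig_elim C p intro: wf_ctx_has_type_jdg_eq.conv)
  ultimately have "\<Gamma> \<turnstile> Split C' g' p' \<^bold>: subst1 C p"
    by (meson wf_ctx_has_type_jdg_eq.conv wf_ctx_has_type_jdg_eq.eq_sym)
  then show ?case using sig_elim_cong.IH C p
    by (auto intro: wf_ctx_has_type_jdg_eq.sig_elim is_ty_subst1 is_tyI)
next
  case (nat_elim \<Gamma> C i c0 cs n)
  then show ?case using is_ty_subst1 is_tyI by blast
next
  case (nat_comp_zero \<Gamma> C i c0 cs)
  then show ?case
    by (auto intro: wf_ctx_has_type_jdg_eq.nat_elim wf_ctx_has_type_jdg_eq.nat_zero wf_of_jdg(1))
next
  case (nat_comp_succ \<Gamma> C i c0 cs n)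
  let ?r = "NatRec C c0 cs n"
  have r: "\<Gamma> \<turnstile> ?r \<^bold>: subst1 C n"
    using nat_comp_succ wf_ctx_has_type_jdg_eq.nat_elim by blast
  have "sub_ok \<Gamma> (?r \<rhd> n \<rhd> Var) (C # NatT # \<Gamma>)"
    using r nat_comp_succ.hyps wf_of_jdg(1)[OF r]
    by (intro sub_ok_scons sub_ok_Var) (simp_all add: subst1_def)
  from substitution(1)[OF this nat_comp_succ.hyps(3)]
  have "\<Gamma> \<turnstile> subst2 cs n ?r \<^bold>: subst (?r \<rhd> n \<rhd> Var) (subst (Succ (Var 1) \<rhd> (\<lambda>n. Var (n + 2))) C)"
    by (simp add: subst2_def)
  also have "subst (?r \<rhd> n \<rhd> Var) (subst (Succ (Var 1) \<rhd> (\<lambda>n. Var (n + 2))) C) = subst1 C (Succ n)"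
    unfolding subst1_def subst_subst
  proof (rule subst_eqI)
    fix k show "subst (?r \<rhd> n \<rhd> Var) ((Succ (Var 1) \<rhd> (\<lambda>n. Var (n + 2))) k) = (Succ n \<rhd> Var) k"
      by (cases k) simp_all
  qed
  finally show ?case
    using nat_comp_succ wf_ctx_has_type_jdg_eq.nat_elim wf_ctx_has_type_jdg_eq.nat_succ is_ty_subst1 is_tyI
    by blast
next
  case (nat_elim_cong \<Gamma> C C' i c0 c0' cs cs' n n')
  have C: "NatT # \<Gamma> \<turnstile> C \<^bold>: Univ i" "NatT # \<Gamma> \<turnstile> C' \<^bold>: Univ i"
    and n: "\<Gamma> \<turnstile> n \<^bold>: NatT" "\<Gamma> \<turnstile> n' \<^bold>: NatT" using nat_elim_cong by auto
  have wf: "wf_ctx (C # NatT # \<Gamma>)" "wf_ctx \<Gamma>" "wf_ctx (C' # NatT # \<Gamma>)"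
    using nat_elim_cong.hyps wf_of_jdg C by (auto intro: ctx_extend)
  have e1: "\<Gamma> \<turnstile> subst1 C m \<doteq> subst1 C' m \<^bold>: Univ i" if "\<Gamma> \<turnstile> m \<^bold>: NatT" for m
    using subst1_eq[OF nat_elim_cong.hyps(1) that] by (simp add: subst1_def)
  have e2: "\<Gamma> \<turnstile> subst1 C' n \<doteq> subst1 C' n' \<^bold>: Univ i"
    using subst1_cong_Univ[OF C(2) nat_elim_cong.hyps(4) n] .
  have e3: "C # NatT # \<Gamma> \<turnstile> subst (Succ (Var 1) \<rhd> (\<lambda>n. Var (n + 2))) C \<doteq>
      subst (Succ (Var 1) \<rhd> (\<lambda>n. Var (n + 2))) C' \<^bold>: Univ i"
    using substitution(2)[OF sub_ok_succ[OF wf(1)] nat_elim_cong.hyps(1)] by simp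
  \<comment> \<open>The motive also occurs in the context of the step, as the type of the induction
    hypothesis, so both the context and the type have to be converted.\<close>
  have "C' # NatT # \<Gamma> \<turnstile> cs' \<^bold>: subst (Succ (Var 1) \<rhd> (\<lambda>n. Var (n + 2))) C'"
    using ctx_conv(1)[OF nat_elim_cong.hyps(1) is_tyI[OF C(2)]] e3 nat_elim_cong.IH(3)
    by (meson wf_ctx_has_type_jdg_eq.conv)
  moreover have "\<Gamma> \<turnstile> c0' \<^bold>: subst1 C' Zero"
    using e1[OF wf_ctx_has_type_jdg_eq.nat_zero[OF wf(2)]] nat_elim_cong.IH(2)
    by (meson wf_ctx_has_type_jdg_eq.conv)
  ultimately have "\<Gamma> \<turnstile> NatRec C' c0' cs' n' \<^bold>: subst1 C' n'"
    using C n by (auto intro: wf_ctx_has_type_jdg_eq.nat_elim)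
  then have "\<Gamma> \<turnstile> NatRec C' c0' cs' n' \<^bold>: subst1 C n"
    using e1[OF n(1)] e2 by (meson wf_ctx_has_type_jdg_eq.conv wf_ctx_has_type_jdg_eq.eq_sym)
  then show ?case using nat_elim_cong.IH C n
    by (auto intro: wf_ctx_has_type_jdg_eq.nat_elim is_ty_subst1 is_tyI)
next
  case (id_form \<Gamma> A i a b)
  then show ?case by simp
next
  case (id_intro \<Gamma> A i a)
  then show ?case using is_ty_Id by blast
next
  case (id_elim A \<Gamma> C i c a b p)
  then show ?case unfolding subst3_def using is_ty_subst[OF is_tyI] sub_ok_id by blast
next
  case (id_comp A \<Gamma> C i c a)
  obtain j where "\<Gamma> \<turnstile> A \<^bold>: Univ j" using id_comp.IH(3) by (auto simp: is_ty_def)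
  then have rf: "\<Gamma> \<turnstile> Refl a \<^bold>: IdT A a a" using id_comp by (auto intro: wf_ctx_has_type_jdg_eq.id_intro)
  have "subst (a \<rhd> Var) (subst (Refl (Var 0) \<rhd> Var 0 \<rhd> Var 0 \<rhd> (\<lambda>n. Var (n + 1))) C) = subst3 C a a (Refl a)"
    unfolding subst3_def subst_subst
  proof (rule subst_eqI)
    fix n show "subst (a \<rhd> Var) ((Refl (Var 0) \<rhd> Var 0 \<rhd> Var 0 \<rhd> (\<lambda>n. Var (n + 1))) n) =
        (Refl a \<rhd> a \<rhd> a \<rhd> Var) n"
      using nat_cases3[of n] by auto
  qed
  then have "\<Gamma> \<turnstile> subst1 c a \<^bold>: subst3 C a a (Refl a)"
    using subst1_ty[OF id_comp.hyps(2,3)] by (simp add: subst1_def)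
  moreover have "is_ty \<Gamma> (subst3 C a a (Refl a))"
    unfolding subst3_def using is_ty_subst[OF is_tyI[OF id_comp.hyps(1)]] sub_ok_id rf id_comp.hyps by blast
  ultimately show ?case using wf_ctx_has_type_jdg_eq.id_elim id_comp.hyps rf by blast
next
  case (id_form_cong \<Gamma> A A' i a a' b b')
  then show ?case by (auto intro: wf_ctx_has_type_jdg_eq.id_form wf_ctx_has_type_jdg_eq.conv)
next
  case (id_intro_cong \<Gamma> A i a a')
  then have "is_ty \<Gamma> A" by (auto intro: is_tyI)
  then obtain j where "\<Gamma> \<turnstile> IdT A a a \<doteq> IdT A a' a' \<^bold>: Univ j"
    using id_intro_cong id_conv by blast
  then show ?case using id_intro_cong \<open>is_ty \<Gamma> A\<close>
    by (meson wf_ctx_has_type_jdg_eq.id_intro wf_ctx_has_type_jdg_eq.conv wf_ctx_has_type_jdg_eq.eq_sym is_ty_Id)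
next
  case (id_elim_cong A \<Gamma> C C' i c c' a a' b b' p p')
  let ?\<rho> = "Refl (Var 0) \<rhd> Var 0 \<rhd> Var 0 \<rhd> (\<lambda>n. Var (n + 1))"
  have C: "IdT (A\<up>2) (Var 1) (Var 0) # A\<up>1 # A # \<Gamma> \<turnstile> C \<^bold>: Univ i"
      "IdT (A\<up>2) (Var 1) (Var 0) # A\<up>1 # A # \<Gamma> \<turnstile> C' \<^bold>: Univ i"
    and a: "\<Gamma> \<turnstile> a \<^bold>: A" "\<Gamma> \<turnstile> a' \<^bold>: A" and b: "\<Gamma> \<turnstile> b \<^bold>: A" "\<Gamma> \<turnstile> b' \<^bold>: A"
    and p: "\<Gamma> \<turnstile> p \<^bold>: IdT A a b" "\<Gamma> \<turnstile> p' \<^bold>: IdT A a b" and A: "is_ty \<Gamma> A"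
    using id_elim_cong.IH by auto
  \<comment> \<open>So far \<open>p'\<close> is only a path between the old end points, whereas the
    eliminator on the right requires one between \<open>a'\<close> and \<open>b'\<close>.\<close>
  obtain j where "\<Gamma> \<turnstile> IdT A a b \<doteq> IdT A a' b' \<^bold>: Univ j"
    using id_conv[OF A id_elim_cong.hyps(3,4)] by blast
  then have p': "\<Gamma> \<turnstile> p' \<^bold>: IdT A a' b'" using p(2) by (rule wf_ctx_has_type_jdg_eq.conv[rotated])
  have wf: "wf_ctx (A # \<Gamma>)" using id_elim_cong.hyps(2) by (rule wf_of_jdg)
  have "A # \<Gamma> \<turnstile> subst ?\<rho> C \<doteq> subst ?\<rho> C' \<^bold>: Univ i"
    using substitution(2)[OF sub_ok_refl[OF wf] id_elim_cong.hyps(1)] by simp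
  then have "A # \<Gamma> \<turnstile> c' \<^bold>: subst ?\<rho> C'"
    using id_elim_cong.IH(2) by (meson wf_ctx_has_type_jdg_eq.conv)
  then have "\<Gamma> \<turnstile> IdRec C' c' a' b' p' \<^bold>: subst3 C' a' b' p'"
    using C(2) a(2) b(2) p' by (auto intro: wf_ctx_has_type_jdg_eq.id_elim)
  moreover have "\<Gamma> \<turnstile> subst3 C a b p \<doteq> subst3 C' a b p \<^bold>: Univ i"
    using substitution(2)[OF sub_ok_id[OF a(1) b(1) p(1)] id_elim_cong.hyps(1)] by (simp add: subst3_def)
  moreover have "\<Gamma> \<turnstile> subst3 C' a b p \<doteq> subst3 C' a' b' p' \<^bold>: Univ i"
    using subst3_cong_Univ[OF C(2) a(1) b(1) p(1) a(2) b(2) p'] id_elim_cong.hyps by blast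
  ultimately have "\<Gamma> \<turnstile> IdRec C' c' a' b' p' \<^bold>: subst3 C a b p"
    by (meson wf_ctx_has_type_jdg_eq.conv wf_ctx_has_type_jdg_eq.eq_sym)
  moreover have "\<Gamma> \<turnstile> IdRec C c a b p \<^bold>: subst3 C a b p"
    using C(1) id_elim_cong.IH(2) a(1) b(1) p(1) by (auto intro: wf_ctx_has_type_jdg_eq.id_elim)
  moreover have "is_ty \<Gamma> (subst3 C a b p)"
    unfolding subst3_def using is_ty_subst[OF is_tyI[OF C(1)] sub_ok_id[OF a(1) b(1) p(1)]] .
  ultimately show ?case by simp
qed (auto intro: wf_ctx_has_type_jdg_eq.nat_form wf_ctx_has_type_jdg_eq.nat_zero wf_ctx_has_type_jdg_eq.nat_succ
      wf_ctx_has_type_jdg_eq.univ is_tyI dest: wf_of_jdg)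

section \<open>Substitution in the path and function extensionality terms\<close>

declare subst1_def [simp] subst2_def [simp] subst3_def [simp]

lemma weaken_Suc_0 [simp]: "t \<up> Suc 0 = t \<up> 1"
  by (simp add: One_nat_def)

lemma arr_subst [simp]: "subst \<sigma> (arr A B) = arr (subst \<sigma> A) (subst \<sigma> B)"
  by (simp add: arr_def)

lemma path_inv_subst [simp]:
  "subst \<sigma> (path_inv A x y p) = path_inv (subst \<sigma> A) (subst \<sigma> x) (subst \<sigma> y) (subst \<sigma> p)"
  by (simp add: path_inv_def)

lemma path_concat_subst [simp]:
  "subst \<sigma> (path_concat A x y z p q) =
    path_concat (subst \<sigma> A) (subst \<sigma> x) (subst \<sigma> y) (subst \<sigma> z) (subst \<sigma> p) (subst \<sigma> q)"
  by (simp add: path_concat_def)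

lemma ap_subst [simp]:
  "subst \<sigma> (ap B f x y p) = ap (subst \<sigma> B) (subst \<sigma> f) (subst \<sigma> x) (subst \<sigma> y) (subst \<sigma> p)"
  by (simp add: ap_def)

lemma transport_subst [simp]:
  "subst \<sigma> (transport P x y p u) =
    transport (subst \<sigma> P) (subst \<sigma> x) (subst \<sigma> y) (subst \<sigma> p) (subst \<sigma> u)"
  by (simp add: transport_def)

lemma right_unit_subst [simp]:
  "subst \<sigma> (right_unit A x y p) = right_unit (subst \<sigma> A) (subst \<sigma> x) (subst \<sigma> y) (subst \<sigma> p)"
  by (simp add: right_unit_def)

lemma pr1_subst [simp]: "subst \<sigma> (pr1 A p) = pr1 (subst \<sigma> A) (subst \<sigma> p)"
  by (simp add: pr1_def)

lemma pr2_subst [simp]: "subst \<sigma> (pr2 A B p) = pr2 (subst \<sigma> A) (subst (up \<sigma>) B) (subst \<sigma> p)"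
proof -
  have "subst (up \<sigma>) (subst (pr1 (A\<up>1) (Var 0) \<rhd> (\<lambda>n. Var (n + 1))) B) =
    subst (pr1 (subst \<sigma> A\<up>1) (Var 0) \<rhd> (\<lambda>n. Var (n + 1))) (subst (up \<sigma>) B)"
  proof (rule subst_subst_eqI)
    fix n show "subst (up \<sigma>) ((pr1 (A\<up>1) (Var 0) \<rhd> (\<lambda>n. Var (n + 1))) n) =
        subst (pr1 (subst \<sigma> A\<up>1) (Var 0) \<rhd> (\<lambda>n. Var (n + 1))) (up \<sigma> n)"
      by (cases n) simp_all
  qed
  then show ?thesis by (simp add: pr2_def)
qed

lemma pi_fam_subst [simp]: "subst \<sigma> (pi_fam A B) = pi_fam (subst \<sigma> A) (subst \<sigma> B)"
  by (simp add: pi_fam_def)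

lemma homotopy_subst [simp]:
  "subst \<sigma> (homotopy A B g h) = homotopy (subst \<sigma> A) (subst \<sigma> B) (subst \<sigma> g) (subst \<sigma> h)"
  by (simp add: homotopy_def)

lemma happly_subst [simp]:
  "subst \<sigma> (happly A B g h) = happly (subst \<sigma> A) (subst \<sigma> B) (subst \<sigma> g) (subst \<sigma> h)"
  by (simp add: happly_def)

lemma rinv_fam_subst [simp]: "subst (up \<sigma>) (rinv_fam B f) = rinv_fam (subst \<sigma> B) (subst \<sigma> f)"
  by (simp add: rinv_fam_def)

lemma linv_fam_subst [simp]: "subst (up \<sigma>) (linv_fam B f) = linv_fam (subst \<sigma> B) (subst \<sigma> f)"
  by (simp add: linv_fam_def)

lemma rinv_subst [simp]: "subst \<sigma> (rinv A B f) = rinv (subst \<sigma> A) (subst \<sigma> B) (subst \<sigma> f)"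
  by (simp add: rinv_def)

lemma linv_subst [simp]: "subst \<sigma> (linv A B f) = linv (subst \<sigma> A) (subst \<sigma> B) (subst \<sigma> f)"
  by (simp add: linv_def)

lemma isequiv_subst [simp]:
  "subst \<sigma> (isequiv A B f) = isequiv (subst \<sigma> A) (subst \<sigma> B) (subst \<sigma> f)"
  by (simp add: isequiv_def)

lemma FunExt_subst [simp]: "subst \<sigma> (FunExt i) = FunExt i"
  by (simp add: FunExt_def)

lemma funext_rinv_subst [simp]:
  "subst \<sigma> (funext_rinv fe A B g h) =
    funext_rinv (subst \<sigma> fe) (subst \<sigma> A) (subst \<sigma> B) (subst \<sigma> g) (subst \<sigma> h)"
  by (simp add: funext_rinv_def)

lemma funext_subst [simp]:
  "subst \<sigma> (funext fe A B g h \<xi>) =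
    funext (subst \<sigma> fe) (subst \<sigma> A) (subst \<sigma> B) (subst \<sigma> g) (subst \<sigma> h) (subst \<sigma> \<xi>)"
  by (simp add: funext_def)

lemma happly_funext_subst [simp]:
  "subst \<sigma> (happly_funext fe A B g h \<xi>) =
    happly_funext (subst \<sigma> fe) (subst \<sigma> A) (subst \<sigma> B) (subst \<sigma> g) (subst \<sigma> h) (subst \<sigma> \<xi>)"
  by (simp add: happly_funext_def)

text \<open>Lets weakening act on the defined constants without unfolding them, by reading it as a
  substitution.\<close>

lemma path_weaken [simp]:
  "arr A B \<up> k = arr (A\<up>k) (B\<up>k)"
  "path_inv A x y p \<up> k = path_inv (A\<up>k) (x\<up>k) (y\<up>k) (p\<up>k)"
  "path_concat A x y z p q \<up> k = path_concat (A\<up>k) (x\<up>k) (y\<up>k) (z\<up>k) (p\<up>k) (q\<up>k)"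
  "ap B f x y p \<up> k = ap (B\<up>k) (f\<up>k) (x\<up>k) (y\<up>k) (p\<up>k)"
  "right_unit A x y p \<up> k = right_unit (A\<up>k) (x\<up>k) (y\<up>k) (p\<up>k)"
  "pr1 A p \<up> k = pr1 (A\<up>k) (p\<up>k)"
  "pi_fam A B \<up> k = pi_fam (A\<up>k) (B\<up>k)"
  "homotopy A B g h \<up> k = homotopy (A\<up>k) (B\<up>k) (g\<up>k) (h\<up>k)"
  "happly A B g h \<up> k = happly (A\<up>k) (B\<up>k) (g\<up>k) (h\<up>k)"
  "rinv A B f \<up> k = rinv (A\<up>k) (B\<up>k) (f\<up>k)"
  "linv A B f \<up> k = linv (A\<up>k) (B\<up>k) (f\<up>k)"
  "isequiv A B f \<up> k = isequiv (A\<up>k) (B\<up>k) (f\<up>k)"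
  "FunExt i \<up> k = FunExt i"
  "funext_rinv fe A B g h \<up> k = funext_rinv (fe\<up>k) (A\<up>k) (B\<up>k) (g\<up>k) (h\<up>k)"
  "funext fe A B g h \<xi> \<up> k = funext (fe\<up>k) (A\<up>k) (B\<up>k) (g\<up>k) (h\<up>k) (\<xi>\<up>k)"
  "happly_funext fe A B g h \<xi> \<up> k = happly_funext (fe\<up>k) (A\<up>k) (B\<up>k) (g\<up>k) (h\<up>k) (\<xi>\<up>k)"
  unfolding weaken_eq_subst
  by (rule arr_subst path_inv_subst path_concat_subst ap_subst right_unit_subst pr1_subst pi_fam_subst
      homotopy_subst happly_subst rinv_subst linv_subst isequiv_subst FunExt_subst funext_rinv_subst
      funext_subst happly_funext_subst)+

section \<open>Derived rules\<close>

definition ty_eq :: "tm list \<Rightarrow> tm \<Rightarrow> tm \<Rightarrow> bool" where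
  "ty_eq \<Gamma> A B \<longleftrightarrow> (\<exists>i. \<Gamma> \<turnstile> A \<doteq> B \<^bold>: Univ i)"

lemma wfI: "is_ty \<Gamma> A \<Longrightarrow> wf_ctx (A # \<Gamma>)"
  by (auto simp: is_ty_def intro: ctx_extend)

lemma wf_of_is_ty: "is_ty \<Gamma> A \<Longrightarrow> wf_ctx \<Gamma>"
  by (auto simp: is_ty_def dest: wf_of_jdg)

lemma has_is_ty: "\<Gamma> \<turnstile> a \<^bold>: A \<Longrightarrow> is_ty \<Gamma> A"
  by (rule presuppositions(2))

lemma eq_left: "\<Gamma> \<turnstile> a \<doteq> b \<^bold>: A \<Longrightarrow> \<Gamma> \<turnstile> a \<^bold>: A"
  and eq_right: "\<Gamma> \<turnstile> a \<doteq> b \<^bold>: A \<Longrightarrow> \<Gamma> \<turnstile> b \<^bold>: A"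
  and eq_is_ty: "\<Gamma> \<turnstile> a \<doteq> b \<^bold>: A \<Longrightarrow> is_ty \<Gamma> A"
  using presuppositions(3) by blast+

lemma ty_eq_is_ty: "ty_eq \<Gamma> A B \<Longrightarrow> is_ty \<Gamma> A" "ty_eq \<Gamma> A B \<Longrightarrow> is_ty \<Gamma> B"
  by (auto simp: ty_eq_def is_ty_def dest: eq_left eq_right)

lemma ty_eqI: "\<Gamma> \<turnstile> A \<doteq> B \<^bold>: Univ i \<Longrightarrow> ty_eq \<Gamma> A B"
  by (auto simp: ty_eq_def)

lemma ty_eq_refl: "is_ty \<Gamma> A \<Longrightarrow> ty_eq \<Gamma> A A"
  by (auto simp: ty_eq_def is_ty_def intro: eq_refl)

lemma ty_eq_sym: "ty_eq \<Gamma> A B \<Longrightarrow> ty_eq \<Gamma> B A"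
  by (auto simp: ty_eq_def intro: eq_sym)

lemma ty_eq_Pi: "ty_eq \<Gamma> A A' \<Longrightarrow> ty_eq (A # \<Gamma>) B B' \<Longrightarrow> ty_eq \<Gamma> (PiT A B) (PiT A' B')"
  unfolding ty_eq_def by (meson pi_form_cong eq_cumul_le max.cobounded1 max.cobounded2)

lemma ty_eq_Id:
  "ty_eq \<Gamma> A A' \<Longrightarrow> \<Gamma> \<turnstile> a \<doteq> a' \<^bold>: A \<Longrightarrow> \<Gamma> \<turnstile> b \<doteq> b' \<^bold>: A \<Longrightarrow> ty_eq \<Gamma> (IdT A a b) (IdT A' a' b')"
  unfolding ty_eq_def by (meson id_form_cong)

lemma ty_eq_weaken1: "ty_eq \<Gamma> A B \<Longrightarrow> wf_ctx (C # \<Gamma>) \<Longrightarrow> ty_eq (C # \<Gamma>) (A\<up>1) (B\<up>1)"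
  unfolding ty_eq_def using weakening1(2) by fastforce

lemma ty_eq_arr: "ty_eq \<Gamma> A A' \<Longrightarrow> ty_eq \<Gamma> B B' \<Longrightarrow> ty_eq \<Gamma> (arr A B) (arr A' B')"
  unfolding arr_def by (auto intro!: ty_eq_Pi ty_eq_weaken1 wfI dest: ty_eq_is_ty)

lemma conv_ty: "\<Gamma> \<turnstile> a \<^bold>: A \<Longrightarrow> ty_eq \<Gamma> A B \<Longrightarrow> \<Gamma> \<turnstile> a \<^bold>: B"
  by (auto simp: ty_eq_def intro: conv)

lemma eq_conv_ty: "\<Gamma> \<turnstile> a \<doteq> b \<^bold>: A \<Longrightarrow> ty_eq \<Gamma> A B \<Longrightarrow> \<Gamma> \<turnstile> a \<doteq> b \<^bold>: B"
  by (auto simp: ty_eq_def intro: eq_conv)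

lemma is_ty_arr: "is_ty \<Gamma> A \<Longrightarrow> is_ty \<Gamma> B \<Longrightarrow> is_ty \<Gamma> (arr A B)"
  unfolding arr_def by (auto intro!: is_ty_Pi is_ty_weak1 wfI)

lemma is_ty_Nat: "wf_ctx \<Gamma> \<Longrightarrow> is_ty \<Gamma> NatT"
  by (auto intro: is_tyI nat_form)

text \<open>The type is given through an equation, so that the rule applies whatever form the
  expected type has and the index arithmetic is left to \<open>simp\<close>. The rules below with
  such a premise on \<open>T\<close> follow the same pattern.\<close>

lemma var_ty: "wf_ctx \<Gamma> \<Longrightarrow> n < length \<Gamma> \<Longrightarrow> T = (\<Gamma> ! n) \<up> Suc n \<Longrightarrow> \<Gamma> \<turnstile> Var n \<^bold>: T"
  by (simp add: var)

lemma weak1: "wf_ctx (C # \<Gamma>) \<Longrightarrow> \<Gamma> \<turnstile> a \<^bold>: A \<Longrightarrow> T = A\<up>1 \<Longrightarrow> C # \<Gamma> \<turnstile> a\<up>1 \<^bold>: T"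
  by (simp add: weakening1)

lemma weak2: "wf_ctx (C # D # \<Gamma>) \<Longrightarrow> \<Gamma> \<turnstile> a \<^bold>: A \<Longrightarrow> T = A\<up>2 \<Longrightarrow> C # D # \<Gamma> \<turnstile> a\<up>2 \<^bold>: T"
  using weakening(1)[of "[C, D]" \<Gamma> a A] by (simp add: numeral_2_eq_2)

lemma weak3: "wf_ctx (C # D # E # \<Gamma>) \<Longrightarrow> \<Gamma> \<turnstile> a \<^bold>: A \<Longrightarrow> T = A\<up>3 \<Longrightarrow> C # D # E # \<Gamma> \<turnstile> a\<up>3 \<^bold>: T"
  using weakening(1)[of "[C, D, E]" \<Gamma> a A] by (simp add: numeral_3_eq_3)

lemma is_ty_weak2: "wf_ctx (C # D # \<Gamma>) \<Longrightarrow> is_ty \<Gamma> A \<Longrightarrow> is_ty (C # D # \<Gamma>) (A\<up>2)"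
  unfolding is_ty_def using weak2 by (metis weaken_simps(2))

lemma is_ty_weak3: "wf_ctx (C # D # E # \<Gamma>) \<Longrightarrow> is_ty \<Gamma> A \<Longrightarrow> is_ty (C # D # E # \<Gamma>) (A\<up>3)"
  unfolding is_ty_def using weak3 by (metis weaken_simps(2))

lemma id_inv:
  assumes "\<Gamma> \<turnstile> p \<^bold>: IdT A x y"
  shows "is_ty \<Gamma> A" "\<Gamma> \<turnstile> x \<^bold>: A" "\<Gamma> \<turnstile> y \<^bold>: A"
  using is_ty_Id_inv[OF has_is_ty[OF assms]] by auto

lemma arr_inv:
  assumes "\<Gamma> \<turnstile> f \<^bold>: arr A B"
  shows "is_ty \<Gamma> A"
  using is_ty_Pi_inv has_is_ty[OF assms] unfolding arr_def by blast

text \<open>Inversion yields the codomain only weakened into the context extended by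
  \<open>A\<close>; instantiating at the inhabitant \<open>a\<close> removes the weakening.\<close>

lemma arr_inv_cod:
  assumes "\<Gamma> \<turnstile> f \<^bold>: arr A B" "\<Gamma> \<turnstile> a \<^bold>: A"
  shows "is_ty \<Gamma> B"
  using has_is_ty[OF pi_elim[OF assms[unfolded arr_def]]] by simp

lemma pi_app: "\<Gamma> \<turnstile> f \<^bold>: PiT A B \<Longrightarrow> \<Gamma> \<turnstile> a \<^bold>: A \<Longrightarrow> T = subst (a \<rhd> Var) B \<Longrightarrow> \<Gamma> \<turnstile> f \<bullet> a \<^bold>: T"
  using pi_elim by fastforce

lemma pi_app_cong: "\<Gamma> \<turnstile> f \<doteq> f' \<^bold>: PiT A B \<Longrightarrow> \<Gamma> \<turnstile> a \<doteq> a' \<^bold>: A \<Longrightarrow> T = subst (a \<rhd> Var) B \<Longrightarrow>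
    \<Gamma> \<turnstile> f \<bullet> a \<doteq> f' \<bullet> a' \<^bold>: T"
  using pi_elim_cong by fastforce

lemma pi_beta: "A # \<Gamma> \<turnstile> b \<^bold>: B \<Longrightarrow> \<Gamma> \<turnstile> a \<^bold>: A \<Longrightarrow> t = subst (a \<rhd> Var) b \<Longrightarrow> T = subst (a \<rhd> Var) B \<Longrightarrow>
    \<Gamma> \<turnstile> Lam A b \<bullet> a \<doteq> t \<^bold>: T"
  using pi_comp by fastforce

lemma arr_app: "\<Gamma> \<turnstile> f \<^bold>: arr A B \<Longrightarrow> \<Gamma> \<turnstile> a \<^bold>: A \<Longrightarrow> \<Gamma> \<turnstile> f \<bullet> a \<^bold>: B"
  unfolding arr_def by (erule (1) pi_app) simp

lemma arr_app_cong: "\<Gamma> \<turnstile> f \<doteq> f' \<^bold>: arr A B \<Longrightarrow> \<Gamma> \<turnstile> a \<doteq> a' \<^bold>: A \<Longrightarrow> \<Gamma> \<turnstile> f \<bullet> a \<doteq> f' \<bullet> a' \<^bold>: B"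
  unfolding arr_def by (erule (1) pi_app_cong) simp

lemma arr_lam: "A # \<Gamma> \<turnstile> b \<^bold>: B\<up>1 \<Longrightarrow> \<Gamma> \<turnstile> Lam A b \<^bold>: arr A B"
  unfolding arr_def by (rule pi_intro)

lemma refl_ty: "\<Gamma> \<turnstile> x \<^bold>: A \<Longrightarrow> \<Gamma> \<turnstile> Refl x \<^bold>: IdT A x x"
  using has_is_ty[of \<Gamma> x A] by (auto simp: is_ty_def intro: id_intro)

lemma refl_cong: "\<Gamma> \<turnstile> x \<doteq> y \<^bold>: A \<Longrightarrow> \<Gamma> \<turnstile> Refl x \<doteq> Refl y \<^bold>: IdT A x x"
  using eq_is_ty[of \<Gamma> x y A] by (auto simp: is_ty_def intro: id_intro_cong)

abbreviation id_ctx :: "tm \<Rightarrow> tm list \<Rightarrow> tm list" where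
  "id_ctx A \<Gamma> \<equiv> IdT (A\<up>2) (Var 1) (Var 0) # A\<up>1 # A # \<Gamma>"

abbreviation refl_inst :: "tm \<Rightarrow> tm" where
  "refl_inst C \<equiv> subst (Refl (Var 0) \<rhd> Var 0 \<rhd> Var 0 \<rhd> (\<lambda>n. Var (n + 1))) C"

lemma wf_id_ctx: "is_ty \<Gamma> A \<Longrightarrow> wf_ctx (id_ctx A \<Gamma>)"
  by (rule wfI is_ty_Id is_ty_weak2 is_ty_weak1 var_ty | assumption | simp)+

lemma J_ty:
  assumes "is_ty (id_ctx A \<Gamma>) C" "A # \<Gamma> \<turnstile> c \<^bold>: T0" "T0 = refl_inst C"
    "\<Gamma> \<turnstile> p \<^bold>: IdT A a b" "T = subst (p \<rhd> b \<rhd> a \<rhd> Var) C"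
  shows "\<Gamma> \<turnstile> IdRec C c a b p \<^bold>: T"
  using assms id_inv[OF assms(4)] id_elim[of A \<Gamma> C _ c a b p] by (auto simp: is_ty_def)

lemma J_refl:
  assumes "is_ty (id_ctx A \<Gamma>) C" "A # \<Gamma> \<turnstile> c \<^bold>: T0" "T0 = refl_inst C"
    "\<Gamma> \<turnstile> a \<^bold>: A" "T = subst (Refl a \<rhd> a \<rhd> a \<rhd> Var) C" "t = subst (a \<rhd> Var) c"
  shows "\<Gamma> \<turnstile> IdRec C c a a (Refl a) \<doteq> t \<^bold>: T"
  using assms id_comp[of A \<Gamma> C _ c a] by (auto simp: is_ty_def)

lemma J_cong:
  assumes "ty_eq (id_ctx A \<Gamma>) C C'" "A # \<Gamma> \<turnstile> c \<doteq> c' \<^bold>: T0" "T0 = refl_inst C"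
    "\<Gamma> \<turnstile> a \<doteq> a' \<^bold>: A" "\<Gamma> \<turnstile> b \<doteq> b' \<^bold>: A" "\<Gamma> \<turnstile> p \<doteq> p' \<^bold>: IdT A a b" "T = subst (p \<rhd> b \<rhd> a \<rhd> Var) C"
  shows "\<Gamma> \<turnstile> IdRec C c a b p \<doteq> IdRec C' c' a' b' p' \<^bold>: T"
  using assms id_elim_cong[of A \<Gamma> C C' _ c c' a a' b b' p p'] by (auto simp: ty_eq_def)

section \<open>The groupoid operations\<close>

lemma path_inv_motive: "is_ty \<Gamma> A \<Longrightarrow> is_ty (id_ctx A \<Gamma>) (IdT (A\<up>3) (Var 1) (Var 2))"
  by (rule is_ty_Id is_ty_weak3 var_ty wf_id_ctx | assumption | simp)+

lemma path_inv_base: "is_ty \<Gamma> A \<Longrightarrow> A # \<Gamma> \<turnstile> Refl (Var 0) \<^bold>: IdT (A\<up>1) (Var 0) (Var 0)"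
  by (rule refl_ty var_ty wfI | assumption | simp)+

lemma path_inv_ty: "\<Gamma> \<turnstile> p \<^bold>: IdT A x y \<Longrightarrow> \<Gamma> \<turnstile> path_inv A x y p \<^bold>: IdT A y x"
  unfolding path_inv_def
  by (rule J_ty[OF path_inv_motive path_inv_base]) (auto dest: id_inv)

lemma path_inv_refl: "\<Gamma> \<turnstile> x \<^bold>: A \<Longrightarrow> \<Gamma> \<turnstile> path_inv A x x (Refl x) \<doteq> Refl x \<^bold>: IdT A x x"
  unfolding path_inv_def
  by (rule J_refl[OF path_inv_motive path_inv_base]) (auto dest: has_is_ty)

lemma path_concat_motive:
  assumes "\<Gamma> \<turnstile> z \<^bold>: A"
  shows "is_ty (id_ctx A \<Gamma>) (arr (IdT (A\<up>3) (Var 1) (z\<up>3)) (IdT (A\<up>3) (Var 2) (z\<up>3)))"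
  by (rule is_ty_arr is_ty_Id is_ty_weak3 var_ty wf_id_ctx weak3 has_is_ty[OF assms] assms | simp)+

lemma path_concat_base:
  assumes "\<Gamma> \<turnstile> z \<^bold>: A"
  shows "A # \<Gamma> \<turnstile> Lam (IdT (A\<up>1) (Var 0) (z\<up>1)) (Var 0)
    \<^bold>: arr (IdT (A\<up>1) (Var 0) (z\<up>1)) (IdT (A\<up>1) (Var 0) (z\<up>1))"
  by (rule arr_lam var_ty wfI is_ty_Id is_ty_weak1 weak1 has_is_ty[OF assms] assms | simp)+

lemma path_concat_fun_ty:
  assumes "\<Gamma> \<turnstile> p \<^bold>: IdT A x y" "\<Gamma> \<turnstile> z \<^bold>: A"
  shows "\<Gamma> \<turnstile> IdRec (arr (IdT (A\<up>3) (Var 1) (z\<up>3)) (IdT (A\<up>3) (Var 2) (z\<up>3)))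
       (Lam (IdT (A\<up>1) (Var 0) (z\<up>1)) (Var 0)) x y p \<^bold>: arr (IdT A y z) (IdT A x z)"
  by (rule J_ty[OF path_concat_motive path_concat_base]) (use assms in auto)

lemma path_concat_ty:
  assumes "\<Gamma> \<turnstile> p \<^bold>: IdT A x y" "\<Gamma> \<turnstile> q \<^bold>: IdT A y z"
  shows "\<Gamma> \<turnstile> path_concat A x y z p q \<^bold>: IdT A x z"
  unfolding path_concat_def by (rule arr_app[OF path_concat_fun_ty]) (use assms id_inv[OF assms(2)] in auto)

lemma path_concat_refl:
  assumes "\<Gamma> \<turnstile> q \<^bold>: IdT A x z"
  shows "\<Gamma> \<turnstile> path_concat A x x z (Refl x) q \<doteq> q \<^bold>: IdT A x z"
proof -
  note i = id_inv[OF assms]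
  have "\<Gamma> \<turnstile> path_concat A x x z (Refl x) q \<doteq> Lam (IdT A x z) (Var 0) \<bullet> q \<^bold>: IdT A x z"
    unfolding path_concat_def
    by (rule arr_app_cong[OF J_refl[OF path_concat_motive path_concat_base] eq_refl])
      (use i assms in auto)
  moreover have "\<Gamma> \<turnstile> Lam (IdT A x z) (Var 0) \<bullet> q \<doteq> q \<^bold>: IdT A x z"
    by (rule pi_beta[OF var0]) (use assms wfI[OF has_is_ty[OF assms]] in auto)
  ultimately show ?thesis by (rule eq_trans)
qed

lemma ap_motive:
  assumes "\<Gamma> \<turnstile> f \<^bold>: arr A B" "is_ty \<Gamma> B"
  shows "is_ty (id_ctx A \<Gamma>) (IdT (B\<up>3) (f\<up>3 \<bullet> Var 2) (f\<up>3 \<bullet> Var 1))"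
  by (rule is_ty_Id is_ty_weak3 wf_id_ctx arr_inv[OF assms(1)] assms |
      rule arr_app[where A = "A\<up>3"] weak3[where A = "arr A B"] var_ty | simp)+

lemma ap_base:
  assumes "\<Gamma> \<turnstile> f \<^bold>: arr A B"
  shows "A # \<Gamma> \<turnstile> Refl (f\<up>1 \<bullet> Var 0) \<^bold>: IdT (B\<up>1) (f\<up>1 \<bullet> Var 0) (f\<up>1 \<bullet> Var 0)"
  by (rule refl_ty arr_app[where A = "A\<up>1"] weak1[where A = "arr A B"] var_ty wfI arr_inv[OF assms] assms | simp)+

lemma ap_ty:
  assumes "\<Gamma> \<turnstile> f \<^bold>: arr A B" "\<Gamma> \<turnstile> p \<^bold>: IdT A x y"
  shows "\<Gamma> \<turnstile> ap B f x y p \<^bold>: IdT B (f \<bullet> x) (f \<bullet> y)"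
  unfolding ap_def
  by (rule J_ty[OF ap_motive ap_base]) (use assms arr_inv_cod[OF assms(1)] id_inv[OF assms(2)] in auto)

lemma ap_refl:
  assumes "\<Gamma> \<turnstile> f \<^bold>: arr A B" "\<Gamma> \<turnstile> x \<^bold>: A"
  shows "\<Gamma> \<turnstile> ap B f x x (Refl x) \<doteq> Refl (f \<bullet> x) \<^bold>: IdT B (f \<bullet> x) (f \<bullet> x)"
  unfolding ap_def
  by (rule J_refl[OF ap_motive ap_base]) (use assms arr_inv_cod[OF assms] in auto)

lemma weak3_eq: "wf_ctx (C # D # E # \<Gamma>) \<Longrightarrow> \<Gamma> \<turnstile> a \<doteq> b \<^bold>: A \<Longrightarrow> T = A\<up>3 \<Longrightarrow> C # D # E # \<Gamma> \<turnstile> a\<up>3 \<doteq> b\<up>3 \<^bold>: T"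
  using weakening(2)[of "[C, D, E]" \<Gamma> a b A] by (simp add: numeral_3_eq_3)

lemma weak1_eq: "wf_ctx (C # \<Gamma>) \<Longrightarrow> \<Gamma> \<turnstile> a \<doteq> b \<^bold>: A \<Longrightarrow> T = A\<up>1 \<Longrightarrow> C # \<Gamma> \<turnstile> a\<up>1 \<doteq> b\<up>1 \<^bold>: T"
  by (simp add: weakening1)

lemma lam_cong: "ty_eq \<Gamma> A A' \<Longrightarrow> A # \<Gamma> \<turnstile> b \<doteq> b' \<^bold>: B \<Longrightarrow> \<Gamma> \<turnstile> Lam A b \<doteq> Lam A' b' \<^bold>: PiT A B"
  by (auto simp: ty_eq_def intro: pi_intro_cong)

lemma ap_cong:
  assumes "\<Gamma> \<turnstile> f \<^bold>: arr A B" "\<Gamma> \<turnstile> x \<doteq> x' \<^bold>: A" "\<Gamma> \<turnstile> y \<doteq> y' \<^bold>: A" "\<Gamma> \<turnstile> p \<doteq> p' \<^bold>: IdT A x y"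
  shows "\<Gamma> \<turnstile> ap B f x y p \<doteq> ap B f x' y' p' \<^bold>: IdT B (f \<bullet> x) (f \<bullet> y)"
  unfolding ap_def
  by (rule J_cong[OF ty_eq_refl[OF ap_motive] eq_refl[OF ap_base]])
    (use assms arr_inv_cod[OF assms(1) eq_left[OF assms(2)]] in auto)

text \<open>The end point \<open>z\<close> occurs in the motive of the underlying path induction, so
  unlike for \<open>ap_cong\<close> the motive itself changes and its equality has to be
  supplied.\<close>

lemma path_concat_cong:
  assumes "\<Gamma> \<turnstile> x \<doteq> x' \<^bold>: A" "\<Gamma> \<turnstile> y \<doteq> y' \<^bold>: A" and z: "\<Gamma> \<turnstile> z \<doteq> z' \<^bold>: A"
    and "\<Gamma> \<turnstile> p \<doteq> p' \<^bold>: IdT A x y" "\<Gamma> \<turnstile> q \<doteq> q' \<^bold>: IdT A y z"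
  shows "\<Gamma> \<turnstile> path_concat A x y z p q \<doteq> path_concat A x' y' z' p' q' \<^bold>: IdT A x z"
proof -
  have A: "is_ty \<Gamma> A" and z0: "\<Gamma> \<turnstile> z \<^bold>: A" using z eq_is_ty eq_left by blast+
  have m: "ty_eq (id_ctx A \<Gamma>) (arr (IdT (A\<up>3) (Var 1) (z\<up>3)) (IdT (A\<up>3) (Var 2) (z\<up>3)))
      (arr (IdT (A\<up>3) (Var 1) (z'\<up>3)) (IdT (A\<up>3) (Var 2) (z'\<up>3)))"
    by (rule ty_eq_arr ty_eq_Id ty_eq_refl is_ty_weak3 weak3_eq[OF _ z] eq_refl var_ty wf_id_ctx A | simp)+
  have wf: "wf_ctx (A # \<Gamma>)" using A by (rule wfI)
  have T: "ty_eq (A # \<Gamma>) (IdT (A\<up>1) (Var 0) (z\<up>1)) (IdT (A\<up>1) (Var 0) (z'\<up>1))"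
    by (rule ty_eq_Id ty_eq_refl is_ty_weak1 weak1_eq[OF _ z] eq_refl var_ty wf A | simp)+
  have c: "A # \<Gamma> \<turnstile> Lam (IdT (A\<up>1) (Var 0) (z\<up>1)) (Var 0) \<doteq> Lam (IdT (A\<up>1) (Var 0) (z'\<up>1)) (Var 0)
      \<^bold>: arr (IdT (A\<up>1) (Var 0) (z\<up>1)) (IdT (A\<up>1) (Var 0) (z\<up>1))"
    unfolding arr_def by (rule lam_cong[OF T]) (rule eq_refl var0 wfI ty_eq_is_ty T)+
  show ?thesis unfolding path_concat_def
    by (rule arr_app_cong[OF J_cong[OF m c]]) (use assms in auto)
qed

lemma fam_app_is_ty: "\<Gamma> \<turnstile> B \<^bold>: arr A (Univ i) \<Longrightarrow> \<Gamma> \<turnstile> a \<^bold>: A \<Longrightarrow> is_ty \<Gamma> (B \<bullet> a)"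
  by (rule is_tyI) (rule arr_app)

lemma transport_ty:
  assumes P: "\<Gamma> \<turnstile> P \<^bold>: arr A (Univ i)" and p: "\<Gamma> \<turnstile> p \<^bold>: IdT A x y" and u: "\<Gamma> \<turnstile> u \<^bold>: P \<bullet> x"
  shows "\<Gamma> \<turnstile> transport P x y p u \<^bold>: P \<bullet> y"
proof -
  note A = id_inv(1)[OF p]
  have m: "is_ty (id_ctx A \<Gamma>) (arr (P\<up>3 \<bullet> Var 2) (P\<up>3 \<bullet> Var 1))"
    by (rule is_ty_arr fam_app_is_ty[where A = "A\<up>3" and i = i] weak3[where A = "arr A (Univ i)"] var_ty wf_id_ctx A P | simp)+
  have c: "A # \<Gamma> \<turnstile> Lam (P\<up>1 \<bullet> Var 0) (Var 0) \<^bold>: arr (P\<up>1 \<bullet> Var 0) (P\<up>1 \<bullet> Var 0)"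
    unfolding arr_def
    by (rule pi_intro var0 wfI fam_app_is_ty[where A = "A\<up>1" and i = i]
        weak1[where A = "arr A (Univ i)"] var_ty P A | simp)+
  show ?thesis unfolding transport_def
    by (rule arr_app[OF J_ty[OF m c]]) (use p u in auto)
qed

lemma right_unit_ty:
  assumes p: "\<Gamma> \<turnstile> p \<^bold>: IdT A x y"
  shows "\<Gamma> \<turnstile> right_unit A x y p \<^bold>: IdT (IdT A x y) (path_concat A x y y p (Refl y)) p"
proof -
  note A = id_inv(1)[OF p]
  have m: "is_ty (id_ctx A \<Gamma>) (IdT (IdT (A\<up>3) (Var 2) (Var 1))
              (path_concat (A\<up>3) (Var 2) (Var 1) (Var 1) (Var 0) (Refl (Var 1))) (Var 0))"
    by (rule is_ty_Id is_ty_weak3 path_concat_ty refl_ty var_ty wf_id_ctx A | simp)+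
  have v: "A # \<Gamma> \<turnstile> Var 0 \<^bold>: A\<up>1" by (rule var0 wfI A)+
  \<comment> \<open>Concatenation of two reflexivities computes to reflexivity, so the iterated
    \<open>Refl\<close> proves the unit law in this case after conversion.\<close>
  have "ty_eq (A # \<Gamma>) (IdT (IdT (A\<up>1) (Var 0) (Var 0)) (Refl (Var 0)) (Refl (Var 0)))
      (IdT (IdT (A\<up>1) (Var 0) (Var 0)) (path_concat (A\<up>1) (Var 0) (Var 0) (Var 0) (Refl (Var 0)) (Refl (Var 0)))
        (Refl (Var 0)))"
    by (rule ty_eq_Id ty_eq_refl eq_sym[OF path_concat_refl] eq_refl is_ty_Id v refl_ty has_is_ty[OF v])+
  with v have c: "A # \<Gamma> \<turnstile> Refl (Refl (Var 0)) \<^bold>: IdT (IdT (A\<up>1) (Var 0) (Var 0))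
      (path_concat (A\<up>1) (Var 0) (Var 0) (Var 0) (Refl (Var 0)) (Refl (Var 0))) (Refl (Var 0))"
    by (intro conv_ty[OF refl_ty[OF refl_ty]])
  show ?thesis unfolding right_unit_def
    by (rule J_ty[OF m c]) (use p in auto)
qed

section \<open>Projections\<close>

lemma sig_inv:
  assumes "\<Gamma> \<turnstile> p \<^bold>: SigT A B"
  shows "is_ty \<Gamma> A" "is_ty (A # \<Gamma>) B"
  using is_ty_Sig_inv[OF has_is_ty[OF assms]] by auto

lemma pr1_motive:
  assumes "is_ty (A # \<Gamma>) B"
  shows "is_ty (SigT A B # \<Gamma>) (A\<up>1)" "B # A # \<Gamma> \<turnstile> Var 1 \<^bold>: A\<up>2"
proof -
  have "is_ty \<Gamma> A" using assms is_ty_ctx wf_of_is_ty by blast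
  then show "is_ty (SigT A B # \<Gamma>) (A\<up>1)" by (rule is_ty_weak1[OF wfI[OF is_ty_Sig[OF assms]]])
  show "B # A # \<Gamma> \<turnstile> Var 1 \<^bold>: A\<up>2" by (rule var_ty wfI assms | simp)+
qed

lemma pr1_ty:
  assumes "\<Gamma> \<turnstile> p \<^bold>: SigT A B"
  shows "\<Gamma> \<turnstile> pr1 A p \<^bold>: A"
proof -
  note B = pr1_motive[OF sig_inv(2)[OF assms]]
  obtain i where "SigT A B # \<Gamma> \<turnstile> A\<up>1 \<^bold>: Univ i" using B(1) by (auto simp: is_ty_def)
  from sig_elim[OF this _ assms, of "Var 1"] B(2) show ?thesis by (simp add: pr1_def)
qed

lemma pr1_pair:
  assumes "is_ty (A # \<Gamma>) B" "\<Gamma> \<turnstile> a \<^bold>: A" "\<Gamma> \<turnstile> b \<^bold>: subst (a \<rhd> Var) B"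
  shows "\<Gamma> \<turnstile> pr1 A (Pair a b) \<doteq> a \<^bold>: A"
proof -
  note B = pr1_motive[OF assms(1)]
  obtain i where "SigT A B # \<Gamma> \<turnstile> A\<up>1 \<^bold>: Univ i" using B(1) by (auto simp: is_ty_def)
  from sig_comp[OF this, of "Var 1" a b] B(2) assms show ?thesis by (simp add: pr1_def)
qed

text \<open>In the branch the motive requires the family at the first projection of a pair, which is
  \<open>B\<close> at the first variable only after computation; congruence of substitution in types
  bridges the gap.\<close>

lemma pr2_ty:
  assumes p: "\<Gamma> \<turnstile> p \<^bold>: SigT A B"
  shows "\<Gamma> \<turnstile> pr2 A B p \<^bold>: subst (pr1 A p \<rhd> Var) B"
proof -
  let ?C = "subst (pr1 (A\<up>1) (Var 0) \<rhd> (\<lambda>n. Var (n + 1))) B"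
  let ?B = "subst (up (\<lambda>n. Var (n + 2))) B"
  note A = sig_inv(1)[OF p] and B = sig_inv(2)[OF p]
  have wf: "wf_ctx (SigT A B # \<Gamma>)" by (rule wfI[OF has_is_ty[OF p]])
  have wf2: "wf_ctx (B # A # \<Gamma>)" by (rule wfI[OF B])
  have "SigT A B # \<Gamma> \<turnstile> Var 0 \<^bold>: SigT (A\<up>1) (subst (up (\<lambda>n. Var (n + 1))) B)"
    using var0[OF wf] by simp
  then have "SigT A B # \<Gamma> \<turnstile> pr1 (A\<up>1) (Var 0) \<^bold>: A\<up>1" by (rule pr1_ty)
  then have C: "is_ty (SigT A B # \<Gamma>) ?C"
    by (intro is_ty_subst[OF B] sub_ok_scons sub_ok_shift1 wf) simp
  have sh: "sub_ok (B # A # \<Gamma>) (\<lambda>n. Var (n + 2)) \<Gamma>"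
    using sub_ok_shift[of "[B, A]" \<Gamma> 2] wf2 by simp
  obtain j where Aj: "\<Gamma> \<turnstile> A \<^bold>: Univ j" using A by (auto simp: is_ty_def)
  have B2: "is_ty (A\<up>2 # B # A # \<Gamma>) ?B"
    using is_ty_subst[OF B substitution.ok_up[OF sh, of A j]] substitution(1)[OF sh Aj] by simp
  have v1: "B # A # \<Gamma> \<turnstile> Var 1 \<^bold>: A\<up>2" by (rule pr1_motive(2)[OF B])
  have s: "subst (t \<rhd> Var) ?B = subst (t \<rhd> (\<lambda>n. Var (n + 2))) B" for t
    unfolding subst_subst
  proof (rule subst_eqI)
    fix n show "subst (t \<rhd> Var) (up (\<lambda>n. Var (n + 2)) n) = (t \<rhd> (\<lambda>n. Var (n + 2))) n"
      by (cases n) simp_all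
  qed
  have s1: "subst (Var 1 \<rhd> (\<lambda>n. Var (n + 2))) B = B\<up>1"
    unfolding weaken_eq_subst
  proof (rule subst_eqI)
    fix n show "(Var 1 \<rhd> (\<lambda>n. Var (n + 2))) n = Var (n + 1)"
      by (cases n) simp_all
  qed
  have v0: "B # A # \<Gamma> \<turnstile> Var 0 \<^bold>: B\<up>1" by (rule var0[OF wf2])
  have b: "B # A # \<Gamma> \<turnstile> pr1 (A\<up>2) (Pair (Var 1) (Var 0)) \<doteq> Var 1 \<^bold>: A\<up>2"
    by (rule pr1_pair[OF B2 v1]) (simp only: s s1 v0)
  obtain k where "A\<up>2 # B # A # \<Gamma> \<turnstile> ?B \<^bold>: Univ k" using B2 by (auto simp: is_ty_def)
  from subst1_cong_Univ[OF this eq_sym[OF b] v1 eq_left[OF b]]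
  have e: "ty_eq (B # A # \<Gamma>) (B\<up>1) (subst (pr1 (A\<up>2) (Pair (Var 1) (Var 0)) \<rhd> (\<lambda>n. Var (n + 2))) B)"
    unfolding subst1_def s s1 by (rule ty_eqI)
  have "subst (Pair (Var 1) (Var 0) \<rhd> (\<lambda>n. Var (n + 2))) ?C =
      subst (pr1 (A\<up>2) (Pair (Var 1) (Var 0)) \<rhd> (\<lambda>n. Var (n + 2))) B"
    unfolding subst_subst
  proof (rule subst_eqI)
    fix n show "subst (Pair (Var 1) (Var 0) \<rhd> (\<lambda>n. Var (n + 2)))
        ((pr1 (A\<up>1) (Var 0) \<rhd> (\<lambda>n. Var (n + 1))) n) = (pr1 (A\<up>2) (Pair (Var 1) (Var 0)) \<rhd> (\<lambda>n. Var (n + 2))) n"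
      by (cases n) simp_all
  qed
  with conv_ty[OF v0 e]
  have g: "B # A # \<Gamma> \<turnstile> Var 0 \<^bold>: subst (Pair (Var 1) (Var 0) \<rhd> (\<lambda>n. Var (n + 2))) ?C" by simp
  obtain l where "SigT A B # \<Gamma> \<turnstile> ?C \<^bold>: Univ l" using C by (auto simp: is_ty_def)
  from sig_elim[OF this g p] have "\<Gamma> \<turnstile> pr2 A B p \<^bold>: subst (p \<rhd> Var) ?C" by (simp add: pr2_def)
  also have "subst (p \<rhd> Var) ?C = subst (pr1 A p \<rhd> Var) B"
    unfolding subst_subst
  proof (rule subst_eqI)
    fix n show "subst (p \<rhd> Var) ((pr1 (A\<up>1) (Var 0) \<rhd> (\<lambda>n. Var (n + 1))) n) = (pr1 A p \<rhd> Var) n"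
      by (cases n) simp_all
  qed
  finally show ?thesis .
qed

section \<open>Function extensionality\<close>

lemma is_ty_pi_fam:
  assumes B: "\<Gamma> \<turnstile> B \<^bold>: arr A (Univ i)"
  shows "is_ty \<Gamma> (pi_fam A B)"
  unfolding pi_fam_def
  by (rule is_ty_Pi fam_app_is_ty[where A = "A\<up>1" and i = i] weak1[where A = "arr A (Univ i)"] var_ty wfI arr_inv[OF B] B | simp)+

lemma fam_app:
  assumes "\<Gamma> \<turnstile> g \<^bold>: pi_fam A B" "\<Gamma> \<turnstile> a \<^bold>: A"
  shows "\<Gamma> \<turnstile> g \<bullet> a \<^bold>: B \<bullet> a"
  by (rule pi_app[OF assms(1)[unfolded pi_fam_def] assms(2)]) simp

lemma is_ty_homotopy:
  assumes B: "\<Gamma> \<turnstile> B \<^bold>: arr A (Univ i)" and g: "\<Gamma> \<turnstile> g \<^bold>: pi_fam A B" and h: "\<Gamma> \<turnstile> h \<^bold>: pi_fam A B"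
  shows "is_ty \<Gamma> (homotopy A B g h)"
proof -
  have wf: "wf_ctx (A # \<Gamma>)" by (rule wfI[OF arr_inv[OF B]])
  have v: "A # \<Gamma> \<turnstile> Var 0 \<^bold>: A\<up>1" by (rule var0[OF wf])
  have B1: "A # \<Gamma> \<turnstile> B\<up>1 \<^bold>: arr (A\<up>1) (Univ i)" by (rule weak1[OF wf B]) simp
  have g1: "A # \<Gamma> \<turnstile> g\<up>1 \<^bold>: pi_fam (A\<up>1) (B\<up>1)" by (rule weak1[OF wf g]) simp
  have h1: "A # \<Gamma> \<turnstile> h\<up>1 \<^bold>: pi_fam (A\<up>1) (B\<up>1)" by (rule weak1[OF wf h]) simp
  show ?thesis unfolding homotopy_def
    by (rule is_ty_Pi is_ty_Id fam_app_is_ty[OF B1] fam_app[OF g1] fam_app[OF h1] v)+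
qed

lemma happly_motive:
  assumes B: "\<Gamma> \<turnstile> B \<^bold>: arr A (Univ i)"
  shows "is_ty (id_ctx (pi_fam A B) \<Gamma>) (homotopy (A\<up>3) (B\<up>3) (Var 2) (Var 1))"
proof -
  have wf: "wf_ctx (id_ctx (pi_fam A B) \<Gamma>)" by (rule wf_id_ctx[OF is_ty_pi_fam[OF B]])
  have B3: "id_ctx (pi_fam A B) \<Gamma> \<turnstile> B\<up>3 \<^bold>: arr (A\<up>3) (Univ i)" by (rule weak3[OF wf B]) simp
  show ?thesis by (rule is_ty_homotopy[OF B3] var_ty[OF wf] | simp)+
qed

lemma happly_base:
  assumes B: "\<Gamma> \<turnstile> B \<^bold>: arr A (Univ i)"
  shows "pi_fam A B # \<Gamma> \<turnstile> Lam (A\<up>1) (Refl (Var 1 \<bullet> Var 0)) \<^bold>: homotopy (A\<up>1) (B\<up>1) (Var 0) (Var 0)"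
proof -
  have wf: "wf_ctx (pi_fam A B # \<Gamma>)" by (rule wfI[OF is_ty_pi_fam[OF B]])
  have wf2: "wf_ctx (A\<up>1 # pi_fam A B # \<Gamma>)" by (rule wfI is_ty_weak1 wf arr_inv[OF B])+
  have "A\<up>1 # pi_fam A B # \<Gamma> \<turnstile> Var 1 \<bullet> Var 0 \<^bold>: B\<up>2 \<bullet> Var 0"
    by (rule fam_app[where A = "A\<up>2"] var_ty[OF wf2] | simp)+
  from refl_ty[OF this] show ?thesis
    unfolding homotopy_def by (intro pi_intro) simp
qed

lemma happly_ty:
  assumes B: "\<Gamma> \<turnstile> B \<^bold>: arr A (Univ i)" and g: "\<Gamma> \<turnstile> g \<^bold>: pi_fam A B" and h: "\<Gamma> \<turnstile> h \<^bold>: pi_fam A B"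
  shows "\<Gamma> \<turnstile> happly A B g h \<^bold>: arr (IdT (pi_fam A B) g h) (homotopy A B g h)"
proof -
  have wf: "wf_ctx (IdT (pi_fam A B) g h # \<Gamma>)" by (rule wfI is_ty_Id is_ty_pi_fam[OF B] g h)+
  have B1: "IdT (pi_fam A B) g h # \<Gamma> \<turnstile> B\<up>1 \<^bold>: arr (A\<up>1) (Univ i)" by (rule weak1[OF wf B]) simp
  have m: "is_ty (id_ctx (pi_fam (A\<up>1) (B\<up>1)) (IdT (pi_fam A B) g h # \<Gamma>)) (homotopy (A\<up>4) (B\<up>4) (Var 2) (Var 1))"
    using happly_motive[OF B1] by simp
  have c: "pi_fam (A\<up>1) (B\<up>1) # IdT (pi_fam A B) g h # \<Gamma> \<turnstile> Lam (A\<up>2) (Refl (Var 1 \<bullet> Var 0)) \<^bold>: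
      homotopy (A\<up>2) (B\<up>2) (Var 0) (Var 0)"
    using happly_base[OF B1] by simp
  show ?thesis unfolding happly_def
    by (rule arr_lam, rule J_ty[OF m c])
      (use var0[OF wf] in auto)
qed

lemma happly_refl:
  assumes B: "\<Gamma> \<turnstile> B \<^bold>: arr A (Univ i)" and g: "\<Gamma> \<turnstile> g \<^bold>: pi_fam A B"
  shows "\<Gamma> \<turnstile> happly A B g g \<bullet> Refl g \<doteq> Lam A (Refl (g\<up>1 \<bullet> Var 0)) \<^bold>: homotopy A B g g"
proof -
  have wf: "wf_ctx (IdT (pi_fam A B) g g # \<Gamma>)" by (rule wfI is_ty_Id is_ty_pi_fam[OF B] g)+
  have B1: "IdT (pi_fam A B) g g # \<Gamma> \<turnstile> B\<up>1 \<^bold>: arr (A\<up>1) (Univ i)" by (rule weak1[OF wf B]) simp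
  have m: "is_ty (id_ctx (pi_fam (A\<up>1) (B\<up>1)) (IdT (pi_fam A B) g g # \<Gamma>)) (homotopy (A\<up>4) (B\<up>4) (Var 2) (Var 1))"
    using happly_motive[OF B1] by simp
  have c: "pi_fam (A\<up>1) (B\<up>1) # IdT (pi_fam A B) g g # \<Gamma> \<turnstile> Lam (A\<up>2) (Refl (Var 1 \<bullet> Var 0)) \<^bold>:
      homotopy (A\<up>2) (B\<up>2) (Var 0) (Var 0)"
    using happly_base[OF B1] by simp
  let ?b = "IdRec (homotopy (A\<up>4) (B\<up>4) (Var 2) (Var 1)) (Lam (A\<up>2) (Refl (Var 1 \<bullet> Var 0))) (g\<up>1) (g\<up>1) (Var 0)"
  have b: "IdT (pi_fam A B) g g # \<Gamma> \<turnstile> ?b \<^bold>: homotopy (A\<up>1) (B\<up>1) (g\<up>1) (g\<up>1)"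
    by (rule J_ty[OF m c])
      (use var0[OF wf] in auto)
  have "\<Gamma> \<turnstile> happly A B g g \<bullet> Refl g \<doteq> IdRec (homotopy (A\<up>3) (B\<up>3) (Var 2) (Var 1))
      (Lam (A\<up>1) (Refl (Var 1 \<bullet> Var 0))) g g (Refl g) \<^bold>: homotopy A B g g"
    unfolding happly_def by (rule pi_beta[OF b refl_ty[OF g]]) simp_all
  moreover have "\<Gamma> \<turnstile> IdRec (homotopy (A\<up>3) (B\<up>3) (Var 2) (Var 1))
      (Lam (A\<up>1) (Refl (Var 1 \<bullet> Var 0))) g g (Refl g) \<doteq> Lam A (Refl (g\<up>1 \<bullet> Var 0)) \<^bold>: homotopy A B g g"
    by (rule J_refl[OF happly_motive[OF B] happly_base[OF B]]) (use g in auto)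
  ultimately show ?thesis by (rule eq_trans)
qed

lemma funext_rinv_ty:
  assumes fe: "\<Gamma> \<turnstile> fe \<^bold>: FunExt i" and A: "\<Gamma> \<turnstile> A \<^bold>: Univ i" and B: "\<Gamma> \<turnstile> B \<^bold>: arr A (Univ i)"
    and g: "\<Gamma> \<turnstile> g \<^bold>: pi_fam A B" and h: "\<Gamma> \<turnstile> h \<^bold>: pi_fam A B"
  shows "\<Gamma> \<turnstile> funext_rinv fe A B g h \<^bold>:
    rinv (IdT (pi_fam A B) g h) (homotopy A B g h) (happly A B g h)"
proof -
  have "\<Gamma> \<turnstile> fe \<bullet> A \<bullet> B \<bullet> g \<bullet> h \<^bold>:
      isequiv (IdT (pi_fam A B) g h) (homotopy A B g h) (happly A B g h)"
    by (rule pi_app[OF pi_app[OF pi_app[OF pi_app[OF fe[unfolded FunExt_def] A refl, simplified] B refl, simplified]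
        g refl, simplified] h, simplified]) simp
  then show ?thesis unfolding funext_rinv_def isequiv_def by (rule pr1_ty)
qed

lemma funext_fam_ty:
  assumes "\<Gamma> \<turnstile> fe \<^bold>: FunExt i" "\<Gamma> \<turnstile> A \<^bold>: Univ i" "\<Gamma> \<turnstile> B \<^bold>: arr A (Univ i)"
    and "\<Gamma> \<turnstile> g \<^bold>: pi_fam A B" "\<Gamma> \<turnstile> h \<^bold>: pi_fam A B" and \<xi>: "\<Gamma> \<turnstile> \<xi> \<^bold>: homotopy A B g h"
  shows "\<Gamma> \<turnstile> funext fe A B g h \<xi> \<^bold>: IdT (pi_fam A B) g h"
  unfolding funext_def
  by (rule arr_app[OF pr1_ty[OF funext_rinv_ty[OF assms(1-5), unfolded rinv_def]] \<xi>])

lemma happly_funext_fam_ty: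
  assumes "\<Gamma> \<turnstile> fe \<^bold>: FunExt i" "\<Gamma> \<turnstile> A \<^bold>: Univ i" "\<Gamma> \<turnstile> B \<^bold>: arr A (Univ i)"
    and "\<Gamma> \<turnstile> g \<^bold>: pi_fam A B" "\<Gamma> \<turnstile> h \<^bold>: pi_fam A B" and \<xi>: "\<Gamma> \<turnstile> \<xi> \<^bold>: homotopy A B g h"
  shows "\<Gamma> \<turnstile> happly_funext fe A B g h \<xi> \<^bold>:
    IdT (homotopy A B g h) (happly A B g h \<bullet> funext fe A B g h \<xi>) \<xi>"
proof -
  let ?H = "homotopy A B g h"
  let ?P = "pr1 (arr ?H (IdT (pi_fam A B) g h)) (funext_rinv fe A B g h)"
  \<comment> \<open>The candidate inverse in the family becomes the first projection of the same
    right inverse, which is the function that \<open>funext\<close> applies.\<close>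
  have "\<Gamma> \<turnstile> pr2 (arr ?H (IdT (pi_fam A B) g h)) (rinv_fam ?H (happly A B g h)) (funext_rinv fe A B g h)
      \<^bold>: PiT ?H (IdT (?H\<up>1) ((happly A B g h)\<up>1 \<bullet> (?P\<up>1 \<bullet> Var 0)) (Var 0))"
    using pr2_ty[OF funext_rinv_ty[OF assms(1-5), unfolded rinv_def]] by (simp add: rinv_fam_def)
  from pi_app[OF this \<xi> refl] show ?thesis unfolding happly_funext_def funext_def by simp
qed

section \<open>Substitution in the terms of the splitting\<close>

lemma compat_subst [simp]: "subst \<sigma> (compat X f a) = compat (subst \<sigma> X) (subst \<sigma> f) (subst \<sigma> a)"
  by (simp add: compat_def)

lemma split_type_subst [simp]: "subst \<sigma> (split_type X f) = split_type (subst \<sigma> X) (subst \<sigma> f)"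
  by (simp add: split_type_def)

lemma section_map_subst [simp]: "subst \<sigma> (section_map X f) = section_map (subst \<sigma> X) (subst \<sigma> f)"
  by (simp add: section_map_def)

lemma retraction_map_subst [simp]:
  "subst \<sigma> (retraction_map X f I) = retraction_map (subst \<sigma> X) (subst \<sigma> f) (subst \<sigma> I)"
  by (simp add: retraction_map_def)

lemma comm_type_subst [simp]: "subst \<sigma> (comm_type X f a \<alpha> c \<gamma> \<xi>) =
    comm_type (subst \<sigma> X) (subst \<sigma> f) (subst \<sigma> a) (subst \<sigma> \<alpha>) (subst \<sigma> c) (subst \<sigma> \<gamma>) (subst \<sigma> \<xi>)"
  by (simp add: comm_type_def Let_def)

lemma seq_happly_subst [simp]: "subst \<sigma> (seq_happly X a c) = seq_happly (subst \<sigma> X) (subst \<sigma> a) (subst \<sigma> c)"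
  by (simp add: seq_happly_def)

text \<open>The beta-reduced form of \<open>homotopy\<close> for the constant family
  \<open>X\<close> over \<open>NatT\<close>. Families are typed in this form and converted when
  function extensionality is applied.\<close>

definition seq_htpy :: "tm \<Rightarrow> tm \<Rightarrow> tm \<Rightarrow> tm" where
  "seq_htpy X a c = PiT NatT (IdT (X\<up>1) (a\<up>1 \<bullet> Var 0) (c\<up>1 \<bullet> Var 0))"

lemma seq_htpy_subst [simp]: "subst \<sigma> (seq_htpy X a c) = seq_htpy (subst \<sigma> X) (subst \<sigma> a) (subst \<sigma> c)"
  by (simp add: seq_htpy_def)

text \<open>The innermost body of \<open>split_path_base\<close> with its four bound variables
  turned into parameters, so that one typing lemma covers the open body and all its
  instances.\<close>

definition split_path_body :: "tm \<Rightarrow> tm \<Rightarrow> tm \<Rightarrow> tm \<Rightarrow> tm \<Rightarrow> tm \<Rightarrow> tm \<Rightarrow> tm" where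
  "split_path_body fe X f a \<alpha> \<gamma> \<theta> =
     ap (split_type X f) (Lam (compat X f a) (Pair (a\<up>1) (Var 0))) \<alpha> \<gamma>
       (funext fe NatT (Lam NatT (IdT (X\<up>1) (f\<up>1 \<bullet> (a\<up>1 \<bullet> Succ (Var 0))) (a\<up>1 \<bullet> Var 0))) \<alpha> \<gamma>
          (Lam NatT (let X' = X\<up>1; a = a\<up>1; \<alpha> = \<alpha>\<up>1; \<gamma> = \<gamma>\<up>1; \<theta> = \<theta>\<up>1; n = Var 0;
               src = f\<up>1 \<bullet> (a \<bullet> Succ n); tgt = a \<bullet> n; T = IdT X' src tgt;
               p = path_concat X' src tgt tgt (\<alpha> \<bullet> n) (Refl tgt)
             in path_concat T (\<alpha> \<bullet> n) p (\<gamma> \<bullet> n)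
                  (path_inv T p (\<alpha> \<bullet> n) (right_unit X' src tgt (\<alpha> \<bullet> n))) (\<theta> \<bullet> n))))"

lemma split_path_body_subst [simp]: "subst \<sigma> (split_path_body fe X f a \<alpha> \<gamma> \<theta>) =
    split_path_body (subst \<sigma> fe) (subst \<sigma> X) (subst \<sigma> f) (subst \<sigma> a) (subst \<sigma> \<alpha>) (subst \<sigma> \<gamma>) (subst \<sigma> \<theta>)"
  by (simp add: split_path_body_def Let_def)

lemma splitting_weaken [simp]:
  "compat X f a \<up> k = compat (X\<up>k) (f\<up>k) (a\<up>k)"
  "split_type X f \<up> k = split_type (X\<up>k) (f\<up>k)"
  "section_map X f \<up> k = section_map (X\<up>k) (f\<up>k)"
  "retraction_map X f I \<up> k = retraction_map (X\<up>k) (f\<up>k) (I\<up>k)"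
  "comm_type X f a \<alpha> c \<gamma> \<xi> \<up> k = comm_type (X\<up>k) (f\<up>k) (a\<up>k) (\<alpha>\<up>k) (c\<up>k) (\<gamma>\<up>k) (\<xi>\<up>k)"
  "seq_happly X a c \<up> k = seq_happly (X\<up>k) (a\<up>k) (c\<up>k)"
  "seq_htpy X a c \<up> k = seq_htpy (X\<up>k) (a\<up>k) (c\<up>k)"
  "split_path_body fe X f a \<alpha> \<gamma> \<theta> \<up> k =
    split_path_body (fe\<up>k) (X\<up>k) (f\<up>k) (a\<up>k) (\<alpha>\<up>k) (\<gamma>\<up>k) (\<theta>\<up>k)"
  unfolding weaken_eq_subst
  by (rule compat_subst split_type_subst section_map_subst retraction_map_subst comm_type_subst
      seq_happly_subst seq_htpy_subst split_path_body_subst)+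

lemma split_path_base_eq: "split_path_base fe X f =
     Lam (compat (X\<up>1) (f\<up>1) (Var 0))
       (Lam (compat (X\<up>2) (f\<up>2) (Var 1))
         (Lam (comm_type (X\<up>3) (f\<up>3) (Var 2) (Var 1) (Var 2) (Var 0)
                 (seq_happly (X\<up>3) (Var 2) (Var 2) \<bullet> Refl (Var 2)))
           (split_path_body (fe\<up>4) (X\<up>4) (f\<up>4) (Var 3) (Var 2) (Var 1) (Var 0))))"
  by (simp add: split_path_base_def split_path_body_def Let_def)

lemma split_path_motive_subst [simp]:
  "subst (up (up (up \<sigma>))) (split_path_motive X f) = split_path_motive (subst \<sigma> X) (subst \<sigma> f)"
  by (simp add: split_path_motive_def)

lemma split_path_base_subst [simp]:
  "subst (up \<sigma>) (split_path_base fe X f) = split_path_base (subst \<sigma> fe) (subst \<sigma> X) (subst \<sigma> f)"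
  by (simp add: split_path_base_eq)

section \<open>Families given by a \<open>\<lambda>\<close>-abstraction\<close>

lemma fam_lam: "A # \<Gamma> \<turnstile> B \<^bold>: Univ i \<Longrightarrow> \<Gamma> \<turnstile> Lam A B \<^bold>: arr A (Univ i)"
  by (rule arr_lam) simp

lemma subst_up_shift_var0 [simp]: "subst (Var 0 \<rhd> Var) (subst (up (\<lambda>n. Var (n + 1))) B) = B"
proof -
  have "subst (Var 0 \<rhd> Var) (up (\<lambda>n. Var (n + 1)) n) = Var n" for n by (cases n) simp_all
  then show ?thesis by (simp add: subst_subst)
qed

text \<open>Function extensionality quantifies over families as functions into a universe, whereas
  the families at hand are types with a free variable; this beta-step passes between the
  two.\<close>

lemma fam_lam_beta:
  assumes "A # \<Gamma> \<turnstile> B \<^bold>: Univ i"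
  shows "ty_eq (A # \<Gamma>) ((Lam A B)\<up>1 \<bullet> Var 0) B"
proof -
  have wf: "wf_ctx (A # \<Gamma>)" using assms by (rule wf_of_jdg)
  have "A # \<Gamma> \<turnstile> (Lam A B)\<up>1 \<^bold>: arr (A\<up>1) (Univ i)" using weakening1(1)[OF wf fam_lam[OF assms]] by simp
  have wf': "wf_ctx (A\<up>1 # A # \<Gamma>)" by (rule wfI[OF is_ty_weak1[OF wf is_ty_ctx[OF wf]]])
  have "sub_ok (A\<up>1 # A # \<Gamma>) (up (\<lambda>n. Var (n + 1))) (A # \<Gamma>)"
    using substitution.ok_up[OF sub_ok_shift1[OF wf], of A] is_ty_weak1[OF wf is_ty_ctx[OF wf]]
    by (auto simp: is_ty_def)
  from substitution(1)[OF this assms]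
  have B: "A\<up>1 # A # \<Gamma> \<turnstile> subst (up (\<lambda>n. Var (n + 1))) B \<^bold>: Univ i" by simp
  have "A # \<Gamma> \<turnstile> (Lam A B)\<up>1 \<bullet> Var 0 \<doteq> B \<^bold>: Univ i"
    unfolding weaken_simps by (rule pi_beta[OF B var0[OF wf]]) simp_all
  then show ?thesis by (rule ty_eqI)
qed

lemma pi_fam_lam:
  assumes B: "A # \<Gamma> \<turnstile> B \<^bold>: Univ i"
  shows "ty_eq \<Gamma> (pi_fam A (Lam A B)) (PiT A B)"
  unfolding pi_fam_def
  by (rule ty_eq_Pi ty_eq_refl is_ty_ctx wf_of_jdg(1)[OF B] fam_lam_beta[OF B])+

lemma homotopy_lam:
  assumes B: "A # \<Gamma> \<turnstile> B \<^bold>: Univ i" and g: "\<Gamma> \<turnstile> g \<^bold>: PiT A B" and h: "\<Gamma> \<turnstile> h \<^bold>: PiT A B"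
  shows "ty_eq \<Gamma> (homotopy A (Lam A B) g h) (PiT A (IdT B (g\<up>1 \<bullet> Var 0) (h\<up>1 \<bullet> Var 0)))"
proof -
  have wf: "wf_ctx (A # \<Gamma>)" by (rule wf_of_jdg(1)[OF B])
  have app: "A # \<Gamma> \<turnstile> g\<up>1 \<bullet> Var 0 \<^bold>: (Lam A B)\<up>1 \<bullet> Var 0" if g: "\<Gamma> \<turnstile> g \<^bold>: PiT A B" for g
  proof -
    have "A # \<Gamma> \<turnstile> g\<up>1 \<^bold>: PiT (A\<up>1) (subst (up (\<lambda>n. Var (n + 1))) B)"
      using weakening1(1)[OF wf g] by simp
    from pi_app[OF this var0[OF wf] refl] have "A # \<Gamma> \<turnstile> g\<up>1 \<bullet> Var 0 \<^bold>: B" by simp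
    then show ?thesis by (rule conv_ty[OF _ ty_eq_sym[OF fam_lam_beta[OF B]]])
  qed
  show ?thesis unfolding homotopy_def
    by (rule ty_eq_Pi ty_eq_refl is_ty_ctx wf ty_eq_Id fam_lam_beta[OF B] eq_refl app g h)+
qed

lemma funext_ty:
  assumes fe: "\<Gamma> \<turnstile> fe \<^bold>: FunExt i" and A: "\<Gamma> \<turnstile> A \<^bold>: Univ i" and B: "A # \<Gamma> \<turnstile> B \<^bold>: Univ i"
    and g: "\<Gamma> \<turnstile> g \<^bold>: PiT A B" and h: "\<Gamma> \<turnstile> h \<^bold>: PiT A B"
    and \<xi>: "\<Gamma> \<turnstile> \<xi> \<^bold>: PiT A (IdT B (g\<up>1 \<bullet> Var 0) (h\<up>1 \<bullet> Var 0))"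
  shows "\<Gamma> \<turnstile> funext fe A (Lam A B) g h \<xi> \<^bold>: IdT (PiT A B) g h"
    and "\<Gamma> \<turnstile> happly_funext fe A (Lam A B) g h \<xi> \<^bold>:
      IdT (PiT A (IdT B (g\<up>1 \<bullet> Var 0) (h\<up>1 \<bullet> Var 0)))
        (happly A (Lam A B) g h \<bullet> funext fe A (Lam A B) g h \<xi>) \<xi>"
proof -
  note p = pi_fam_lam[OF B] and q = homotopy_lam[OF B g h]
  have g': "\<Gamma> \<turnstile> g \<^bold>: pi_fam A (Lam A B)" and h': "\<Gamma> \<turnstile> h \<^bold>: pi_fam A (Lam A B)"
    and \<xi>': "\<Gamma> \<turnstile> \<xi> \<^bold>: homotopy A (Lam A B) g h"
    using g h \<xi> p q by (auto intro: conv_ty ty_eq_sym)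
  note F = funext_fam_ty[OF fe A fam_lam[OF B] g' h' \<xi>']
  show "\<Gamma> \<turnstile> funext fe A (Lam A B) g h \<xi> \<^bold>: IdT (PiT A B) g h"
    by (rule conv_ty[OF F ty_eq_Id[OF p eq_refl[OF g'] eq_refl[OF h']]])
  have "\<Gamma> \<turnstile> happly A (Lam A B) g h \<bullet> funext fe A (Lam A B) g h \<xi> \<^bold>: homotopy A (Lam A B) g h"
    by (rule arr_app[OF happly_ty[OF fam_lam[OF B] g' h'] F])
  then show "\<Gamma> \<turnstile> happly_funext fe A (Lam A B) g h \<xi> \<^bold>:
      IdT (PiT A (IdT B (g\<up>1 \<bullet> Var 0) (h\<up>1 \<bullet> Var 0)))
        (happly A (Lam A B) g h \<bullet> funext fe A (Lam A B) g h \<xi>) \<xi>"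
    by (rule conv_ty[OF happly_funext_fam_ty[OF fe A fam_lam[OF B] g' h' \<xi>'] ty_eq_Id[OF q eq_refl eq_refl[OF \<xi>']]])
qed

section \<open>Sequences\<close>

lemma wf_Nat: "wf_ctx \<Gamma> \<Longrightarrow> wf_ctx (NatT # \<Gamma>)"
  by (rule wfI[OF is_ty_Nat])

lemma nat_var0: "wf_ctx (NatT # \<Gamma>) \<Longrightarrow> NatT # \<Gamma> \<turnstile> Var 0 \<^bold>: NatT"
  using var0[of NatT \<Gamma>] by simp

lemma seq_PiT: "arr NatT X = PiT NatT (X\<up>1)"
  by (simp add: arr_def)

text \<open>\<open>FunExt i\<close> takes domain and family from the same universe, so the naturals
  are raised to the level of \<open>X\<close>.\<close>

lemma nat_level: "wf_ctx \<Gamma> \<Longrightarrow> \<Gamma> \<turnstile> NatT \<^bold>: Univ i"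
  by (rule cumul_le[OF nat_form]) simp_all

lemma X_level: "\<Gamma> \<turnstile> X \<^bold>: Univ i \<Longrightarrow> NatT # \<Gamma> \<turnstile> X\<up>1 \<^bold>: Univ i"
  by (rule weak1[OF wf_Nat[OF wf_of_jdg(1)]]) auto

lemma seq_htpy_app: "\<Gamma> \<turnstile> \<xi> \<^bold>: seq_htpy X a c \<Longrightarrow> \<Gamma> \<turnstile> n \<^bold>: NatT \<Longrightarrow> \<Gamma> \<turnstile> \<xi> \<bullet> n \<^bold>: IdT X (a \<bullet> n) (c \<bullet> n)"
  unfolding seq_htpy_def by (erule (1) pi_app) simp

lemma is_ty_seq_htpy:
  assumes "\<Gamma> \<turnstile> a \<^bold>: arr NatT X" "\<Gamma> \<turnstile> c \<^bold>: arr NatT X"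
  shows "is_ty \<Gamma> (seq_htpy X a c)"
proof -
  have wf: "wf_ctx (NatT # \<Gamma>)" by (rule wf_Nat[OF wf_of_jdg(1)[OF assms(1)]])
  have "NatT # \<Gamma> \<turnstile> a\<up>1 \<bullet> Var 0 \<^bold>: X\<up>1" if "\<Gamma> \<turnstile> a \<^bold>: arr NatT X" for a
    by (rule arr_app weak1[OF wf that] nat_var0[OF wf] | simp)+
  note v = this[OF assms(1)] this[OF assms(2)]
  show ?thesis unfolding seq_htpy_def by (rule is_ty_Pi is_ty_Id has_is_ty[OF v(1)] v)+
qed

lemma seq_happly_ty:
  assumes X: "\<Gamma> \<turnstile> X \<^bold>: Univ i" and a: "\<Gamma> \<turnstile> a \<^bold>: arr NatT X" and c: "\<Gamma> \<turnstile> c \<^bold>: arr NatT X"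
  shows "\<Gamma> \<turnstile> seq_happly X a c \<^bold>: arr (IdT (arr NatT X) a c) (seq_htpy X a c)"
proof -
  note B = X_level[OF X]
  note p = pi_fam_lam[OF B, folded seq_PiT] and q = homotopy_lam[OF B a[unfolded seq_PiT] c[unfolded seq_PiT]]
  have a': "\<Gamma> \<turnstile> a \<^bold>: pi_fam NatT (Lam NatT (X\<up>1))" and c': "\<Gamma> \<turnstile> c \<^bold>: pi_fam NatT (Lam NatT (X\<up>1))"
    using a c p by (auto intro: conv_ty ty_eq_sym)
  show ?thesis unfolding seq_happly_def seq_htpy_def
    by (rule conv_ty[OF happly_ty[OF fam_lam[OF B] a' c']] ty_eq_arr ty_eq_Id p q eq_refl a' c')+
qed

lemma seq_happly_app:
  assumes "\<Gamma> \<turnstile> X \<^bold>: Univ i" and e: "\<Gamma> \<turnstile> e \<^bold>: IdT (arr NatT X) a c"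
  shows "\<Gamma> \<turnstile> seq_happly X a c \<bullet> e \<^bold>: seq_htpy X a c"
  by (rule arr_app[OF seq_happly_ty e] assms id_inv[OF e])+

text \<open>In the reflexivity case of the path induction this turns every member of the family into
  reflexivity, which collapses the commutativity squares.\<close>

lemma seq_happly_refl:
  assumes X: "\<Gamma> \<turnstile> X \<^bold>: Univ i" and a: "\<Gamma> \<turnstile> a \<^bold>: arr NatT X" and n: "\<Gamma> \<turnstile> n \<^bold>: NatT"
  shows "\<Gamma> \<turnstile> seq_happly X a a \<bullet> Refl a \<bullet> n \<doteq> Refl (a \<bullet> n) \<^bold>: IdT X (a \<bullet> n) (a \<bullet> n)"
proof -
  note B = X_level[OF X]
  note p = pi_fam_lam[OF B, folded seq_PiT] and q = homotopy_lam[OF B a[unfolded seq_PiT] a[unfolded seq_PiT]]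
  have a': "\<Gamma> \<turnstile> a \<^bold>: pi_fam NatT (Lam NatT (X\<up>1))"
    using a p by (auto intro: conv_ty ty_eq_sym)
  have wf: "wf_ctx (NatT # \<Gamma>)" by (rule wf_of_jdg(1)[OF B])
  have "\<Gamma> \<turnstile> seq_happly X a a \<bullet> Refl a \<doteq> Lam NatT (Refl (a\<up>1 \<bullet> Var 0)) \<^bold>: seq_htpy X a a"
    unfolding seq_happly_def seq_htpy_def
    by (rule eq_conv_ty[OF happly_refl[OF fam_lam[OF B] a'] q])
  from pi_app_cong[OF this[unfolded seq_htpy_def] eq_refl[OF n]]
  have "\<Gamma> \<turnstile> seq_happly X a a \<bullet> Refl a \<bullet> n \<doteq> Lam NatT (Refl (a\<up>1 \<bullet> Var 0)) \<bullet> n \<^bold>: IdT X (a \<bullet> n) (a \<bullet> n)"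
    by simp
  moreover have "NatT # \<Gamma> \<turnstile> Refl (a\<up>1 \<bullet> Var 0) \<^bold>: IdT (X\<up>1) (a\<up>1 \<bullet> Var 0) (a\<up>1 \<bullet> Var 0)"
    by (rule refl_ty arr_app weak1[OF wf a] nat_var0[OF wf] | simp)+
  from pi_beta[OF this n refl refl]
  have "\<Gamma> \<turnstile> Lam NatT (Refl (a\<up>1 \<bullet> Var 0)) \<bullet> n \<doteq> Refl (a \<bullet> n) \<^bold>: IdT X (a \<bullet> n) (a \<bullet> n)" by simp
  ultimately show ?thesis by (rule eq_trans)
qed

section \<open>The splitting\<close>

lemma compat_app: "\<Gamma> \<turnstile> \<alpha> \<^bold>: compat X f a \<Longrightarrow> \<Gamma> \<turnstile> n \<^bold>: NatT \<Longrightarrow>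
    \<Gamma> \<turnstile> \<alpha> \<bullet> n \<^bold>: IdT X (f \<bullet> (a \<bullet> Succ n)) (a \<bullet> n)"
  unfolding compat_def by (erule (1) pi_app) simp

lemma compat_body:
  assumes X: "\<Gamma> \<turnstile> X \<^bold>: Univ i" and f: "\<Gamma> \<turnstile> f \<^bold>: arr X X" and a: "\<Gamma> \<turnstile> a \<^bold>: arr NatT X"
  shows "NatT # \<Gamma> \<turnstile> IdT (X\<up>1) (f\<up>1 \<bullet> (a\<up>1 \<bullet> Succ (Var 0))) (a\<up>1 \<bullet> Var 0) \<^bold>: Univ i"
proof -
  have wf: "wf_ctx (NatT # \<Gamma>)" by (rule wf_of_jdg(1)[OF X_level[OF X]])
  have f1: "NatT # \<Gamma> \<turnstile> f\<up>1 \<^bold>: arr (X\<up>1) (X\<up>1)" by (rule weak1[OF wf f]) simp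
  have a1: "NatT # \<Gamma> \<turnstile> a\<up>1 \<^bold>: arr NatT (X\<up>1)" by (rule weak1[OF wf a]) simp
  show ?thesis by (rule id_form X_level[OF X] arr_app[OF f1] arr_app[OF a1] nat_succ nat_var0[OF wf])+
qed

lemma compat_level:
  assumes "\<Gamma> \<turnstile> X \<^bold>: Univ i" "\<Gamma> \<turnstile> f \<^bold>: arr X X" "\<Gamma> \<turnstile> a \<^bold>: arr NatT X"
  shows "\<Gamma> \<turnstile> compat X f a \<^bold>: Univ i"
  unfolding compat_def by (rule pi_form nat_level wf_of_jdg(1)[OF assms(1)] compat_body assms)+

lemma split_family:
  assumes X: "\<Gamma> \<turnstile> X \<^bold>: Univ i" and f: "\<Gamma> \<turnstile> f \<^bold>: arr X X"
  shows "arr NatT X # \<Gamma> \<turnstile> compat (X\<up>1) (f\<up>1) (Var 0) \<^bold>: Univ i"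
proof -
  have "is_ty \<Gamma> (arr NatT X)" by (rule is_ty_arr is_ty_Nat wf_of_jdg(1)[OF X] is_tyI[OF X])+
  then have wf: "wf_ctx (arr NatT X # \<Gamma>)" by (rule wfI)
  show ?thesis by (rule compat_level weak1[OF wf X] weak1[OF wf f] var_ty[OF wf] | simp)+
qed

lemma is_ty_split:
  assumes "\<Gamma> \<turnstile> X \<^bold>: Univ i" "\<Gamma> \<turnstile> f \<^bold>: arr X X"
  shows "is_ty \<Gamma> (split_type X f)"
  unfolding split_type_def by (rule is_ty_Sig is_tyI split_family assms)+

lemma split_pair_ty:
  assumes "\<Gamma> \<turnstile> X \<^bold>: Univ i" "\<Gamma> \<turnstile> f \<^bold>: arr X X" "\<Gamma> \<turnstile> a \<^bold>: arr NatT X" "\<Gamma> \<turnstile> \<alpha> \<^bold>: compat X f a"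
  shows "\<Gamma> \<turnstile> Pair a \<alpha> \<^bold>: split_type X f"
  unfolding split_type_def by (rule sig_intro[OF split_family]) (use assms in auto)

lemma split_rec:
  assumes X: "\<Gamma> \<turnstile> X \<^bold>: Univ i" and f: "\<Gamma> \<turnstile> f \<^bold>: arr X X"
  shows "SigT (arr NatT X) (compat (X\<up>1) (f\<up>1) (Var 0)) # \<Gamma> \<turnstile> X\<up>1 \<^bold>: Univ i"
    and "compat (X\<up>1) (f\<up>1) (Var 0) # arr NatT X # \<Gamma> \<turnstile> Var 1 \<bullet> Zero \<^bold>: X\<up>2"
proof -
  show "SigT (arr NatT X) (compat (X\<up>1) (f\<up>1) (Var 0)) # \<Gamma> \<turnstile> X\<up>1 \<^bold>: Univ i"
    by (rule weak1[OF wfI[OF is_ty_split[OF X f, unfolded split_type_def]] X]) simp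
  have wf: "wf_ctx (compat (X\<up>1) (f\<up>1) (Var 0) # arr NatT X # \<Gamma>)"
    by (rule wfI is_tyI split_family X f)+
  show "compat (X\<up>1) (f\<up>1) (Var 0) # arr NatT X # \<Gamma> \<turnstile> Var 1 \<bullet> Zero \<^bold>: X\<up>2"
    by (rule arr_app[where A = NatT] var_ty[OF wf] nat_zero[OF wf] | simp)+
qed

lemma section_body_ty:
  assumes X: "\<Gamma> \<turnstile> X \<^bold>: Univ i" and f: "\<Gamma> \<turnstile> f \<^bold>: arr X X" and u: "\<Gamma> \<turnstile> u \<^bold>: split_type X f"
  shows "\<Gamma> \<turnstile> Split (X\<up>1) (Var 1 \<bullet> Zero) u \<^bold>: X"
  using sig_elim[OF split_rec(1)[OF X f] _ u[unfolded split_type_def], of "Var 1 \<bullet> Zero"] split_rec(2)[OF X f]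
  by simp

lemma section_body_ty1:
  assumes X: "\<Gamma> \<turnstile> X \<^bold>: Univ i" and f: "\<Gamma> \<turnstile> f \<^bold>: arr X X"
  shows "split_type X f # \<Gamma> \<turnstile> Split (X\<up>2) (Var 1 \<bullet> Zero) (Var 0) \<^bold>: X\<up>1"
proof -
  have wf: "wf_ctx (split_type X f # \<Gamma>)" by (rule wfI[OF is_ty_split[OF X f]])
  have X1: "split_type X f # \<Gamma> \<turnstile> X\<up>1 \<^bold>: Univ i" by (rule weak1[OF wf X]) simp
  have f1: "split_type X f # \<Gamma> \<turnstile> f\<up>1 \<^bold>: arr (X\<up>1) (X\<up>1)" by (rule weak1[OF wf f]) simp
  show ?thesis using section_body_ty[OF X1 f1, of "Var 0"] var0[OF wf] by simp
qed

lemma section_ty: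
  assumes X: "\<Gamma> \<turnstile> X \<^bold>: Univ i" and f: "\<Gamma> \<turnstile> f \<^bold>: arr X X"
  shows "\<Gamma> \<turnstile> section_map X f \<^bold>: arr (split_type X f) X"
  unfolding section_map_def by (rule arr_lam[OF section_body_ty1[OF X f]])

lemma section_pair:
  assumes X: "\<Gamma> \<turnstile> X \<^bold>: Univ i" and f: "\<Gamma> \<turnstile> f \<^bold>: arr X X"
    and a: "\<Gamma> \<turnstile> a \<^bold>: arr NatT X" and \<alpha>: "\<Gamma> \<turnstile> \<alpha> \<^bold>: compat X f a"
  shows "\<Gamma> \<turnstile> section_map X f \<bullet> Pair a \<alpha> \<doteq> a \<bullet> Zero \<^bold>: X"
proof -
  have "\<Gamma> \<turnstile> section_map X f \<bullet> Pair a \<alpha> \<doteq> Split (X\<up>1) (Var 1 \<bullet> Zero) (Pair a \<alpha>) \<^bold>: X"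
    unfolding section_map_def
    by (rule pi_beta[OF section_body_ty1[OF X f] split_pair_ty[OF X f a \<alpha>]]) simp_all
  moreover have "\<Gamma> \<turnstile> Split (X\<up>1) (Var 1 \<bullet> Zero) (Pair a \<alpha>) \<doteq> a \<bullet> Zero \<^bold>: X"
    using sig_comp[OF split_rec(1)[OF X f] _ a, of "Var 1 \<bullet> Zero" \<alpha>] split_rec(2)[OF X f] \<alpha> by simp
  ultimately show ?thesis by (rule eq_trans)
qed

text \<open>Covers both components of \<open>r x\<close>: with \<open>f\<close> for the sequence and
  with \<open>I\<close> for its compatibility proof.\<close>

definition const_seq :: "tm \<Rightarrow> tm \<Rightarrow> tm" where
  "const_seq g x = Lam NatT (g\<up>1 \<bullet> x\<up>1)"

lemma const_seq_subst [simp]: "subst \<sigma> (const_seq g x) = const_seq (subst \<sigma> g) (subst \<sigma> x)"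
  by (simp add: const_seq_def)

lemma const_seq_weaken [simp]: "const_seq g x \<up> k = const_seq (g\<up>k) (x\<up>k)"
  unfolding weaken_eq_subst by (rule const_seq_subst)

lemma preidem_app: "\<Gamma> \<turnstile> I \<^bold>: preidem_type X f \<Longrightarrow> \<Gamma> \<turnstile> x \<^bold>: X \<Longrightarrow> \<Gamma> \<turnstile> I \<bullet> x \<^bold>: IdT X (f \<bullet> (f \<bullet> x)) (f \<bullet> x)"
  unfolding preidem_type_def by (erule (1) pi_app) simp

lemma preidem_subst [simp]: "subst \<sigma> (preidem_type X f) = preidem_type (subst \<sigma> X) (subst \<sigma> f)"
  by (simp add: preidem_type_def)

lemma preidem_weaken [simp]: "preidem_type X f \<up> k = preidem_type (X\<up>k) (f\<up>k)"
  unfolding weaken_eq_subst by (rule preidem_subst)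

lemma const_seq_ty:
  assumes f: "\<Gamma> \<turnstile> f \<^bold>: arr X X" and x: "\<Gamma> \<turnstile> x \<^bold>: X"
  shows "\<Gamma> \<turnstile> const_seq f x \<^bold>: arr NatT X"
proof -
  have wf: "wf_ctx (NatT # \<Gamma>)" by (rule wf_Nat[OF wf_of_jdg(1)[OF f]])
  show ?thesis unfolding const_seq_def
    by (rule arr_lam arr_app[where A = "X\<up>1"] weak1[OF wf f] weak1[OF wf x] | simp)+
qed

lemma const_seq_app:
  assumes f: "\<Gamma> \<turnstile> f \<^bold>: arr X X" and x: "\<Gamma> \<turnstile> x \<^bold>: X" and n: "\<Gamma> \<turnstile> n \<^bold>: NatT"
  shows "\<Gamma> \<turnstile> const_seq f x \<bullet> n \<doteq> f \<bullet> x \<^bold>: X"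
proof -
  have wf: "wf_ctx (NatT # \<Gamma>)" by (rule wf_Nat[OF wf_of_jdg(1)[OF f]])
  have b: "NatT # \<Gamma> \<turnstile> f\<up>1 \<bullet> x\<up>1 \<^bold>: X\<up>1"
    by (rule arr_app[where A = "X\<up>1"] weak1[OF wf f] weak1[OF wf x] | simp)+
  show ?thesis unfolding const_seq_def by (rule pi_beta[OF b n]) simp_all
qed

lemma const_path_app:
  assumes I: "\<Gamma> \<turnstile> I \<^bold>: preidem_type X f" and x: "\<Gamma> \<turnstile> x \<^bold>: X" and n: "\<Gamma> \<turnstile> n \<^bold>: NatT"
  shows "\<Gamma> \<turnstile> const_seq I x \<bullet> n \<doteq> I \<bullet> x \<^bold>: IdT X (f \<bullet> (f \<bullet> x)) (f \<bullet> x)"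
proof -
  have wf: "wf_ctx (NatT # \<Gamma>)" by (rule wf_Nat[OF wf_of_jdg(1)[OF I]])
  have b: "NatT # \<Gamma> \<turnstile> I\<up>1 \<bullet> x\<up>1 \<^bold>: IdT (X\<up>1) (f\<up>1 \<bullet> (f\<up>1 \<bullet> x\<up>1)) (f\<up>1 \<bullet> x\<up>1)"
    by (rule preidem_app weak1[OF wf I] weak1[OF wf x] | simp)+
  show ?thesis unfolding const_seq_def by (rule pi_beta[OF b n]) simp_all
qed

lemma const_path_ty:
  assumes f: "\<Gamma> \<turnstile> f \<^bold>: arr X X" and I: "\<Gamma> \<turnstile> I \<^bold>: preidem_type X f" and x: "\<Gamma> \<turnstile> x \<^bold>: X"
  shows "\<Gamma> \<turnstile> const_seq I x \<^bold>: compat X f (const_seq f x)"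
proof -
  have wf: "wf_ctx (NatT # \<Gamma>)" by (rule wf_Nat[OF wf_of_jdg(1)[OF f]])
  have x1: "NatT # \<Gamma> \<turnstile> x\<up>1 \<^bold>: X\<up>1" by (rule weak1[OF wf x]) simp
  have f1: "NatT # \<Gamma> \<turnstile> f\<up>1 \<^bold>: arr (X\<up>1) (X\<up>1)" by (rule weak1[OF wf f]) simp
  have I1: "NatT # \<Gamma> \<turnstile> I\<up>1 \<^bold>: preidem_type (X\<up>1) (f\<up>1)" by (rule weak1[OF wf I]) simp
  \<comment> \<open>The end points \<open>f (f x)\<close> and \<open>f x\<close> of
    \<open>I x\<close> are those required at every index, because each value of the constant
    sequence beta-reduces to \<open>f x\<close>.\<close>
  have "NatT # \<Gamma> \<turnstile> I\<up>1 \<bullet> x\<up>1 \<^bold>: IdT (X\<up>1) (f\<up>1 \<bullet> (const_seq (f\<up>1) (x\<up>1) \<bullet> Succ (Var 0))) (const_seq (f\<up>1) (x\<up>1) \<bullet> Var 0)"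
    by (rule conv_ty[OF preidem_app[OF I1 x1]] ty_eq_Id ty_eq_refl has_is_ty[OF x1] arr_app_cong[OF eq_refl[OF f1]]
        eq_sym[OF const_seq_app[OF f1 x1]] nat_var0[OF wf] nat_succ)+
  then show ?thesis unfolding const_seq_def[of I] compat_def
    by (intro pi_intro) simp
qed

lemma retraction_body_ty:
  assumes X: "\<Gamma> \<turnstile> X \<^bold>: Univ i" and f: "\<Gamma> \<turnstile> f \<^bold>: arr X X" and I: "\<Gamma> \<turnstile> I \<^bold>: preidem_type X f"
  shows "X # \<Gamma> \<turnstile> Pair (const_seq (f\<up>1) (Var 0)) (const_seq (I\<up>1) (Var 0)) \<^bold>: (split_type X f)\<up>1"
proof -
  have wf: "wf_ctx (X # \<Gamma>)" by (rule wfI[OF is_tyI[OF X]])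
  have X1: "X # \<Gamma> \<turnstile> X\<up>1 \<^bold>: Univ i" by (rule weak1[OF wf X]) simp
  have f1: "X # \<Gamma> \<turnstile> f\<up>1 \<^bold>: arr (X\<up>1) (X\<up>1)" by (rule weak1[OF wf f]) simp
  have I1: "X # \<Gamma> \<turnstile> I\<up>1 \<^bold>: preidem_type (X\<up>1) (f\<up>1)" by (rule weak1[OF wf I]) simp
  note v = var0[OF wf]
  show ?thesis using split_pair_ty[OF X1 f1 const_seq_ty[OF f1 v] const_path_ty[OF f1 I1 v]] by simp
qed

lemma retraction_map_eq:
  "retraction_map X f I = Lam X (Pair (const_seq (f\<up>1) (Var 0)) (const_seq (I\<up>1) (Var 0)))"
  by (simp add: retraction_map_def const_seq_def)

lemma retraction_ty:
  assumes X: "\<Gamma> \<turnstile> X \<^bold>: Univ i" and f: "\<Gamma> \<turnstile> f \<^bold>: arr X X" and I: "\<Gamma> \<turnstile> I \<^bold>: preidem_type X f"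
  shows "\<Gamma> \<turnstile> retraction_map X f I \<^bold>: arr X (split_type X f)"
  unfolding retraction_map_eq by (rule arr_lam[OF retraction_body_ty[OF X f I]])

lemma retraction_app:
  assumes X: "\<Gamma> \<turnstile> X \<^bold>: Univ i" and f: "\<Gamma> \<turnstile> f \<^bold>: arr X X" and I: "\<Gamma> \<turnstile> I \<^bold>: preidem_type X f"
    and x: "\<Gamma> \<turnstile> x \<^bold>: X"
  shows "\<Gamma> \<turnstile> retraction_map X f I \<bullet> x \<doteq> Pair (const_seq f x) (const_seq I x) \<^bold>: split_type X f"
  unfolding retraction_map_eq by (rule pi_beta[OF retraction_body_ty[OF X f I] x]) simp_all

section \<open>Paths in the splitting\<close>

lemma comm_paths_ty:
  assumes f: "\<Gamma> \<turnstile> f \<^bold>: arr X X" and a: "\<Gamma> \<turnstile> a \<^bold>: arr NatT X" and \<alpha>: "\<Gamma> \<turnstile> \<alpha> \<^bold>: compat X f a"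
    and c: "\<Gamma> \<turnstile> c \<^bold>: arr NatT X" and \<gamma>: "\<Gamma> \<turnstile> \<gamma> \<^bold>: compat X f c" and \<xi>: "\<Gamma> \<turnstile> \<xi> \<^bold>: seq_htpy X a c"
    and n: "\<Gamma> \<turnstile> n \<^bold>: NatT"
  shows "\<Gamma> \<turnstile> path_concat X (f \<bullet> (a \<bullet> Succ n)) (a \<bullet> n) (c \<bullet> n) (\<alpha> \<bullet> n) (\<xi> \<bullet> n) \<^bold>: IdT X (f \<bullet> (a \<bullet> Succ n)) (c \<bullet> n)"
    and "\<Gamma> \<turnstile> path_concat X (f \<bullet> (a \<bullet> Succ n)) (f \<bullet> (c \<bullet> Succ n)) (c \<bullet> n)
      (ap X f (a \<bullet> Succ n) (c \<bullet> Succ n) (\<xi> \<bullet> Succ n)) (\<gamma> \<bullet> n) \<^bold>: IdT X (f \<bullet> (a \<bullet> Succ n)) (c \<bullet> n)"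
  by (rule path_concat_ty compat_app[OF \<alpha>] seq_htpy_app[OF \<xi>] ap_ty[OF f] compat_app[OF \<gamma>] nat_succ n)+

lemma is_ty_comm_type:
  assumes f: "\<Gamma> \<turnstile> f \<^bold>: arr X X" and a: "\<Gamma> \<turnstile> a \<^bold>: arr NatT X" and \<alpha>: "\<Gamma> \<turnstile> \<alpha> \<^bold>: compat X f a"
    and c: "\<Gamma> \<turnstile> c \<^bold>: arr NatT X" and \<gamma>: "\<Gamma> \<turnstile> \<gamma> \<^bold>: compat X f c" and \<xi>: "\<Gamma> \<turnstile> \<xi> \<^bold>: seq_htpy X a c"
  shows "is_ty \<Gamma> (comm_type X f a \<alpha> c \<gamma> \<xi>)"
proof -
  have wf: "wf_ctx (NatT # \<Gamma>)" by (rule wf_Nat[OF wf_of_jdg(1)[OF f]])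
  have w: "NatT # \<Gamma> \<turnstile> f\<up>1 \<^bold>: arr (X\<up>1) (X\<up>1)" "NatT # \<Gamma> \<turnstile> a\<up>1 \<^bold>: arr NatT (X\<up>1)"
    "NatT # \<Gamma> \<turnstile> \<alpha>\<up>1 \<^bold>: compat (X\<up>1) (f\<up>1) (a\<up>1)" "NatT # \<Gamma> \<turnstile> c\<up>1 \<^bold>: arr NatT (X\<up>1)"
    "NatT # \<Gamma> \<turnstile> \<gamma>\<up>1 \<^bold>: compat (X\<up>1) (f\<up>1) (c\<up>1)" "NatT # \<Gamma> \<turnstile> \<xi>\<up>1 \<^bold>: seq_htpy (X\<up>1) (a\<up>1) (c\<up>1)"
    by (rule weak1[OF wf f] weak1[OF wf a] weak1[OF wf c] weak1[OF wf \<alpha>] weak1[OF wf \<gamma>] weak1[OF wf \<xi>], simp)+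
  note p = comm_paths_ty[OF w nat_var0[OF wf]]
  show ?thesis unfolding comm_type_def Let_def
    by (rule is_ty_Pi is_ty_Id[OF has_is_ty[OF p(1)]] p)+
qed

lemma comm_app:
  assumes "\<Gamma> \<turnstile> \<theta> \<^bold>: comm_type X f a \<alpha> c \<gamma> \<xi>" "\<Gamma> \<turnstile> n \<^bold>: NatT"
  shows "\<Gamma> \<turnstile> \<theta> \<bullet> n \<^bold>: IdT (IdT X (f \<bullet> (a \<bullet> Succ n)) (c \<bullet> n))
    (path_concat X (f \<bullet> (a \<bullet> Succ n)) (a \<bullet> n) (c \<bullet> n) (\<alpha> \<bullet> n) (\<xi> \<bullet> n))
    (path_concat X (f \<bullet> (a \<bullet> Succ n)) (f \<bullet> (c \<bullet> Succ n)) (c \<bullet> n)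
      (ap X f (a \<bullet> Succ n) (c \<bullet> Succ n) (\<xi> \<bullet> Succ n)) (\<gamma> \<bullet> n))"
  by (rule pi_app[OF assms(1)[unfolded comm_type_def Let_def] assms(2)]) simp

lemma pair_fun_body_ty:
  assumes X: "\<Gamma> \<turnstile> X \<^bold>: Univ i" and f: "\<Gamma> \<turnstile> f \<^bold>: arr X X" and a: "\<Gamma> \<turnstile> a \<^bold>: arr NatT X"
  shows "compat X f a # \<Gamma> \<turnstile> Pair (a\<up>1) (Var 0) \<^bold>: (split_type X f)\<up>1"
proof -
  have wf: "wf_ctx (compat X f a # \<Gamma>)" by (rule wfI[OF is_tyI[OF compat_level[OF X f a]]])
  have X1: "compat X f a # \<Gamma> \<turnstile> X\<up>1 \<^bold>: Univ i" by (rule weak1[OF wf X]) simp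
  have f1: "compat X f a # \<Gamma> \<turnstile> f\<up>1 \<^bold>: arr (X\<up>1) (X\<up>1)" by (rule weak1[OF wf f]) simp
  have a1: "compat X f a # \<Gamma> \<turnstile> a\<up>1 \<^bold>: arr NatT (X\<up>1)" by (rule weak1[OF wf a]) simp
  show ?thesis using split_pair_ty[OF X1 f1 a1] var0[OF wf] by simp
qed

lemma pair_fun_ty:
  assumes X: "\<Gamma> \<turnstile> X \<^bold>: Univ i" and f: "\<Gamma> \<turnstile> f \<^bold>: arr X X" and a: "\<Gamma> \<turnstile> a \<^bold>: arr NatT X"
  shows "\<Gamma> \<turnstile> Lam (compat X f a) (Pair (a\<up>1) (Var 0)) \<^bold>: arr (compat X f a) (split_type X f)"
  by (rule arr_lam[OF pair_fun_body_ty[OF X f a]])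

lemma pair_fun_app:
  assumes X: "\<Gamma> \<turnstile> X \<^bold>: Univ i" and f: "\<Gamma> \<turnstile> f \<^bold>: arr X X" and a: "\<Gamma> \<turnstile> a \<^bold>: arr NatT X"
    and \<alpha>: "\<Gamma> \<turnstile> \<alpha> \<^bold>: compat X f a"
  shows "\<Gamma> \<turnstile> Lam (compat X f a) (Pair (a\<up>1) (Var 0)) \<bullet> \<alpha> \<doteq> Pair a \<alpha> \<^bold>: split_type X f"
  by (rule pi_beta[OF pair_fun_body_ty[OF X f a] \<alpha>]) simp_all

lemma ap_pair_fun_ty:
  assumes X: "\<Gamma> \<turnstile> X \<^bold>: Univ i" and f: "\<Gamma> \<turnstile> f \<^bold>: arr X X" and a: "\<Gamma> \<turnstile> a \<^bold>: arr NatT X"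
    and q: "\<Gamma> \<turnstile> q \<^bold>: IdT (compat X f a) \<alpha> \<gamma>"
  shows "\<Gamma> \<turnstile> ap (split_type X f) (Lam (compat X f a) (Pair (a\<up>1) (Var 0))) \<alpha> \<gamma> q
    \<^bold>: IdT (split_type X f) (Pair a \<alpha>) (Pair a \<gamma>)"
  by (rule conv_ty[OF ap_ty[OF pair_fun_ty[OF X f a] q]] ty_eq_Id ty_eq_refl is_ty_split[OF X f]
      pair_fun_app[OF X f a] id_inv[OF q])+

text \<open>On the right, \<open>ap f refl\<close> followed by \<open>\<gamma> n\<close> computes to
  \<open>\<gamma> n\<close>. On the left, \<open>\<alpha> n\<close> followed by \<open>refl\<close>
  is stuck, because concatenation is defined by induction on its first path; hence the explicit unit
  law in \<open>split_path_base\<close>.\<close>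

lemma comm_refl_ty:
  assumes X: "\<Gamma> \<turnstile> X \<^bold>: Univ i" and f: "\<Gamma> \<turnstile> f \<^bold>: arr X X" and a: "\<Gamma> \<turnstile> a \<^bold>: arr NatT X"
    and \<alpha>: "\<Gamma> \<turnstile> \<alpha> \<^bold>: compat X f a" and \<gamma>: "\<Gamma> \<turnstile> \<gamma> \<^bold>: compat X f a"
    and \<theta>: "\<Gamma> \<turnstile> \<theta> \<^bold>: comm_type X f a \<alpha> a \<gamma> (seq_happly X a a \<bullet> Refl a)" and n: "\<Gamma> \<turnstile> n \<^bold>: NatT"
  shows "\<Gamma> \<turnstile> \<theta> \<bullet> n \<^bold>: IdT (IdT X (f \<bullet> (a \<bullet> Succ n)) (a \<bullet> n))
    (path_concat X (f \<bullet> (a \<bullet> Succ n)) (a \<bullet> n) (a \<bullet> n) (\<alpha> \<bullet> n) (Refl (a \<bullet> n))) (\<gamma> \<bullet> n)"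
proof -
  note Sn = nat_succ[OF n]
  note an = arr_app[OF a n] and aS = arr_app[OF a Sn]
  note fS = arr_app[OF f aS]
  note \<alpha>n = compat_app[OF \<alpha> n] and \<gamma>n = compat_app[OF \<gamma> n]
  have 1: "\<Gamma> \<turnstile> path_concat X (f \<bullet> (a \<bullet> Succ n)) (a \<bullet> n) (a \<bullet> n) (\<alpha> \<bullet> n) (seq_happly X a a \<bullet> Refl a \<bullet> n) \<doteq>
      path_concat X (f \<bullet> (a \<bullet> Succ n)) (a \<bullet> n) (a \<bullet> n) (\<alpha> \<bullet> n) (Refl (a \<bullet> n)) \<^bold>: IdT X (f \<bullet> (a \<bullet> Succ n)) (a \<bullet> n)"
    by (rule path_concat_cong seq_happly_refl[OF X a n] eq_refl an fS \<alpha>n)+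
  have "\<Gamma> \<turnstile> ap X f (a \<bullet> Succ n) (a \<bullet> Succ n) (seq_happly X a a \<bullet> Refl a \<bullet> Succ n) \<doteq>
      Refl (f \<bullet> (a \<bullet> Succ n)) \<^bold>: IdT X (f \<bullet> (a \<bullet> Succ n)) (f \<bullet> (a \<bullet> Succ n))"
    by (rule eq_trans[OF ap_cong[OF f eq_refl[OF aS] eq_refl[OF aS] seq_happly_refl[OF X a Sn]] ap_refl[OF f aS]])
  then have 2: "\<Gamma> \<turnstile> path_concat X (f \<bullet> (a \<bullet> Succ n)) (f \<bullet> (a \<bullet> Succ n)) (a \<bullet> n)
      (ap X f (a \<bullet> Succ n) (a \<bullet> Succ n) (seq_happly X a a \<bullet> Refl a \<bullet> Succ n)) (\<gamma> \<bullet> n) \<doteq> \<gamma> \<bullet> n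
      \<^bold>: IdT X (f \<bullet> (a \<bullet> Succ n)) (a \<bullet> n)"
    by (intro eq_trans[OF path_concat_cong path_concat_refl] eq_refl an fS \<gamma>n)
  show ?thesis
    by (rule conv_ty[OF comm_app[OF \<theta> n]] ty_eq_Id[OF ty_eq_refl[OF has_is_ty[OF \<alpha>n]] 1 2])+
qed

text \<open>Hides the function extensionality term behind a variable \<open>q\<close>: to compute
  with \<open>s\<close> it suffices that the path is the image of some path between compatibility
  proofs over the same sequence.\<close>

lemma split_path_body_eq_ap:
  assumes fe: "\<Gamma> \<turnstile> fe \<^bold>: FunExt i" and X: "\<Gamma> \<turnstile> X \<^bold>: Univ i" and f: "\<Gamma> \<turnstile> f \<^bold>: arr X X"
    and a: "\<Gamma> \<turnstile> a \<^bold>: arr NatT X"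
    and \<alpha>: "\<Gamma> \<turnstile> \<alpha> \<^bold>: compat X f a" and \<gamma>: "\<Gamma> \<turnstile> \<gamma> \<^bold>: compat X f a"
    and \<theta>: "\<Gamma> \<turnstile> \<theta> \<^bold>: comm_type X f a \<alpha> a \<gamma> (seq_happly X a a \<bullet> Refl a)"
  shows "\<exists>q. \<Gamma> \<turnstile> q \<^bold>: IdT (compat X f a) \<alpha> \<gamma> \<and> split_path_body fe X f a \<alpha> \<gamma> \<theta> =
    ap (split_type X f) (Lam (compat X f a) (Pair (a\<up>1) (Var 0))) \<alpha> \<gamma> q"
proof -
  let ?n = "Var 0" let ?src = "f\<up>1 \<bullet> (a\<up>1 \<bullet> Succ ?n)" let ?tgt = "a\<up>1 \<bullet> ?n"
  let ?T = "IdT (X\<up>1) ?src ?tgt"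
  let ?p = "path_concat (X\<up>1) ?src ?tgt ?tgt (\<alpha>\<up>1 \<bullet> ?n) (Refl ?tgt)"
  let ?b = "path_concat ?T (\<alpha>\<up>1 \<bullet> ?n) ?p (\<gamma>\<up>1 \<bullet> ?n)
      (path_inv ?T ?p (\<alpha>\<up>1 \<bullet> ?n) (right_unit (X\<up>1) ?src ?tgt (\<alpha>\<up>1 \<bullet> ?n))) (\<theta>\<up>1 \<bullet> ?n)"
  have wf: "wf_ctx (NatT # \<Gamma>)" by (rule wf_Nat[OF wf_of_jdg(1)[OF f]])
  have w: "NatT # \<Gamma> \<turnstile> X\<up>1 \<^bold>: Univ i" "NatT # \<Gamma> \<turnstile> f\<up>1 \<^bold>: arr (X\<up>1) (X\<up>1)" "NatT # \<Gamma> \<turnstile> a\<up>1 \<^bold>: arr NatT (X\<up>1)"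
    "NatT # \<Gamma> \<turnstile> \<alpha>\<up>1 \<^bold>: compat (X\<up>1) (f\<up>1) (a\<up>1)" "NatT # \<Gamma> \<turnstile> \<gamma>\<up>1 \<^bold>: compat (X\<up>1) (f\<up>1) (a\<up>1)"
    "NatT # \<Gamma> \<turnstile> \<theta>\<up>1 \<^bold>: comm_type (X\<up>1) (f\<up>1) (a\<up>1) (\<alpha>\<up>1) (a\<up>1) (\<gamma>\<up>1) (seq_happly (X\<up>1) (a\<up>1) (a\<up>1) \<bullet> Refl (a\<up>1))"
    by (rule weak1[OF wf X] weak1[OF wf f] weak1[OF wf a] weak1[OF wf \<alpha>] weak1[OF wf \<gamma>] weak1[OF wf \<theta>], simp)+
  note n = nat_var0[OF wf]
  have b: "NatT # \<Gamma> \<turnstile> ?b \<^bold>: IdT ?T (\<alpha>\<up>1 \<bullet> ?n) (\<gamma>\<up>1 \<bullet> ?n)"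
    by (rule path_concat_ty path_inv_ty right_unit_ty compat_app[OF w(4) n] comm_refl_ty[OF w n])+
  have "\<Gamma> \<turnstile> funext fe NatT (Lam NatT ?T) \<alpha> \<gamma> (Lam NatT ?b) \<^bold>: IdT (compat X f a) \<alpha> \<gamma>"
    unfolding compat_def
    by (rule funext_ty(1)[OF fe nat_level compat_body[OF X f a] \<alpha>[unfolded compat_def] \<gamma>[unfolded compat_def]]
        pi_intro b wf_of_jdg(1)[OF f])+
  then show ?thesis by (auto simp: split_path_body_def Let_def)
qed

section \<open>Equational reasoning with inhabited identity types\<close>

definition inh :: "tm list \<Rightarrow> tm \<Rightarrow> bool" where
  "inh \<Gamma> T \<longleftrightarrow> (\<exists>t. \<Gamma> \<turnstile> t \<^bold>: T)"

lemma inhI: "\<Gamma> \<turnstile> t \<^bold>: T \<Longrightarrow> inh \<Gamma> T"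
  by (auto simp: inh_def)

lemma inh_conv: "inh \<Gamma> T \<Longrightarrow> ty_eq \<Gamma> T T' \<Longrightarrow> inh \<Gamma> T'"
  by (auto simp: inh_def intro: conv_ty)

lemma inh_lam: "inh (A # \<Gamma>) B \<Longrightarrow> inh \<Gamma> (PiT A B)"
  by (auto simp: inh_def intro: pi_intro)

lemma inh_app: "inh \<Gamma> (PiT A B) \<Longrightarrow> \<Gamma> \<turnstile> a \<^bold>: A \<Longrightarrow> T = subst (a \<rhd> Var) B \<Longrightarrow> inh \<Gamma> T"
  by (auto simp: inh_def intro: pi_app)

lemma inh_J:
  assumes "is_ty (id_ctx A \<Gamma>) C" "inh (A # \<Gamma>) T0" "T0 = refl_inst C"
    "\<Gamma> \<turnstile> p \<^bold>: IdT A a b" "T = subst (p \<rhd> b \<rhd> a \<rhd> Var) C"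
  shows "inh \<Gamma> T"
  using assms J_ty[OF assms(1)] unfolding inh_def by blast

lemma inh_sym: "inh \<Gamma> (IdT A x y) \<Longrightarrow> inh \<Gamma> (IdT A y x)"
  by (auto simp: inh_def intro: path_inv_ty)

lemma inh_trans: "inh \<Gamma> (IdT A x y) \<Longrightarrow> inh \<Gamma> (IdT A y z) \<Longrightarrow> inh \<Gamma> (IdT A x z)"
  unfolding inh_def using path_concat_ty by blast

lemma inh_eq: "\<Gamma> \<turnstile> x \<doteq> y \<^bold>: A \<Longrightarrow> inh \<Gamma> (IdT A x y)"
  by (rule inhI[OF conv_ty[OF refl_ty]]) (auto intro: eq_left ty_eq_Id ty_eq_refl eq_is_ty eq_refl)

text \<open>The function is given by an open term, so rewriting inside an expression only needs a
  typing of that expression with a variable at the position concerned.\<close>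

lemma inh_cong:
  assumes "inh \<Gamma> (IdT A x y)" and F: "A # \<Gamma> \<turnstile> t \<^bold>: B\<up>1"
  shows "inh \<Gamma> (IdT B (subst (x \<rhd> Var) t) (subst (y \<rhd> Var) t))"
proof -
  obtain p where p: "\<Gamma> \<turnstile> p \<^bold>: IdT A x y" using assms by (auto simp: inh_def)
  have B: "is_ty \<Gamma> B" using is_ty_subst1[OF has_is_ty[OF F] id_inv(2)[OF p]] by simp
  have "\<Gamma> \<turnstile> Lam A t \<bullet> z \<doteq> subst (z \<rhd> Var) t \<^bold>: B" if "\<Gamma> \<turnstile> z \<^bold>: A" for z
    by (rule pi_beta[OF F that]) simp_all
  then show ?thesis using id_inv[OF p]
    by (intro inh_conv[OF inhI[OF ap_ty[OF arr_lam[OF F] p]]] ty_eq_Id ty_eq_refl B) auto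
qed

section \<open>Typing and computation of the path induction behind \<open>split_path\<close>\<close>

abbreviation refl_ctx :: "tm \<Rightarrow> tm \<Rightarrow> tm list \<Rightarrow> tm list" where
  "refl_ctx X f \<Gamma> \<equiv> comm_type (X\<up>3) (f\<up>3) (Var 2) (Var 1) (Var 2) (Var 0)
      (seq_happly (X\<up>3) (Var 2) (Var 2) \<bullet> Refl (Var 2)) #
    compat (X\<up>2) (f\<up>2) (Var 1) # compat (X\<up>1) (f\<up>1) (Var 0) # arr NatT X # \<Gamma>"

abbreviation motive_ctx :: "tm \<Rightarrow> tm \<Rightarrow> tm list \<Rightarrow> tm list" where
  "motive_ctx X f \<Gamma> \<equiv> comm_type (X\<up>5) (f\<up>5) (Var 4) (Var 1) (Var 3) (Var 0)
      (seq_happly (X\<up>5) (Var 4) (Var 3) \<bullet> Var 2) #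
    compat (X\<up>4) (f\<up>4) (Var 2) # compat (X\<up>3) (f\<up>3) (Var 2) # id_ctx (arr NatT X) \<Gamma>"

lemma weaken_append: "wf_ctx (\<Delta> @ \<Gamma>) \<Longrightarrow> \<Gamma> \<turnstile> a \<^bold>: A \<Longrightarrow> k = length \<Delta> \<Longrightarrow> T = A\<up>k \<Longrightarrow> \<Delta> @ \<Gamma> \<turnstile> a\<up>k \<^bold>: T"
  using weakening(1) by blast

lemma weak4: "wf_ctx (C1 # C2 # C3 # C4 # \<Gamma>) \<Longrightarrow> \<Gamma> \<turnstile> a \<^bold>: A \<Longrightarrow> T = A\<up>4 \<Longrightarrow> C1 # C2 # C3 # C4 # \<Gamma> \<turnstile> a\<up>4 \<^bold>: T"
  using weaken_append[of "[C1, C2, C3, C4]" \<Gamma> a A 4 T] by simp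

lemma weak5: "wf_ctx (C1 # C2 # C3 # C4 # C5 # \<Gamma>) \<Longrightarrow> \<Gamma> \<turnstile> a \<^bold>: A \<Longrightarrow> T = A\<up>5 \<Longrightarrow>
    C1 # C2 # C3 # C4 # C5 # \<Gamma> \<turnstile> a\<up>5 \<^bold>: T"
  using weaken_append[of "[C1, C2, C3, C4, C5]" \<Gamma> a A 5 T] by simp

lemma weak6: "wf_ctx (C1 # C2 # C3 # C4 # C5 # C6 # \<Gamma>) \<Longrightarrow> \<Gamma> \<turnstile> a \<^bold>: A \<Longrightarrow> T = A\<up>6 \<Longrightarrow>
    C1 # C2 # C3 # C4 # C5 # C6 # \<Gamma> \<turnstile> a\<up>6 \<^bold>: T"
  using weaken_append[of "[C1, C2, C3, C4, C5, C6]" \<Gamma> a A 6 T] by simp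

lemma is_ty_seq: "\<Gamma> \<turnstile> X \<^bold>: Univ i \<Longrightarrow> is_ty \<Gamma> (arr NatT X)"
  by (rule is_ty_arr is_ty_Nat wf_of_jdg(1) is_tyI | assumption)+

lemma motive_ctx_wf:
  assumes X: "\<Gamma> \<turnstile> X \<^bold>: Univ i" and f: "\<Gamma> \<turnstile> f \<^bold>: arr X X"
  shows "wf_ctx (motive_ctx X f \<Gamma>)"
proof -
  let ?\<Gamma>3 = "id_ctx (arr NatT X) \<Gamma>"
  let ?\<Gamma>4 = "compat (X\<up>3) (f\<up>3) (Var 2) # ?\<Gamma>3"
  let ?\<Gamma>5 = "compat (X\<up>4) (f\<up>4) (Var 2) # ?\<Gamma>4"
  have w3: "wf_ctx ?\<Gamma>3" by (rule wf_id_ctx[OF is_ty_seq[OF X]])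
  have w4: "wf_ctx ?\<Gamma>4"
    by (rule wfI[OF is_tyI[OF compat_level]] weak3[OF w3 X] weak3[OF w3 f] var_ty[OF w3] | simp)+
  have w5: "wf_ctx ?\<Gamma>5"
    by (rule wfI[OF is_tyI[OF compat_level]] weak4[OF w4 X] weak4[OF w4 f] var_ty[OF w4] | simp)+
  have X5: "?\<Gamma>5 \<turnstile> X\<up>5 \<^bold>: Univ i" and f5: "?\<Gamma>5 \<turnstile> f\<up>5 \<^bold>: arr (X\<up>5) (X\<up>5)"
    by (rule weak5[OF w5 X] weak5[OF w5 f], simp)+
  show ?thesis
    by (rule wfI[OF is_ty_comm_type] f5 seq_happly_app[OF X5] var_ty[OF w5] | simp)+
qed

lemma refl_ctx_wf:
  assumes X: "\<Gamma> \<turnstile> X \<^bold>: Univ i" and f: "\<Gamma> \<turnstile> f \<^bold>: arr X X"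
  shows "wf_ctx (refl_ctx X f \<Gamma>)"
proof -
  let ?\<Gamma>1 = "arr NatT X # \<Gamma>"
  let ?\<Gamma>2 = "compat (X\<up>1) (f\<up>1) (Var 0) # ?\<Gamma>1"
  let ?\<Gamma>3 = "compat (X\<up>2) (f\<up>2) (Var 1) # ?\<Gamma>2"
  have w1: "wf_ctx ?\<Gamma>1" by (rule wfI[OF is_ty_seq[OF X]])
  have w2: "wf_ctx ?\<Gamma>2"
    by (rule wfI[OF is_tyI[OF compat_level]] weak1[OF w1 X] weak1[OF w1 f] var_ty[OF w1] | simp)+
  have w3: "wf_ctx ?\<Gamma>3"
    by (rule wfI[OF is_tyI[OF compat_level]] weak2[OF w2 X] weak2[OF w2 f] var_ty[OF w2] | simp)+
  have X3: "?\<Gamma>3 \<turnstile> X\<up>3 \<^bold>: Univ i" and f3: "?\<Gamma>3 \<turnstile> f\<up>3 \<^bold>: arr (X\<up>3) (X\<up>3)"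
    by (rule weak3[OF w3 X] weak3[OF w3 f], simp)+
  show ?thesis
    by (rule wfI[OF is_ty_comm_type] f3 seq_happly_app[OF X3] refl_ty var_ty[OF w3] | simp)+
qed

lemma split_path_motive_ty:
  assumes X: "\<Gamma> \<turnstile> X \<^bold>: Univ i" and f: "\<Gamma> \<turnstile> f \<^bold>: arr X X"
  shows "is_ty (id_ctx (arr NatT X) \<Gamma>) (split_path_motive X f)"
proof -
  have w: "wf_ctx (motive_ctx X f \<Gamma>)" by (rule motive_ctx_wf[OF X f])
  have X6: "motive_ctx X f \<Gamma> \<turnstile> X\<up>6 \<^bold>: Univ i" and f6: "motive_ctx X f \<Gamma> \<turnstile> f\<up>6 \<^bold>: arr (X\<up>6) (X\<up>6)"
    by (rule weak6[OF w X] weak6[OF w f], simp)+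
  show ?thesis unfolding split_path_motive_def splitting_weaken
    by (rule is_ty_Pi is_ty_Id is_ty_split[OF X6 f6] split_pair_ty[OF X6 f6] var_ty[OF w] | simp)+
qed

lemma split_path_body_ty:
  assumes fe: "\<Gamma> \<turnstile> fe \<^bold>: FunExt i" and X: "\<Gamma> \<turnstile> X \<^bold>: Univ i" and f: "\<Gamma> \<turnstile> f \<^bold>: arr X X"
    and a: "\<Gamma> \<turnstile> a \<^bold>: arr NatT X"
    and \<alpha>: "\<Gamma> \<turnstile> \<alpha> \<^bold>: compat X f a" and \<gamma>: "\<Gamma> \<turnstile> \<gamma> \<^bold>: compat X f a"
    and \<theta>: "\<Gamma> \<turnstile> \<theta> \<^bold>: comm_type X f a \<alpha> a \<gamma> (seq_happly X a a \<bullet> Refl a)"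
  shows "\<Gamma> \<turnstile> split_path_body fe X f a \<alpha> \<gamma> \<theta> \<^bold>: IdT (split_type X f) (Pair a \<alpha>) (Pair a \<gamma>)"
  using split_path_body_eq_ap[OF assms] ap_pair_fun_ty[OF X f a] by auto

lemma split_path_body_open_ty:
  assumes fe: "\<Gamma> \<turnstile> fe \<^bold>: FunExt i" and X: "\<Gamma> \<turnstile> X \<^bold>: Univ i" and f: "\<Gamma> \<turnstile> f \<^bold>: arr X X"
  shows "refl_ctx X f \<Gamma> \<turnstile> split_path_body (fe\<up>4) (X\<up>4) (f\<up>4) (Var 3) (Var 2) (Var 1) (Var 0) \<^bold>:
    IdT (split_type (X\<up>4) (f\<up>4)) (Pair (Var 3) (Var 2)) (Pair (Var 3) (Var 1))"
proof -
  have w: "wf_ctx (refl_ctx X f \<Gamma>)" by (rule refl_ctx_wf[OF X f])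
  have X4: "refl_ctx X f \<Gamma> \<turnstile> X\<up>4 \<^bold>: Univ i" and f4: "refl_ctx X f \<Gamma> \<turnstile> f\<up>4 \<^bold>: arr (X\<up>4) (X\<up>4)"
    and fe4: "refl_ctx X f \<Gamma> \<turnstile> fe\<up>4 \<^bold>: FunExt i"
    by (rule weak4[OF w X] weak4[OF w f] weak4[OF w fe], simp)+
  show ?thesis by (rule split_path_body_ty[OF fe4 X4 f4] var_ty[OF w] | simp)+
qed

lemma split_path_base_ty:
  assumes fe: "\<Gamma> \<turnstile> fe \<^bold>: FunExt i" and X: "\<Gamma> \<turnstile> X \<^bold>: Univ i" and f: "\<Gamma> \<turnstile> f \<^bold>: arr X X"
  shows "arr NatT X # \<Gamma> \<turnstile> split_path_base fe X f \<^bold>: refl_inst (split_path_motive X f)"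
proof -
  have "arr NatT X # \<Gamma> \<turnstile> split_path_base fe X f \<^bold>: PiT (compat (X\<up>1) (f\<up>1) (Var 0))
      (PiT (compat (X\<up>2) (f\<up>2) (Var 1)) (PiT (comm_type (X\<up>3) (f\<up>3) (Var 2) (Var 1) (Var 2) (Var 0)
         (seq_happly (X\<up>3) (Var 2) (Var 2) \<bullet> Refl (Var 2)))
      (IdT (split_type (X\<up>4) (f\<up>4)) (Pair (Var 3) (Var 2)) (Pair (Var 3) (Var 1)))))"
    unfolding split_path_base_eq by (rule pi_intro split_path_body_open_ty[OF fe X f])+
  then show ?thesis by (simp add: split_path_motive_def)
qed

text \<open>\<open>split_path\<close> with an arbitrary path \<open>e\<close> in place of the one
  from function extensionality; only with \<open>e\<close> free can a further path induction be
  performed on it.\<close>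

definition split_path_rec :: "tm \<Rightarrow> tm \<Rightarrow> tm \<Rightarrow> tm \<Rightarrow> tm \<Rightarrow> tm \<Rightarrow> tm \<Rightarrow> tm \<Rightarrow> tm \<Rightarrow> tm" where
  "split_path_rec fe X f a c e \<alpha> \<gamma> \<theta> =
     IdRec (split_path_motive X f) (split_path_base fe X f) a c e \<bullet> \<alpha> \<bullet> \<gamma> \<bullet> \<theta>"

lemma split_path_rec_subst [simp]: "subst \<sigma> (split_path_rec fe X f a c e \<alpha> \<gamma> \<theta>) =
    split_path_rec (subst \<sigma> fe) (subst \<sigma> X) (subst \<sigma> f) (subst \<sigma> a) (subst \<sigma> c) (subst \<sigma> e)
      (subst \<sigma> \<alpha>) (subst \<sigma> \<gamma>) (subst \<sigma> \<theta>)"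
  by (simp add: split_path_rec_def)

lemma split_path_rec_ty:
  assumes fe: "\<Gamma> \<turnstile> fe \<^bold>: FunExt i" and X: "\<Gamma> \<turnstile> X \<^bold>: Univ i" and f: "\<Gamma> \<turnstile> f \<^bold>: arr X X"
    and e: "\<Gamma> \<turnstile> e \<^bold>: IdT (arr NatT X) a c"
    and \<alpha>: "\<Gamma> \<turnstile> \<alpha> \<^bold>: compat X f a" and \<gamma>: "\<Gamma> \<turnstile> \<gamma> \<^bold>: compat X f c"
    and \<theta>: "\<Gamma> \<turnstile> \<theta> \<^bold>: comm_type X f a \<alpha> c \<gamma> (seq_happly X a c \<bullet> e)"
  shows "\<Gamma> \<turnstile> split_path_rec fe X f a c e \<alpha> \<gamma> \<theta> \<^bold>: IdT (split_type X f) (Pair a \<alpha>) (Pair c \<gamma>)"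
proof -
  have "\<Gamma> \<turnstile> IdRec (split_path_motive X f) (split_path_base fe X f) a c e \<^bold>: PiT (compat X f a)
      (PiT (compat (X\<up>1) (f\<up>1) (c\<up>1)) (PiT (comm_type (X\<up>2) (f\<up>2) (a\<up>2) (Var 1) (c\<up>2) (Var 0)
         (seq_happly (X\<up>2) (a\<up>2) (c\<up>2) \<bullet> e\<up>2))
      (IdT (split_type (X\<up>3) (f\<up>3)) (Pair (a\<up>3) (Var 2)) (Pair (c\<up>3) (Var 1)))))"
    by (rule J_ty[OF split_path_motive_ty[OF X f] split_path_base_ty[OF fe X f] refl e])
      (simp add: split_path_motive_def)
  from pi_app[OF this \<alpha> refl]
  have "\<Gamma> \<turnstile> IdRec (split_path_motive X f) (split_path_base fe X f) a c e \<bullet> \<alpha> \<^bold>: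
      PiT (compat X f c) (PiT (comm_type (X\<up>1) (f\<up>1) (a\<up>1) (\<alpha>\<up>1) (c\<up>1) (Var 0)
         (seq_happly (X\<up>1) (a\<up>1) (c\<up>1) \<bullet> e\<up>1))
      (IdT (split_type (X\<up>2) (f\<up>2)) (Pair (a\<up>2) (\<alpha>\<up>2)) (Pair (c\<up>2) (Var 1))))"
    by simp
  from pi_app[OF this \<gamma> refl]
  have "\<Gamma> \<turnstile> IdRec (split_path_motive X f) (split_path_base fe X f) a c e \<bullet> \<alpha> \<bullet> \<gamma> \<^bold>:
      PiT (comm_type X f a \<alpha> c \<gamma> (seq_happly X a c \<bullet> e))
      (IdT (split_type (X\<up>1) (f\<up>1)) (Pair (a\<up>1) (\<alpha>\<up>1)) (Pair (c\<up>1) (\<gamma>\<up>1)))"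
    by simp
  from pi_app[OF this \<theta> refl] show ?thesis by (simp add: split_path_rec_def)
qed

lemma split_path_rec_refl:
  assumes fe: "\<Gamma> \<turnstile> fe \<^bold>: FunExt i" and X: "\<Gamma> \<turnstile> X \<^bold>: Univ i" and f: "\<Gamma> \<turnstile> f \<^bold>: arr X X"
    and a: "\<Gamma> \<turnstile> a \<^bold>: arr NatT X"
    and \<alpha>: "\<Gamma> \<turnstile> \<alpha> \<^bold>: compat X f a" and \<gamma>: "\<Gamma> \<turnstile> \<gamma> \<^bold>: compat X f a"
    and \<theta>: "\<Gamma> \<turnstile> \<theta> \<^bold>: comm_type X f a \<alpha> a \<gamma> (seq_happly X a a \<bullet> Refl a)"
  shows "\<Gamma> \<turnstile> split_path_rec fe X f a a (Refl a) \<alpha> \<gamma> \<theta> \<doteq> split_path_body fe X f a \<alpha> \<gamma> \<theta>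
    \<^bold>: IdT (split_type X f) (Pair a \<alpha>) (Pair a \<gamma>)"
proof -
  let ?R = "IdRec (split_path_motive X f) (split_path_base fe X f) a a (Refl a)"
  let ?C2 = "comm_type (X\<up>2) (f\<up>2) (a\<up>2) (Var 1) (a\<up>2) (Var 0) (seq_happly (X\<up>2) (a\<up>2) (a\<up>2) \<bullet> Refl (a\<up>2))"
  let ?b = "split_path_body (fe\<up>3) (X\<up>3) (f\<up>3) (a\<up>3) (Var 2) (Var 1) (Var 0)"
  let ?T = "IdT (split_type (X\<up>3) (f\<up>3)) (Pair (a\<up>3) (Var 2)) (Pair (a\<up>3) (Var 1))"
  let ?L = "Lam (compat X f a) (Lam (compat (X\<up>1) (f\<up>1) (a\<up>1)) (Lam ?C2 ?b))"
  have wf: "wf_ctx \<Gamma>" using a by (rule wf_of_jdg)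
  have R: "\<Gamma> \<turnstile> ?R \<doteq> ?L \<^bold>: PiT (compat X f a) (PiT (compat (X\<up>1) (f\<up>1) (a\<up>1)) (PiT ?C2 ?T))"
    by (rule J_refl[OF split_path_motive_ty[OF X f] split_path_base_ty[OF fe X f] refl a])
      (simp_all add: split_path_motive_def split_path_base_eq)
  from pi_app_cong[OF pi_app_cong[OF pi_app_cong[OF R eq_refl[OF \<alpha>] refl, simplified] eq_refl[OF \<gamma>] refl, simplified]
      eq_refl[OF \<theta>] refl]
  have "\<Gamma> \<turnstile> ?R \<bullet> \<alpha> \<bullet> \<gamma> \<bullet> \<theta> \<doteq> ?L \<bullet> \<alpha> \<bullet> \<gamma> \<bullet> \<theta> \<^bold>: IdT (split_type X f) (Pair a \<alpha>) (Pair a \<gamma>)"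
    by simp
  moreover have "\<Gamma> \<turnstile> ?L \<bullet> \<alpha> \<bullet> \<gamma> \<bullet> \<theta> \<doteq> split_path_body fe X f a \<alpha> \<gamma> \<theta> \<^bold>: IdT (split_type X f) (Pair a \<alpha>) (Pair a \<gamma>)"
  proof -
    have s: "sub_ok \<Gamma> (a \<rhd> Var) (arr NatT X # \<Gamma>)" using a wf by (intro sub_ok_scons sub_ok_Var) simp_all
    have w: "wf_ctx (refl_ctx X f \<Gamma>)" by (rule refl_ctx_wf[OF X f])
    note w' = wf_ctx_tail[OF w] wf_ctx_tail[OF wf_ctx_tail[OF w]]
    \<comment> \<open>The computation rule instantiates the sequence variable by \<open>a\<close>
      underneath three abstractions; the same lifted substitution types the resulting body.\<close>
    have "sub_ok (?C2 # compat (X\<up>1) (f\<up>1) (a\<up>1) # compat X f a # \<Gamma>) (up (up (up (a \<rhd> Var)))) (refl_ctx X f \<Gamma>)"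
      using sub_ok_up[OF sub_ok_up[OF sub_ok_up[OF s w'(2)] w'(1)] w] by simp
    from substitution(1)[OF this split_path_body_open_ty[OF fe X f]]
    have "?C2 # compat (X\<up>1) (f\<up>1) (a\<up>1) # compat X f a # \<Gamma> \<turnstile> ?b \<^bold>: ?T" by simp
    from pi_comp3[OF this \<alpha>, of \<gamma> \<theta>] \<gamma> \<theta> show ?thesis by simp
  qed
  ultimately show ?thesis unfolding split_path_rec_def by (rule eq_trans)
qed

section \<open>The action of \<open>s\<close> on paths in the splitting\<close>

lemma ap_section_ty:
  assumes X: "\<Gamma> \<turnstile> X \<^bold>: Univ i" and f: "\<Gamma> \<turnstile> f \<^bold>: arr X X"
    and a: "\<Gamma> \<turnstile> a \<^bold>: arr NatT X" and \<alpha>: "\<Gamma> \<turnstile> \<alpha> \<^bold>: compat X f a"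
    and c: "\<Gamma> \<turnstile> c \<^bold>: arr NatT X" and \<gamma>: "\<Gamma> \<turnstile> \<gamma> \<^bold>: compat X f c"
  shows ap_section_ty': "\<Gamma> \<turnstile> p \<^bold>: IdT (split_type X f) (Pair a \<alpha>) (Pair c \<gamma>) \<Longrightarrow>
      \<Gamma> \<turnstile> ap X (section_map X f) (Pair a \<alpha>) (Pair c \<gamma>) p \<^bold>: IdT X (a \<bullet> Zero) (c \<bullet> Zero)"
    and ap_section_cong: "\<Gamma> \<turnstile> p \<doteq> q \<^bold>: IdT (split_type X f) (Pair a \<alpha>) (Pair c \<gamma>) \<Longrightarrow>
      \<Gamma> \<turnstile> ap X (section_map X f) (Pair a \<alpha>) (Pair c \<gamma>) p \<doteq> ap X (section_map X f) (Pair a \<alpha>) (Pair c \<gamma>) q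
        \<^bold>: IdT X (a \<bullet> Zero) (c \<bullet> Zero)"
proof -
  \<comment> \<open>On pairs \<open>s\<close> computes to the value at index 0, which puts the image
    of a path into the same type as \<open>\<xi> 0\<close>.\<close>
  have e: "ty_eq \<Gamma> (IdT X (section_map X f \<bullet> Pair a \<alpha>) (section_map X f \<bullet> Pair c \<gamma>)) (IdT X (a \<bullet> Zero) (c \<bullet> Zero))"
    by (rule ty_eq_Id ty_eq_refl is_tyI[OF X] section_pair[OF X f] a \<alpha> c \<gamma>)+
  show "\<Gamma> \<turnstile> ap X (section_map X f) (Pair a \<alpha>) (Pair c \<gamma>) p \<^bold>: IdT X (a \<bullet> Zero) (c \<bullet> Zero)"
    if "\<Gamma> \<turnstile> p \<^bold>: IdT (split_type X f) (Pair a \<alpha>) (Pair c \<gamma>)"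
    by (rule conv_ty[OF ap_ty[OF section_ty[OF X f] that] e])
  show "\<Gamma> \<turnstile> ap X (section_map X f) (Pair a \<alpha>) (Pair c \<gamma>) p \<doteq> ap X (section_map X f) (Pair a \<alpha>) (Pair c \<gamma>) q
        \<^bold>: IdT X (a \<bullet> Zero) (c \<bullet> Zero)"
    if "\<Gamma> \<turnstile> p \<doteq> q \<^bold>: IdT (split_type X f) (Pair a \<alpha>) (Pair c \<gamma>)"
    by (rule eq_conv_ty[OF ap_cong[OF section_ty[OF X f] _ _ that] e] eq_refl split_pair_ty[OF X f] a \<alpha> c \<gamma>)+
qed

text \<open>Along \<open>q\<close> the sequence stays fixed, so \<open>s\<close> is constantly
  \<open>a 0\<close> on the pairs in question. After induction on \<open>q\<close>, both actions on
  reflexivity compute to reflexivity.\<close>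

lemma ap_section_ap_pair_fun:
  assumes X: "\<Gamma> \<turnstile> X \<^bold>: Univ i" and f: "\<Gamma> \<turnstile> f \<^bold>: arr X X" and a: "\<Gamma> \<turnstile> a \<^bold>: arr NatT X"
    and q: "\<Gamma> \<turnstile> q \<^bold>: IdT (compat X f a) \<alpha> \<gamma>"
  shows "inh \<Gamma> (IdT (IdT X (a \<bullet> Zero) (a \<bullet> Zero)) (ap X (section_map X f) (Pair a \<alpha>) (Pair a \<gamma>)
    (ap (split_type X f) (Lam (compat X f a) (Pair (a\<up>1) (Var 0))) \<alpha> \<gamma> q)) (Refl (a \<bullet> Zero)))"
proof -
  let ?\<Delta> = "id_ctx (compat X f a) \<Gamma>"
  let ?C = "IdT (IdT (X\<up>3) (a\<up>3 \<bullet> Zero) (a\<up>3 \<bullet> Zero)) (ap (X\<up>3) (section_map (X\<up>3) (f\<up>3)) (Pair (a\<up>3) (Var 2)) (Pair (a\<up>3) (Var 1))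
    (ap (split_type (X\<up>3) (f\<up>3)) (Lam (compat (X\<up>3) (f\<up>3) (a\<up>3)) (Pair (a\<up>4) (Var 0))) (Var 2) (Var 1) (Var 0))) (Refl (a\<up>3 \<bullet> Zero))"
  have C: "is_ty \<Gamma> (compat X f a)" by (rule is_tyI[OF compat_level[OF X f a]])
  have w: "wf_ctx ?\<Delta>" by (rule wf_id_ctx[OF C])
  have X3: "?\<Delta> \<turnstile> X\<up>3 \<^bold>: Univ i" and f3: "?\<Delta> \<turnstile> f\<up>3 \<^bold>: arr (X\<up>3) (X\<up>3)" and a3: "?\<Delta> \<turnstile> a\<up>3 \<^bold>: arr NatT (X\<up>3)"
    by (rule weak3[OF w X] weak3[OF w f] weak3[OF w a], simp)+
  \<comment> \<open>Splitting the shift exhibits the bound pairing function as the one belonging to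
    the weakened sequence \<open>a\<up>3\<close>.\<close>
  have a4: "a\<up>4 = a\<up>3\<up>1" by simp
  have z: "?\<Delta> \<turnstile> a\<up>3 \<bullet> Zero \<^bold>: X\<up>3" by (rule arr_app[OF a3 nat_zero[OF w]])
  have m: "is_ty ?\<Delta> ?C" unfolding a4
    by (rule is_ty_Id is_tyI[OF X3] z refl_ty ap_section_ty'[OF X3 f3] a3 ap_pair_fun_ty[OF X3 f3 a3] var_ty[OF w] | simp)+
  let ?\<Delta>1 = "compat X f a # \<Gamma>"
  have w1: "wf_ctx ?\<Delta>1" by (rule wfI[OF C])
  have X1: "?\<Delta>1 \<turnstile> X\<up>1 \<^bold>: Univ i" and f1: "?\<Delta>1 \<turnstile> f\<up>1 \<^bold>: arr (X\<up>1) (X\<up>1)" and a1: "?\<Delta>1 \<turnstile> a\<up>1 \<^bold>: arr NatT (X\<up>1)"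
    and v: "?\<Delta>1 \<turnstile> Var 0 \<^bold>: compat (X\<up>1) (f\<up>1) (a\<up>1)"
    by (rule weak1[OF w1 X] weak1[OF w1 f] weak1[OF w1 a] var_ty[OF w1] | simp)+
  let ?F = "Lam (compat (X\<up>1) (f\<up>1) (a\<up>1)) (Pair (a\<up>1\<up>1) (Var 0))"
  let ?P = "Pair (a\<up>1) (Var 0)"
  let ?s = "section_map (X\<up>1) (f\<up>1)"
  note P = split_pair_ty[OF X1 f1 a1 v] and Fv = pair_fun_app[OF X1 f1 a1 v]
  have "?\<Delta>1 \<turnstile> ap (split_type (X\<up>1) (f\<up>1)) ?F (Var 0) (Var 0) (Refl (Var 0)) \<doteq> Refl ?P
      \<^bold>: IdT (split_type (X\<up>1) (f\<up>1)) ?P ?P"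
    by (rule eq_conv_ty[OF eq_trans[OF ap_refl[OF pair_fun_ty[OF X1 f1 a1] v] refl_cong[OF Fv]]]
        ty_eq_Id ty_eq_refl is_ty_split[OF X1 f1] Fv)+
  from ap_section_cong[OF X1 f1 a1 v a1 v this]
  have "?\<Delta>1 \<turnstile> ap (X\<up>1) ?s ?P ?P (ap (split_type (X\<up>1) (f\<up>1)) ?F (Var 0) (Var 0) (Refl (Var 0))) \<doteq>
      ap (X\<up>1) ?s ?P ?P (Refl ?P) \<^bold>: IdT (X\<up>1) (a\<up>1 \<bullet> Zero) (a\<up>1 \<bullet> Zero)" .
  moreover have "?\<Delta>1 \<turnstile> ap (X\<up>1) ?s ?P ?P (Refl ?P) \<doteq> Refl (a\<up>1 \<bullet> Zero) \<^bold>: IdT (X\<up>1) (a\<up>1 \<bullet> Zero) (a\<up>1 \<bullet> Zero)"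
    by (rule eq_conv_ty[OF eq_trans[OF ap_refl[OF section_ty[OF X1 f1] P] refl_cong[OF section_pair[OF X1 f1 a1 v]]]]
        ty_eq_Id ty_eq_refl is_tyI[OF X1] section_pair[OF X1 f1 a1 v])+
  ultimately have "inh ?\<Delta>1 (IdT (IdT (X\<up>1) (a\<up>1 \<bullet> Zero) (a\<up>1 \<bullet> Zero))
      (ap (X\<up>1) ?s ?P ?P (ap (split_type (X\<up>1) (f\<up>1)) ?F (Var 0) (Var 0) (Refl (Var 0)))) (Refl (a\<up>1 \<bullet> Zero)))"
    by (intro inh_eq) (rule eq_trans)
  then show ?thesis by (rule inh_J[OF m _ _ q]) simp_all
qed

text \<open>
  The first component of a path built from \<open>e\<close> is \<open>happly e\<close>, here at index 0: for
  \<open>e = refl\<close> the path is an \<open>ap (\<lambda>\<delta>. (a, \<delta>))\<close>, which \<open>s\<close> sends to a reflexivity path.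
\<close>

lemma ap_section_split_path_rec:
  assumes fe: "\<Gamma> \<turnstile> fe \<^bold>: FunExt i" and X: "\<Gamma> \<turnstile> X \<^bold>: Univ i" and f: "\<Gamma> \<turnstile> f \<^bold>: arr X X"
    and e: "\<Gamma> \<turnstile> e \<^bold>: IdT (arr NatT X) a c"
    and \<alpha>: "\<Gamma> \<turnstile> \<alpha> \<^bold>: compat X f a" and \<gamma>: "\<Gamma> \<turnstile> \<gamma> \<^bold>: compat X f c"
    and \<theta>: "\<Gamma> \<turnstile> \<theta> \<^bold>: comm_type X f a \<alpha> c \<gamma> (seq_happly X a c \<bullet> e)"
  shows "inh \<Gamma> (IdT (IdT X (a \<bullet> Zero) (c \<bullet> Zero))
    (ap X (section_map X f) (Pair a \<alpha>) (Pair c \<gamma>) (split_path_rec fe X f a c e \<alpha> \<gamma> \<theta>))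
    (seq_happly X a c \<bullet> e \<bullet> Zero))"
proof -
  let ?E = "\<lambda>fe X f a c e \<alpha> \<gamma> \<theta>. IdT (IdT X (a \<bullet> Zero) (c \<bullet> Zero))
    (ap X (section_map X f) (Pair a \<alpha>) (Pair c \<gamma>) (split_path_rec fe X f a c e \<alpha> \<gamma> \<theta>))
    (seq_happly X a c \<bullet> e \<bullet> Zero)"
  \<comment> \<open>The types of \<open>\<alpha>\<close>, \<open>\<gamma>\<close> and
    \<open>\<theta>\<close> depend on the end points or on the path, hence they are quantified
    inside the motive.\<close>
  let ?C = "PiT (compat (X\<up>3) (f\<up>3) (Var 2)) (PiT (compat (X\<up>4) (f\<up>4) (Var 2))
    (PiT (comm_type (X\<up>5) (f\<up>5) (Var 4) (Var 1) (Var 3) (Var 0) (seq_happly (X\<up>5) (Var 4) (Var 3) \<bullet> Var 2))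
      (?E (fe\<up>6) (X\<up>6) (f\<up>6) (Var 5) (Var 4) (Var 3) (Var 2) (Var 1) (Var 0))))"
  have w: "wf_ctx (motive_ctx X f \<Gamma>)" by (rule motive_ctx_wf[OF X f])
  have X6: "motive_ctx X f \<Gamma> \<turnstile> X\<up>6 \<^bold>: Univ i" and f6: "motive_ctx X f \<Gamma> \<turnstile> f\<up>6 \<^bold>: arr (X\<up>6) (X\<up>6)"
    and fe6: "motive_ctx X f \<Gamma> \<turnstile> fe\<up>6 \<^bold>: FunExt i"
    by (rule weak6[OF w X] weak6[OF w f] weak6[OF w fe], simp)+
  have m: "is_ty (id_ctx (arr NatT X) \<Gamma>) ?C"
    by (rule is_ty_Pi is_ty_Id is_tyI[OF X6] arr_app[where A = NatT] ap_section_ty'[OF X6 f6] split_path_rec_ty[OF fe6 X6 f6]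
        seq_htpy_app seq_happly_app[OF X6] nat_zero[OF w] var_ty[OF w] | simp)+
  \<comment> \<open>Proved for arbitrary contexts and terms, since the induction uses it for the
    variables of \<open>refl_ctx\<close>.\<close>
  have base: "inh \<Gamma> (?E fe X f a a (Refl a) \<alpha> \<gamma> \<theta>)"
    if fe: "\<Gamma> \<turnstile> fe \<^bold>: FunExt i" and X: "\<Gamma> \<turnstile> X \<^bold>: Univ i" and f: "\<Gamma> \<turnstile> f \<^bold>: arr X X"
    and a: "\<Gamma> \<turnstile> a \<^bold>: arr NatT X" and \<alpha>: "\<Gamma> \<turnstile> \<alpha> \<^bold>: compat X f a" and \<gamma>: "\<Gamma> \<turnstile> \<gamma> \<^bold>: compat X f a"
    and \<theta>: "\<Gamma> \<turnstile> \<theta> \<^bold>: comm_type X f a \<alpha> a \<gamma> (seq_happly X a a \<bullet> Refl a)" for \<Gamma> fe X f a \<alpha> \<gamma> \<theta>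
  proof -
    obtain q where q: "\<Gamma> \<turnstile> q \<^bold>: IdT (compat X f a) \<alpha> \<gamma>" and body: "split_path_body fe X f a \<alpha> \<gamma> \<theta> =
        ap (split_type X f) (Lam (compat X f a) (Pair (a\<up>1) (Var 0))) \<alpha> \<gamma> q"
      using split_path_body_eq_ap[OF fe X f a \<alpha> \<gamma> \<theta>] by blast
    note z = nat_zero[OF wf_of_jdg(1)[OF X]]
    note r = ap_section_cong[OF X f a \<alpha> a \<gamma> eq_sym[OF split_path_rec_refl[OF fe X f a \<alpha> \<gamma> \<theta>]]]
      and h = eq_sym[OF seq_happly_refl[OF X a z]]
    show ?thesis
      by (rule inh_conv[OF ap_section_ap_pair_fun[OF X f a q, folded body]] ty_eq_Id ty_eq_refl eq_is_ty[OF r] r h)+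
  qed
  have w4: "wf_ctx (refl_ctx X f \<Gamma>)" by (rule refl_ctx_wf[OF X f])
  have X4: "refl_ctx X f \<Gamma> \<turnstile> X\<up>4 \<^bold>: Univ i" and f4: "refl_ctx X f \<Gamma> \<turnstile> f\<up>4 \<^bold>: arr (X\<up>4) (X\<up>4)"
    and fe4: "refl_ctx X f \<Gamma> \<turnstile> fe\<up>4 \<^bold>: FunExt i"
    by (rule weak4[OF w4 X] weak4[OF w4 f] weak4[OF w4 fe], simp)+
  have "inh (refl_ctx X f \<Gamma>) (?E (fe\<up>4) (X\<up>4) (f\<up>4) (Var 3) (Var 3) (Refl (Var 3)) (Var 2) (Var 1) (Var 0))"
    by (rule base[OF fe4 X4 f4] var_ty[OF w4] | simp)+
  from inh_lam[OF inh_lam[OF inh_lam[OF this]]]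
  have "inh (arr NatT X # \<Gamma>) (refl_inst ?C)" by simp
  from inh_J[OF m this refl e refl]
  have "inh \<Gamma> (PiT (compat X f a) (PiT (compat (X\<up>1) (f\<up>1) (c\<up>1)) (PiT (comm_type (X\<up>2) (f\<up>2) (a\<up>2) (Var 1) (c\<up>2) (Var 0)
         (seq_happly (X\<up>2) (a\<up>2) (c\<up>2) \<bullet> e\<up>2))
      (?E (fe\<up>3) (X\<up>3) (f\<up>3) (a\<up>3) (c\<up>3) (e\<up>3) (Var 2) (Var 1) (Var 0)))))" by simp
  from inh_app[OF inh_app[OF inh_app[OF this \<alpha> refl, simplified] \<gamma> refl, simplified] \<theta> refl]
  show ?thesis by simp
qed

text \<open>Extracts what later arguments need about the path from function extensionality and about
  the transported proof: their types, and that \<open>happly e\<close> is \<open>\<xi>\<close> up to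
  a path.\<close>

lemma split_path_eq_rec:
  assumes fe: "\<Gamma> \<turnstile> fe \<^bold>: FunExt i" and X: "\<Gamma> \<turnstile> X \<^bold>: Univ i" and f: "\<Gamma> \<turnstile> f \<^bold>: arr X X"
    and a: "\<Gamma> \<turnstile> a \<^bold>: arr NatT X" and \<alpha>: "\<Gamma> \<turnstile> \<alpha> \<^bold>: compat X f a"
    and c: "\<Gamma> \<turnstile> c \<^bold>: arr NatT X" and \<gamma>: "\<Gamma> \<turnstile> \<gamma> \<^bold>: compat X f c"
    and \<xi>: "\<Gamma> \<turnstile> \<xi> \<^bold>: seq_htpy X a c" and \<theta>: "\<Gamma> \<turnstile> \<theta> \<^bold>: comm_type X f a \<alpha> c \<gamma> \<xi>"
  obtains e \<theta>' where "split_path fe X f a \<alpha> c \<gamma> \<xi> \<theta> = split_path_rec fe X f a c e \<alpha> \<gamma> \<theta>'"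
    and "\<Gamma> \<turnstile> e \<^bold>: IdT (arr NatT X) a c"
    and "inh \<Gamma> (IdT (seq_htpy X a c) (seq_happly X a c \<bullet> e) \<xi>)"
    and "\<Gamma> \<turnstile> \<theta>' \<^bold>: comm_type X f a \<alpha> c \<gamma> (seq_happly X a c \<bullet> e)"
proof -
  let ?B = "Lam NatT (X\<up>1)"
  let ?e = "funext fe NatT ?B a c \<xi>"
  let ?h = "seq_happly X a c \<bullet> ?e"
  let ?T = "homotopy NatT ?B a c"
  let ?P = "Lam ?T (comm_type (X\<up>1) (f\<up>1) (a\<up>1) (\<alpha>\<up>1) (c\<up>1) (\<gamma>\<up>1) (Var 0))"
  let ?hf = "happly_funext fe NatT ?B a c \<xi>"
  note N = nat_level[OF wf_of_jdg(1)[OF X], of i] and B = X_level[OF X]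
  note fun_args = fe N B a[unfolded seq_PiT] c[unfolded seq_PiT] \<xi>[unfolded seq_htpy_def]
  have e: "\<Gamma> \<turnstile> ?e \<^bold>: IdT (arr NatT X) a c"
    unfolding seq_PiT by (rule funext_ty(1)[OF fun_args])
  have hf: "\<Gamma> \<turnstile> ?hf \<^bold>: IdT (seq_htpy X a c) ?h \<xi>"
    unfolding seq_htpy_def seq_happly_def by (rule funext_ty(2)[OF fun_args])
  \<comment> \<open>The transport inside \<open>split_path\<close> is written over
    \<open>homotopy\<close>, which agrees with the type of \<open>\<xi>\<close> only
    judgementally.\<close>
  have T: "ty_eq \<Gamma> ?T (seq_htpy X a c)"
    unfolding seq_htpy_def by (rule homotopy_lam[OF fun_args(3-5)])
  have hfT: "\<Gamma> \<turnstile> ?hf \<^bold>: IdT ?T ?h \<xi>"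
    by (rule conv_ty[OF hf ty_eq_Id[OF ty_eq_sym[OF T]]] eq_refl id_inv[OF hf])+
  have wf: "wf_ctx (?T # \<Gamma>)" by (rule wfI[OF ty_eq_is_ty(1)[OF T]])
  have w: "?T # \<Gamma> \<turnstile> f\<up>1 \<^bold>: arr (X\<up>1) (X\<up>1)" "?T # \<Gamma> \<turnstile> a\<up>1 \<^bold>: arr NatT (X\<up>1)"
    "?T # \<Gamma> \<turnstile> \<alpha>\<up>1 \<^bold>: compat (X\<up>1) (f\<up>1) (a\<up>1)" "?T # \<Gamma> \<turnstile> c\<up>1 \<^bold>: arr NatT (X\<up>1)"
    "?T # \<Gamma> \<turnstile> \<gamma>\<up>1 \<^bold>: compat (X\<up>1) (f\<up>1) (c\<up>1)"
    by (rule weak1[OF wf f] weak1[OF wf a] weak1[OF wf c] weak1[OF wf \<alpha>] weak1[OF wf \<gamma>], simp)+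
  have v: "?T # \<Gamma> \<turnstile> Var 0 \<^bold>: seq_htpy (X\<up>1) (a\<up>1) (c\<up>1)"
    using conv_ty[OF var0[OF wf] ty_eq_weaken1[OF T wf]] by simp
  obtain j where C: "?T # \<Gamma> \<turnstile> comm_type (X\<up>1) (f\<up>1) (a\<up>1) (\<alpha>\<up>1) (c\<up>1) (\<gamma>\<up>1) (Var 0) \<^bold>: Univ j"
    using is_ty_comm_type[OF w v] by (auto simp: is_ty_def)
  have P: "ty_eq \<Gamma> (?P \<bullet> \<zeta>) (comm_type X f a \<alpha> c \<gamma> \<zeta>)" if "\<Gamma> \<turnstile> \<zeta> \<^bold>: ?T" for \<zeta>
    by (rule ty_eqI[OF pi_beta[OF C that]]) simp_all
  have \<theta>': "\<Gamma> \<turnstile> transport ?P \<xi> ?h (path_inv ?T ?h \<xi> ?hf) \<theta> \<^bold>: comm_type X f a \<alpha> c \<gamma> ?h"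
    by (rule conv_ty[OF transport_ty[OF fam_lam[OF C] path_inv_ty[OF hfT]] P]
        conv_ty[OF \<theta> ty_eq_sym[OF P]] id_inv[OF hfT])+
  show ?thesis
    by (rule that[OF _ e inhI[OF hf] \<theta>']) (simp add: split_path_def split_path_rec_def Let_def)
qed

lemma split_path_ty:
  assumes fe: "\<Gamma> \<turnstile> fe \<^bold>: FunExt i" and X: "\<Gamma> \<turnstile> X \<^bold>: Univ i" and f: "\<Gamma> \<turnstile> f \<^bold>: arr X X"
    and a: "\<Gamma> \<turnstile> a \<^bold>: arr NatT X" and \<alpha>: "\<Gamma> \<turnstile> \<alpha> \<^bold>: compat X f a"
    and c: "\<Gamma> \<turnstile> c \<^bold>: arr NatT X" and \<gamma>: "\<Gamma> \<turnstile> \<gamma> \<^bold>: compat X f c"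
    and \<xi>: "\<Gamma> \<turnstile> \<xi> \<^bold>: seq_htpy X a c" and \<theta>: "\<Gamma> \<turnstile> \<theta> \<^bold>: comm_type X f a \<alpha> c \<gamma> \<xi>"
  shows "\<Gamma> \<turnstile> split_path fe X f a \<alpha> c \<gamma> \<xi> \<theta> \<^bold>: IdT (split_type X f) (Pair a \<alpha>) (Pair c \<gamma>)"
  using split_path_eq_rec[OF assms] split_path_rec_ty[OF fe X f _ \<alpha> \<gamma>] by metis

lemma ap_section_split_path:
  assumes fe: "\<Gamma> \<turnstile> fe \<^bold>: FunExt i" and X: "\<Gamma> \<turnstile> X \<^bold>: Univ i" and f: "\<Gamma> \<turnstile> f \<^bold>: arr X X"
    and a: "\<Gamma> \<turnstile> a \<^bold>: arr NatT X" and \<alpha>: "\<Gamma> \<turnstile> \<alpha> \<^bold>: compat X f a"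
    and c: "\<Gamma> \<turnstile> c \<^bold>: arr NatT X" and \<gamma>: "\<Gamma> \<turnstile> \<gamma> \<^bold>: compat X f c"
    and \<xi>: "\<Gamma> \<turnstile> \<xi> \<^bold>: seq_htpy X a c" and \<theta>: "\<Gamma> \<turnstile> \<theta> \<^bold>: comm_type X f a \<alpha> c \<gamma> \<xi>"
  shows "inh \<Gamma> (IdT (IdT X (a \<bullet> Zero) (c \<bullet> Zero))
    (ap X (section_map X f) (Pair a \<alpha>) (Pair c \<gamma>) (split_path fe X f a \<alpha> c \<gamma> \<xi> \<theta>)) (\<xi> \<bullet> Zero))"
proof -
  obtain e \<theta>' where eq: "split_path fe X f a \<alpha> c \<gamma> \<xi> \<theta> = split_path_rec fe X f a c e \<alpha> \<gamma> \<theta>'"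
    and e: "\<Gamma> \<turnstile> e \<^bold>: IdT (arr NatT X) a c"
    and h: "inh \<Gamma> (IdT (seq_htpy X a c) (seq_happly X a c \<bullet> e) \<xi>)"
    and \<theta>': "\<Gamma> \<turnstile> \<theta>' \<^bold>: comm_type X f a \<alpha> c \<gamma> (seq_happly X a c \<bullet> e)"
    by (rule split_path_eq_rec[OF assms])
  have wf: "wf_ctx (seq_htpy X a c # \<Gamma>)" by (rule wfI[OF is_ty_seq_htpy[OF a c]])
  \<comment> \<open>Evaluation at index 0 as an open term, through which the path from
    \<open>happly e\<close> to \<open>\<xi>\<close> is pushed.\<close>
  have "seq_htpy X a c # \<Gamma> \<turnstile> Var 0 \<bullet> Zero \<^bold>: (IdT X (a \<bullet> Zero) (c \<bullet> Zero))\<up>1"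
    unfolding weaken_simps by (rule seq_htpy_app var_ty[OF wf] nat_zero[OF wf] | simp)+
  from inh_cong[OF h this]
  have "inh \<Gamma> (IdT (IdT X (a \<bullet> Zero) (c \<bullet> Zero)) (seq_happly X a c \<bullet> e \<bullet> Zero) (\<xi> \<bullet> Zero))" by simp
  with ap_section_split_path_rec[OF fe X f e \<alpha> \<gamma> \<theta>'] show ?thesis
    unfolding eq by (rule inh_trans)
qed

section \<open>The two paths\<close>

lemma b_seq_body_ty:
  assumes f: "\<Gamma> \<turnstile> f \<^bold>: arr X X" and a: "\<Gamma> \<turnstile> a \<^bold>: arr NatT X"
  shows "NatT # \<Gamma> \<turnstile> f\<up>1 \<bullet> (f\<up>1 \<bullet> (a\<up>1 \<bullet> Succ (Var 0))) \<^bold>: X\<up>1"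
proof -
  have wf: "wf_ctx (NatT # \<Gamma>)" by (rule wf_Nat[OF wf_of_jdg(1)[OF f]])
  show ?thesis
    by (rule arr_app[where A = "X\<up>1" and f = "f\<up>1"] arr_app[where A = NatT and f = "a\<up>1"] weak1[OF wf f] weak1[OF wf a]
        nat_succ nat_var0[OF wf] | simp)+
qed

lemma b_seq_ty:
  assumes "\<Gamma> \<turnstile> f \<^bold>: arr X X" "\<Gamma> \<turnstile> a \<^bold>: arr NatT X"
  shows "\<Gamma> \<turnstile> b_seq f a \<^bold>: arr NatT X"
  unfolding b_seq_def by (rule arr_lam[OF b_seq_body_ty[OF assms]])

lemma b_seq_app:
  assumes "\<Gamma> \<turnstile> f \<^bold>: arr X X" "\<Gamma> \<turnstile> a \<^bold>: arr NatT X" "\<Gamma> \<turnstile> n \<^bold>: NatT"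
  shows "\<Gamma> \<turnstile> b_seq f a \<bullet> n \<doteq> f \<bullet> (f \<bullet> (a \<bullet> Succ n)) \<^bold>: X"
  unfolding b_seq_def by (rule pi_beta[OF b_seq_body_ty[OF assms(1,2)] assms(3)]) simp_all

lemma b_seq_subst [simp]: "subst \<sigma> (b_seq f a) = b_seq (subst \<sigma> f) (subst \<sigma> a)"
  by (simp add: b_seq_def)

lemma b_seq_weaken [simp]: "b_seq f a \<up> k = b_seq (f\<up>k) (a\<up>k)"
  unfolding weaken_eq_subst by (rule b_seq_subst)

lemma beta_seq_subst [simp]:
  "subst \<sigma> (beta_seq X f a \<alpha>) = beta_seq (subst \<sigma> X) (subst \<sigma> f) (subst \<sigma> a) (subst \<sigma> \<alpha>)"
  by (simp add: beta_seq_def)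

lemma twice_body_ty:
  assumes f: "\<Gamma> \<turnstile> f \<^bold>: arr X X"
  shows "X # \<Gamma> \<turnstile> f\<up>1 \<bullet> (f\<up>1 \<bullet> Var 0) \<^bold>: X\<up>1"
proof -
  have wf: "wf_ctx (X # \<Gamma>)" by (rule wfI[OF arr_inv[OF f]])
  show ?thesis by (rule arr_app[where A = "X\<up>1"] weak1[OF wf f] var_ty[OF wf] | simp)+
qed

text \<open>The image of \<open>\<alpha> (n+1)\<close> under the twofold \<open>f\<close> runs from
  \<open>f (f (f (a (n+2))))\<close> to \<open>f (f (a (n+1)))\<close>. These are the beta-reduced
  forms of \<open>f (b (n+1))\<close> and \<open>b n\<close>.\<close>

lemma beta_seq_ty:
  assumes f: "\<Gamma> \<turnstile> f \<^bold>: arr X X" and a: "\<Gamma> \<turnstile> a \<^bold>: arr NatT X" and \<alpha>: "\<Gamma> \<turnstile> \<alpha> \<^bold>: compat X f a"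
  shows "\<Gamma> \<turnstile> beta_seq X f a \<alpha> \<^bold>: compat X f (b_seq f a)"
proof -
  have wf: "wf_ctx (NatT # \<Gamma>)" by (rule wf_Nat[OF wf_of_jdg(1)[OF f]])
  let ?\<Delta> = "NatT # \<Gamma>"
  have f1: "?\<Delta> \<turnstile> f\<up>1 \<^bold>: arr (X\<up>1) (X\<up>1)" and a1: "?\<Delta> \<turnstile> a\<up>1 \<^bold>: arr NatT (X\<up>1)"
    and \<alpha>1: "?\<Delta> \<turnstile> \<alpha>\<up>1 \<^bold>: compat (X\<up>1) (f\<up>1) (a\<up>1)"
    by (rule weak1[OF wf f] weak1[OF wf a] weak1[OF wf \<alpha>], simp)+
  note n = nat_var0[OF wf]
  let ?ff = "Lam (X\<up>1) (f\<up>2 \<bullet> (f\<up>2 \<bullet> Var 0))"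
  have b: "X\<up>1 # ?\<Delta> \<turnstile> f\<up>2 \<bullet> (f\<up>2 \<bullet> Var 0) \<^bold>: X\<up>1\<up>1" using twice_body_ty[OF f1] by simp
  have ff: "?\<Delta> \<turnstile> ?ff \<^bold>: arr (X\<up>1) (X\<up>1)" by (rule arr_lam[OF b])
  have ff_app: "?\<Delta> \<turnstile> ?ff \<bullet> y \<doteq> f\<up>1 \<bullet> (f\<up>1 \<bullet> y) \<^bold>: X\<up>1" if "?\<Delta> \<turnstile> y \<^bold>: X\<up>1" for y
    by (rule pi_beta[OF b that]) simp_all
  have bs: "?\<Delta> \<turnstile> f\<up>1 \<bullet> (b_seq (f\<up>1) (a\<up>1) \<bullet> Succ (Var 0)) \<doteq> f\<up>1 \<bullet> (f\<up>1 \<bullet> (f\<up>1 \<bullet> (a\<up>1 \<bullet> Succ (Succ (Var 0))))) \<^bold>: X\<up>1"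
    by (rule arr_app_cong[OF eq_refl[OF f1]] b_seq_app[OF f1 a1] nat_succ n)+
  note aS = arr_app[OF a1 nat_succ[OF n]] and aSS = arr_app[OF a1 nat_succ[OF nat_succ[OF n]]]
  have "?\<Delta> \<turnstile> ap (X\<up>1) ?ff (f\<up>1 \<bullet> (a\<up>1 \<bullet> Succ (Succ (Var 0)))) (a\<up>1 \<bullet> Succ (Var 0)) (\<alpha>\<up>1 \<bullet> Succ (Var 0)) \<^bold>:
      IdT (X\<up>1) (f\<up>1 \<bullet> (b_seq (f\<up>1) (a\<up>1) \<bullet> Succ (Var 0))) (b_seq (f\<up>1) (a\<up>1) \<bullet> Var 0)"
    by (rule conv_ty[OF ap_ty[OF ff compat_app[OF \<alpha>1 nat_succ[OF n]]] ty_eq_Id[OF ty_eq_refl[OF has_is_ty[OF aS]]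
        eq_trans[OF ff_app[OF arr_app[OF f1 aSS]] eq_sym[OF bs]]
        eq_trans[OF ff_app[OF aS] eq_sym[OF b_seq_app[OF f1 a1 n]]]]])
  then show ?thesis unfolding beta_seq_def compat_def by (intro pi_intro) simp
qed

lemma xi1_body_ty:
  assumes f: "\<Gamma> \<turnstile> f \<^bold>: arr X X" and I: "\<Gamma> \<turnstile> I \<^bold>: preidem_type X f"
    and a: "\<Gamma> \<turnstile> a \<^bold>: arr NatT X" and \<alpha>: "\<Gamma> \<turnstile> \<alpha> \<^bold>: compat X f a" and n: "\<Gamma> \<turnstile> n \<^bold>: NatT"
  shows "\<Gamma> \<turnstile> path_concat X (f \<bullet> (f \<bullet> (a \<bullet> Succ n))) (f \<bullet> (a \<bullet> Succ n)) (a \<bullet> n) (I \<bullet> (a \<bullet> Succ n)) (\<alpha> \<bullet> n)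
    \<^bold>: IdT X (f \<bullet> (f \<bullet> (a \<bullet> Succ n))) (a \<bullet> n)"
  by (rule path_concat_ty preidem_app[OF I] compat_app[OF \<alpha>] arr_app[OF a] nat_succ n)+

lemma xi1_body_weaken_ty:
  assumes f: "\<Gamma> \<turnstile> f \<^bold>: arr X X" and I: "\<Gamma> \<turnstile> I \<^bold>: preidem_type X f"
    and a: "\<Gamma> \<turnstile> a \<^bold>: arr NatT X" and \<alpha>: "\<Gamma> \<turnstile> \<alpha> \<^bold>: compat X f a"
  shows "NatT # \<Gamma> \<turnstile> path_concat (X\<up>1) (f\<up>1 \<bullet> (f\<up>1 \<bullet> (a\<up>1 \<bullet> Succ (Var 0)))) (f\<up>1 \<bullet> (a\<up>1 \<bullet> Succ (Var 0))) (a\<up>1 \<bullet> Var 0)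
      (I\<up>1 \<bullet> (a\<up>1 \<bullet> Succ (Var 0))) (\<alpha>\<up>1 \<bullet> Var 0)
    \<^bold>: IdT (X\<up>1) (f\<up>1 \<bullet> (f\<up>1 \<bullet> (a\<up>1 \<bullet> Succ (Var 0)))) (a\<up>1 \<bullet> Var 0)"
proof -
  have wf: "wf_ctx (NatT # \<Gamma>)" by (rule wf_Nat[OF wf_of_jdg(1)[OF f]])
  show ?thesis
    by (rule xi1_body_ty weak1[OF wf f] weak1[OF wf I] weak1[OF wf a] weak1[OF wf \<alpha>] nat_var0[OF wf] | simp)+
qed

lemma xi1_ty:
  assumes f: "\<Gamma> \<turnstile> f \<^bold>: arr X X" and I: "\<Gamma> \<turnstile> I \<^bold>: preidem_type X f"
    and a: "\<Gamma> \<turnstile> a \<^bold>: arr NatT X" and \<alpha>: "\<Gamma> \<turnstile> \<alpha> \<^bold>: compat X f a"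
  shows "\<Gamma> \<turnstile> xi1 X f I a \<alpha> \<^bold>: seq_htpy X (b_seq f a) a"
proof -
  have wf: "wf_ctx (NatT # \<Gamma>)" by (rule wf_Nat[OF wf_of_jdg(1)[OF f]])
  note b = xi1_body_weaken_ty[OF assms]
  have f1: "NatT # \<Gamma> \<turnstile> f\<up>1 \<^bold>: arr (X\<up>1) (X\<up>1)" and a1: "NatT # \<Gamma> \<turnstile> a\<up>1 \<^bold>: arr NatT (X\<up>1)"
    by (rule weak1[OF wf f] weak1[OF wf a], simp)+
  note n = nat_var0[OF wf]
  have "ty_eq (NatT # \<Gamma>) (IdT (X\<up>1) (f\<up>1 \<bullet> (f\<up>1 \<bullet> (a\<up>1 \<bullet> Succ (Var 0)))) (a\<up>1 \<bullet> Var 0))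
      (IdT (X\<up>1) (b_seq (f\<up>1) (a\<up>1) \<bullet> Var 0) (a\<up>1 \<bullet> Var 0))"
    by (rule ty_eq_Id ty_eq_refl id_inv(1)[OF b] eq_sym[OF b_seq_app[OF f1 a1 n]] eq_refl arr_app[OF a1 n])+
  from conv_ty[OF b this] show ?thesis unfolding xi1_def seq_htpy_def Let_def
    by (intro pi_intro) simp
qed

lemma xi1_app:
  assumes f: "\<Gamma> \<turnstile> f \<^bold>: arr X X" and I: "\<Gamma> \<turnstile> I \<^bold>: preidem_type X f"
    and a: "\<Gamma> \<turnstile> a \<^bold>: arr NatT X" and \<alpha>: "\<Gamma> \<turnstile> \<alpha> \<^bold>: compat X f a" and n: "\<Gamma> \<turnstile> n \<^bold>: NatT"
  shows "\<Gamma> \<turnstile> xi1 X f I a \<alpha> \<bullet> n \<doteq> path_concat X (f \<bullet> (f \<bullet> (a \<bullet> Succ n))) (f \<bullet> (a \<bullet> Succ n)) (a \<bullet> n)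
      (I \<bullet> (a \<bullet> Succ n)) (\<alpha> \<bullet> n) \<^bold>: IdT X (f \<bullet> (f \<bullet> (a \<bullet> Succ n))) (a \<bullet> n)"
  unfolding xi1_def Let_def by (rule pi_beta[OF xi1_body_weaken_ty[OF assms(1-4)] n]) simp_all

lemma xi1_subst [simp]: "subst \<sigma> (xi1 X f I a \<alpha>) = xi1 (subst \<sigma> X) (subst \<sigma> f) (subst \<sigma> I) (subst \<sigma> a) (subst \<sigma> \<alpha>)"
  by (simp add: xi1_def Let_def)

text \<open>The recursion inside \<open>xi2\<close> at an arbitrary argument \<open>m\<close>, freed
  from the abstraction so that its computation rule can be stated in \<Gamma>.\<close>

definition xi2_rec :: "tm \<Rightarrow> tm \<Rightarrow> tm \<Rightarrow> tm \<Rightarrow> tm \<Rightarrow> tm \<Rightarrow> tm" where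
  "xi2_rec X f I a \<alpha> m =
     NatRec (IdT (X\<up>1) (f\<up>1 \<bullet> (f\<up>1 \<bullet> (a\<up>1 \<bullet> Succ (Var 0)))) (f\<up>1 \<bullet> (a\<up>1 \<bullet> Zero)))
       (ap X f (f \<bullet> (a \<bullet> Succ Zero)) (a \<bullet> Zero) (\<alpha> \<bullet> Zero))
       (let X' = X\<up>2; f' = f\<up>2; n = Var 1; ih = Var 0;
            fa0 = f' \<bullet> (a\<up>2 \<bullet> Zero); an1 = a\<up>2 \<bullet> Succ n; an2 = a\<up>2 \<bullet> Succ (Succ n)
        in path_concat X' (f' \<bullet> (f' \<bullet> an2)) (f' \<bullet> (f' \<bullet> an1)) fa0
             (path_concat X' (f' \<bullet> (f' \<bullet> an2)) (f' \<bullet> an1) (f' \<bullet> (f' \<bullet> an1))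
                (ap X' f' (f' \<bullet> an2) an1 (\<alpha>\<up>2 \<bullet> Succ n))
                (path_inv X' (f' \<bullet> (f' \<bullet> an1)) (f' \<bullet> an1) (I\<up>2 \<bullet> an1)))
             ih)
       m"

lemma xi2_rec_subst [simp]: "subst \<sigma> (xi2_rec X f I a \<alpha> m) =
    xi2_rec (subst \<sigma> X) (subst \<sigma> f) (subst \<sigma> I) (subst \<sigma> a) (subst \<sigma> \<alpha>) (subst \<sigma> m)"
  by (simp add: xi2_rec_def Let_def)

lemma xi2_eq: "xi2 X f I a \<alpha> = Lam NatT (xi2_rec (X\<up>1) (f\<up>1) (I\<up>1) (a\<up>1) (\<alpha>\<up>1) (Var 0))"
  by (simp add: xi2_def xi2_rec_def Let_def)

lemma xi2_subst [simp]: "subst \<sigma> (xi2 X f I a \<alpha>) = xi2 (subst \<sigma> X) (subst \<sigma> f) (subst \<sigma> I) (subst \<sigma> a) (subst \<sigma> \<alpha>)"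
  by (simp add: xi2_eq)

text \<open>The target \<open>f (a 0)\<close> is the same at every index, so the step only prepends
  a path from \<open>f (f (a (n+2)))\<close> to \<open>f (f (a (n+1)))\<close>: down to
  \<open>f (a (n+1))\<close> by \<open>\<alpha>\<close>, then back up along the inverse of
  \<open>I\<close>.\<close>

lemma xi2_rec_ty:
  assumes X: "\<Gamma> \<turnstile> X \<^bold>: Univ i" and f: "\<Gamma> \<turnstile> f \<^bold>: arr X X" and I: "\<Gamma> \<turnstile> I \<^bold>: preidem_type X f"
    and a: "\<Gamma> \<turnstile> a \<^bold>: arr NatT X" and \<alpha>: "\<Gamma> \<turnstile> \<alpha> \<^bold>: compat X f a"
  shows "\<Gamma> \<turnstile> m \<^bold>: NatT \<Longrightarrow> \<Gamma> \<turnstile> xi2_rec X f I a \<alpha> m \<^bold>: IdT X (f \<bullet> (f \<bullet> (a \<bullet> Succ m))) (f \<bullet> (a \<bullet> Zero))"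
    and "\<Gamma> \<turnstile> xi2_rec X f I a \<alpha> Zero \<doteq> ap X f (f \<bullet> (a \<bullet> Succ Zero)) (a \<bullet> Zero) (\<alpha> \<bullet> Zero)
      \<^bold>: IdT X (f \<bullet> (f \<bullet> (a \<bullet> Succ Zero))) (f \<bullet> (a \<bullet> Zero))"
proof -
  let ?C = "IdT (X\<up>1) (f\<up>1 \<bullet> (f\<up>1 \<bullet> (a\<up>1 \<bullet> Succ (Var 0)))) (f\<up>1 \<bullet> (a\<up>1 \<bullet> Zero))"
  have wf: "wf_ctx (NatT # \<Gamma>)" by (rule wf_Nat[OF wf_of_jdg(1)[OF f]])
  have f1: "NatT # \<Gamma> \<turnstile> f\<up>1 \<^bold>: arr (X\<up>1) (X\<up>1)" and a1: "NatT # \<Gamma> \<turnstile> a\<up>1 \<^bold>: arr NatT (X\<up>1)"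
    by (rule weak1[OF wf f] weak1[OF wf a], simp)+
  have C: "NatT # \<Gamma> \<turnstile> ?C \<^bold>: Univ i"
    by (rule id_form X_level[OF X] arr_app[OF f1] arr_app[OF a1] nat_succ nat_zero[OF wf] nat_var0[OF wf])+
  have z: "\<Gamma> \<turnstile> Zero \<^bold>: NatT" by (rule nat_zero[OF wf_of_jdg(1)[OF f]])
  have c0: "\<Gamma> \<turnstile> ap X f (f \<bullet> (a \<bullet> Succ Zero)) (a \<bullet> Zero) (\<alpha> \<bullet> Zero) \<^bold>: subst1 ?C Zero"
    using ap_ty[OF f compat_app[OF \<alpha> z]] by simp
  let ?\<Delta> = "?C # NatT # \<Gamma>"
  have wf2: "wf_ctx ?\<Delta>" by (rule wfI[OF is_tyI[OF C]])
  have f2: "?\<Delta> \<turnstile> f\<up>2 \<^bold>: arr (X\<up>2) (X\<up>2)" and a2: "?\<Delta> \<turnstile> a\<up>2 \<^bold>: arr NatT (X\<up>2)"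
    and I2: "?\<Delta> \<turnstile> I\<up>2 \<^bold>: preidem_type (X\<up>2) (f\<up>2)" and \<alpha>2: "?\<Delta> \<turnstile> \<alpha>\<up>2 \<^bold>: compat (X\<up>2) (f\<up>2) (a\<up>2)"
    and v1: "?\<Delta> \<turnstile> Var 1 \<^bold>: NatT"
    and v0: "?\<Delta> \<turnstile> Var 0 \<^bold>: IdT (X\<up>2) (f\<up>2 \<bullet> (f\<up>2 \<bullet> (a\<up>2 \<bullet> Succ (Var 1)))) (f\<up>2 \<bullet> (a\<up>2 \<bullet> Zero))"
    by (rule weak2[OF wf2 f] weak2[OF wf2 a] weak2[OF wf2 I] weak2[OF wf2 \<alpha>] var_ty[OF wf2] | simp)+
  have cs: "?\<Delta> \<turnstile> path_concat (X\<up>2) (f\<up>2 \<bullet> (f\<up>2 \<bullet> (a\<up>2 \<bullet> Succ (Succ (Var 1))))) (f\<up>2 \<bullet> (f\<up>2 \<bullet> (a\<up>2 \<bullet> Succ (Var 1)))) (f\<up>2 \<bullet> (a\<up>2 \<bullet> Zero))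
             (path_concat (X\<up>2) (f\<up>2 \<bullet> (f\<up>2 \<bullet> (a\<up>2 \<bullet> Succ (Succ (Var 1))))) (f\<up>2 \<bullet> (a\<up>2 \<bullet> Succ (Var 1))) (f\<up>2 \<bullet> (f\<up>2 \<bullet> (a\<up>2 \<bullet> Succ (Var 1))))
                (ap (X\<up>2) (f\<up>2) (f\<up>2 \<bullet> (a\<up>2 \<bullet> Succ (Succ (Var 1)))) (a\<up>2 \<bullet> Succ (Var 1)) (\<alpha>\<up>2 \<bullet> Succ (Var 1)))
                (path_inv (X\<up>2) (f\<up>2 \<bullet> (f\<up>2 \<bullet> (a\<up>2 \<bullet> Succ (Var 1)))) (f\<up>2 \<bullet> (a\<up>2 \<bullet> Succ (Var 1))) (I\<up>2 \<bullet> (a\<up>2 \<bullet> Succ (Var 1)))))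
             (Var 0) \<^bold>: subst (Succ (Var 1) \<rhd> (\<lambda>n. Var (n + 2))) ?C"
  proof -
    have "subst (Succ (Var 1) \<rhd> (\<lambda>n. Var (n + 2))) ?C =
        IdT (X\<up>2) (f\<up>2 \<bullet> (f\<up>2 \<bullet> (a\<up>2 \<bullet> Succ (Succ (Var 1))))) (f\<up>2 \<bullet> (a\<up>2 \<bullet> Zero))" by simp
    then show ?thesis
      by (simp only:) (rule path_concat_ty path_inv_ty ap_ty[OF f2] preidem_app[OF I2] compat_app[OF \<alpha>2] v0 arr_app[OF a2] nat_succ v1)+
  qed
  show "\<Gamma> \<turnstile> xi2_rec X f I a \<alpha> m \<^bold>: IdT X (f \<bullet> (f \<bullet> (a \<bullet> Succ m))) (f \<bullet> (a \<bullet> Zero))" if "\<Gamma> \<turnstile> m \<^bold>: NatT"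
    using nat_elim[OF C c0 cs that] by (simp add: xi2_rec_def Let_def)
  show "\<Gamma> \<turnstile> xi2_rec X f I a \<alpha> Zero \<doteq> ap X f (f \<bullet> (a \<bullet> Succ Zero)) (a \<bullet> Zero) (\<alpha> \<bullet> Zero)
      \<^bold>: IdT X (f \<bullet> (f \<bullet> (a \<bullet> Succ Zero))) (f \<bullet> (a \<bullet> Zero))"
    using nat_comp_zero[OF C c0 cs] by (simp add: xi2_rec_def Let_def)
qed

lemma rs_seq_eq: "rs_seq f a = const_seq f (a \<bullet> Zero)" and rs_path_eq: "rs_path I a = const_seq I (a \<bullet> Zero)"
  by (simp_all add: rs_seq_def rs_path_def const_seq_def)

lemma xi2_body_ty:
  assumes X: "\<Gamma> \<turnstile> X \<^bold>: Univ i" and f: "\<Gamma> \<turnstile> f \<^bold>: arr X X" and I: "\<Gamma> \<turnstile> I \<^bold>: preidem_type X f"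
    and a: "\<Gamma> \<turnstile> a \<^bold>: arr NatT X" and \<alpha>: "\<Gamma> \<turnstile> \<alpha> \<^bold>: compat X f a"
  shows "NatT # \<Gamma> \<turnstile> xi2_rec (X\<up>1) (f\<up>1) (I\<up>1) (a\<up>1) (\<alpha>\<up>1) (Var 0) \<^bold>:
    IdT (X\<up>1) (f\<up>1 \<bullet> (f\<up>1 \<bullet> (a\<up>1 \<bullet> Succ (Var 0)))) (f\<up>1 \<bullet> (a\<up>1 \<bullet> Zero))"
proof -
  have wf: "wf_ctx (NatT # \<Gamma>)" by (rule wf_Nat[OF wf_of_jdg(1)[OF f]])
  show ?thesis
    by (rule xi2_rec_ty X_level[OF X] weak1[OF wf f] weak1[OF wf I] weak1[OF wf a] weak1[OF wf \<alpha>] nat_var0[OF wf] | simp)+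
qed

lemma xi2_ty:
  assumes X: "\<Gamma> \<turnstile> X \<^bold>: Univ i" and f: "\<Gamma> \<turnstile> f \<^bold>: arr X X" and I: "\<Gamma> \<turnstile> I \<^bold>: preidem_type X f"
    and a: "\<Gamma> \<turnstile> a \<^bold>: arr NatT X" and \<alpha>: "\<Gamma> \<turnstile> \<alpha> \<^bold>: compat X f a"
  shows "\<Gamma> \<turnstile> xi2 X f I a \<alpha> \<^bold>: seq_htpy X (b_seq f a) (rs_seq f a)"
proof -
  have wf: "wf_ctx (NatT # \<Gamma>)" by (rule wf_Nat[OF wf_of_jdg(1)[OF f]])
  note b = xi2_body_ty[OF assms]
  have f1: "NatT # \<Gamma> \<turnstile> f\<up>1 \<^bold>: arr (X\<up>1) (X\<up>1)" and a1: "NatT # \<Gamma> \<turnstile> a\<up>1 \<^bold>: arr NatT (X\<up>1)"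
    by (rule weak1[OF wf f] weak1[OF wf a], simp)+
  note n = nat_var0[OF wf]
  have "ty_eq (NatT # \<Gamma>) (IdT (X\<up>1) (f\<up>1 \<bullet> (f\<up>1 \<bullet> (a\<up>1 \<bullet> Succ (Var 0)))) (f\<up>1 \<bullet> (a\<up>1 \<bullet> Zero)))
      (IdT (X\<up>1) (b_seq (f\<up>1) (a\<up>1) \<bullet> Var 0) (const_seq (f\<up>1) (a\<up>1 \<bullet> Zero) \<bullet> Var 0))"
    by (rule ty_eq_Id ty_eq_refl id_inv(1)[OF b] eq_sym[OF b_seq_app[OF f1 a1 n]] eq_sym[OF const_seq_app[OF f1 _ n]]
        arr_app[OF a1] nat_zero[OF wf])+
  from conv_ty[OF b this] show ?thesis unfolding xi2_eq seq_htpy_def rs_seq_eq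
    by (intro pi_intro) simp
qed

text \<open>Index 0 is the one that \<open>s\<close> reads off, and there the recursion returns its
  base value.\<close>

lemma xi2_zero:
  assumes X: "\<Gamma> \<turnstile> X \<^bold>: Univ i" and f: "\<Gamma> \<turnstile> f \<^bold>: arr X X" and I: "\<Gamma> \<turnstile> I \<^bold>: preidem_type X f"
    and a: "\<Gamma> \<turnstile> a \<^bold>: arr NatT X" and \<alpha>: "\<Gamma> \<turnstile> \<alpha> \<^bold>: compat X f a"
  shows "\<Gamma> \<turnstile> xi2 X f I a \<alpha> \<bullet> Zero \<doteq> ap X f (f \<bullet> (a \<bullet> Succ Zero)) (a \<bullet> Zero) (\<alpha> \<bullet> Zero)
    \<^bold>: IdT X (f \<bullet> (f \<bullet> (a \<bullet> Succ Zero))) (f \<bullet> (a \<bullet> Zero))"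
proof -
  have z: "\<Gamma> \<turnstile> Zero \<^bold>: NatT" by (rule nat_zero[OF wf_of_jdg(1)[OF f]])
  have "\<Gamma> \<turnstile> xi2 X f I a \<alpha> \<bullet> Zero \<doteq> xi2_rec X f I a \<alpha> Zero \<^bold>: IdT X (f \<bullet> (f \<bullet> (a \<bullet> Succ Zero))) (f \<bullet> (a \<bullet> Zero))"
    unfolding xi2_eq by (rule pi_beta[OF xi2_body_ty[OF assms] z]) simp_all
  then show ?thesis by (rule eq_trans[OF _ xi2_rec_ty(2)[OF assms]])
qed

lemma rs_seq_subst [simp]: "subst \<sigma> (rs_seq f a) = rs_seq (subst \<sigma> f) (subst \<sigma> a)"
  and rs_path_subst [simp]: "subst \<sigma> (rs_path I a) = rs_path (subst \<sigma> I) (subst \<sigma> a)"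
  by (simp_all add: rs_seq_eq rs_path_eq)

lemma split_path_subst [simp]: "subst \<sigma> (split_path fe X f a \<alpha> c \<gamma> \<xi> \<theta>) =
    split_path (subst \<sigma> fe) (subst \<sigma> X) (subst \<sigma> f) (subst \<sigma> a) (subst \<sigma> \<alpha>) (subst \<sigma> c) (subst \<sigma> \<gamma>)
      (subst \<sigma> \<xi>) (subst \<sigma> \<theta>)"
  by (simp add: split_path_def Let_def)

lemma path1_subst [simp]: "subst \<sigma> (path1 fe X f I c1 a \<alpha>) =
    path1 (subst \<sigma> fe) (subst \<sigma> X) (subst \<sigma> f) (subst \<sigma> I) (subst \<sigma> c1) (subst \<sigma> a) (subst \<sigma> \<alpha>)"
  by (simp add: path1_def)

lemma path2_subst [simp]: "subst \<sigma> (path2 fe X f I c2 a \<alpha>) =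
    path2 (subst \<sigma> fe) (subst \<sigma> X) (subst \<sigma> f) (subst \<sigma> I) (subst \<sigma> c2) (subst \<sigma> a) (subst \<sigma> \<alpha>)"
  by (simp add: path2_def)

lemma comm1_type_subst [simp]: "subst \<sigma> (comm1_type X f I) = comm1_type (subst \<sigma> X) (subst \<sigma> f) (subst \<sigma> I)"
  by (simp add: comm1_type_def Let_def)

lemma comm2_type_subst [simp]: "subst \<sigma> (comm2_type X f I) = comm2_type (subst \<sigma> X) (subst \<sigma> f) (subst \<sigma> I)"
  by (simp add: comm2_type_def Let_def)

lemma coherence_type_subst [simp]:
  "subst \<sigma> (coherence_type X f I) = coherence_type (subst \<sigma> X) (subst \<sigma> f) (subst \<sigma> I)"
  by (simp add: coherence_type_def)

lemma hypotheses_weaken [simp]: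
  "comm1_type X f I \<up> k = comm1_type (X\<up>k) (f\<up>k) (I\<up>k)"
  "comm2_type X f I \<up> k = comm2_type (X\<up>k) (f\<up>k) (I\<up>k)"
  "coherence_type X f I \<up> k = coherence_type (X\<up>k) (f\<up>k) (I\<up>k)"
  "path1 fe X f I c1 a \<alpha> \<up> k = path1 (fe\<up>k) (X\<up>k) (f\<up>k) (I\<up>k) (c1\<up>k) (a\<up>k) (\<alpha>\<up>k)"
  "path2 fe X f I c1 a \<alpha> \<up> k = path2 (fe\<up>k) (X\<up>k) (f\<up>k) (I\<up>k) (c1\<up>k) (a\<up>k) (\<alpha>\<up>k)"
  "beta_seq X f a \<alpha> \<up> k = beta_seq (X\<up>k) (f\<up>k) (a\<up>k) (\<alpha>\<up>k)"
  unfolding weaken_eq_subst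
  by (rule comm1_type_subst comm2_type_subst coherence_type_subst path1_subst path2_subst beta_seq_subst)+

lemma comm1_app:
  assumes c1: "\<Gamma> \<turnstile> c1 \<^bold>: comm1_type X f I"
    and a: "\<Gamma> \<turnstile> a \<^bold>: arr NatT X" and \<alpha>: "\<Gamma> \<turnstile> \<alpha> \<^bold>: compat X f a"
  shows "\<Gamma> \<turnstile> c1 \<bullet> a \<bullet> \<alpha> \<^bold>: comm_type X f (b_seq f a) (beta_seq X f a \<alpha>) a \<alpha> (xi1 X f I a \<alpha>)"
  by (rule pi_app[OF pi_app[OF c1[unfolded comm1_type_def Let_def] a refl, simplified] \<alpha>]) simp

lemma comm2_app:
  assumes c2: "\<Gamma> \<turnstile> c2 \<^bold>: comm2_type X f I"
    and a: "\<Gamma> \<turnstile> a \<^bold>: arr NatT X" and \<alpha>: "\<Gamma> \<turnstile> \<alpha> \<^bold>: compat X f a"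
  shows "\<Gamma> \<turnstile> c2 \<bullet> a \<bullet> \<alpha> \<^bold>: comm_type X f (b_seq f a) (beta_seq X f a \<alpha>) (rs_seq f a) (rs_path I a) (xi2 X f I a \<alpha>)"
  by (rule pi_app[OF pi_app[OF c2[unfolded comm2_type_def Let_def] a refl, simplified] \<alpha>]) simp

lemma rs_ty:
  assumes f: "\<Gamma> \<turnstile> f \<^bold>: arr X X" and I: "\<Gamma> \<turnstile> I \<^bold>: preidem_type X f" and a: "\<Gamma> \<turnstile> a \<^bold>: arr NatT X"
  shows "\<Gamma> \<turnstile> rs_seq f a \<^bold>: arr NatT X" "\<Gamma> \<turnstile> rs_path I a \<^bold>: compat X f (rs_seq f a)"
  unfolding rs_seq_eq rs_path_eq
  by (rule const_seq_ty[OF f] const_path_ty[OF f I] arr_app[OF a] nat_zero wf_of_jdg(1)[OF f])+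

lemma path1:
  assumes fe: "\<Gamma> \<turnstile> fe \<^bold>: FunExt i" and X: "\<Gamma> \<turnstile> X \<^bold>: Univ i" and f: "\<Gamma> \<turnstile> f \<^bold>: arr X X"
    and I: "\<Gamma> \<turnstile> I \<^bold>: preidem_type X f" and c1: "\<Gamma> \<turnstile> c1 \<^bold>: comm1_type X f I"
    and a: "\<Gamma> \<turnstile> a \<^bold>: arr NatT X" and \<alpha>: "\<Gamma> \<turnstile> \<alpha> \<^bold>: compat X f a"
  shows path1_ty: "\<Gamma> \<turnstile> path1 fe X f I c1 a \<alpha> \<^bold>:
      IdT (split_type X f) (Pair (b_seq f a) (beta_seq X f a \<alpha>)) (Pair a \<alpha>)"
    and ap_section_path1: "inh \<Gamma> (IdT (IdT X (b_seq f a \<bullet> Zero) (a \<bullet> Zero))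
      (ap X (section_map X f) (Pair (b_seq f a) (beta_seq X f a \<alpha>)) (Pair a \<alpha>) (path1 fe X f I c1 a \<alpha>))
      (xi1 X f I a \<alpha> \<bullet> Zero))"
  unfolding path1_def
  by (rule split_path_ty[OF fe X f] ap_section_split_path[OF fe X f] b_seq_ty[OF f] beta_seq_ty[OF f]
      xi1_ty[OF f I] comm1_app[OF c1] a \<alpha>)+

lemma path2:
  assumes fe: "\<Gamma> \<turnstile> fe \<^bold>: FunExt i" and X: "\<Gamma> \<turnstile> X \<^bold>: Univ i" and f: "\<Gamma> \<turnstile> f \<^bold>: arr X X"
    and I: "\<Gamma> \<turnstile> I \<^bold>: preidem_type X f" and c2: "\<Gamma> \<turnstile> c2 \<^bold>: comm2_type X f I"
    and a: "\<Gamma> \<turnstile> a \<^bold>: arr NatT X" and \<alpha>: "\<Gamma> \<turnstile> \<alpha> \<^bold>: compat X f a"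
  shows path2_ty: "\<Gamma> \<turnstile> path2 fe X f I c2 a \<alpha> \<^bold>:
      IdT (split_type X f) (Pair (b_seq f a) (beta_seq X f a \<alpha>)) (Pair (rs_seq f a) (rs_path I a))"
    and ap_section_path2: "inh \<Gamma> (IdT (IdT X (b_seq f a \<bullet> Zero) (rs_seq f a \<bullet> Zero))
      (ap X (section_map X f) (Pair (b_seq f a) (beta_seq X f a \<alpha>)) (Pair (rs_seq f a) (rs_path I a))
        (path2 fe X f I c2 a \<alpha>))
      (xi2 X f I a \<alpha> \<bullet> Zero))"
  unfolding path2_def
  by (rule split_path_ty[OF fe X f] ap_section_split_path[OF fe X f] b_seq_ty[OF f] beta_seq_ty[OF f]
      xi2_ty[OF X f I] comm2_app[OF c2] rs_ty[OF f I] a \<alpha>)+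

section \<open>The homotopy\<close>

text \<open>\<open>split_path\<close> produces paths between explicit pairs, while the type of
  \<open>H\<close> mentions \<open>r (s (a, \<alpha>))\<close>; this computation reconciles the end
  points of \<open>p2\<close>.\<close>

lemma retraction_section_pair:
  assumes X: "\<Gamma> \<turnstile> X \<^bold>: Univ i" and f: "\<Gamma> \<turnstile> f \<^bold>: arr X X" and I: "\<Gamma> \<turnstile> I \<^bold>: preidem_type X f"
    and a: "\<Gamma> \<turnstile> a \<^bold>: arr NatT X" and \<alpha>: "\<Gamma> \<turnstile> \<alpha> \<^bold>: compat X f a"
  shows "\<Gamma> \<turnstile> retraction_map X f I \<bullet> (section_map X f \<bullet> Pair a \<alpha>) \<doteq> Pair (rs_seq f a) (rs_path I a) \<^bold>: split_type X f"
  unfolding rs_seq_eq rs_path_eq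
  by (rule eq_trans[OF arr_app_cong[OF eq_refl[OF retraction_ty[OF X f I]] section_pair[OF X f a \<alpha>]]]
      retraction_app[OF X f I] arr_app[OF a] nat_zero wf_of_jdg(1)[OF f])+

text \<open>The branch of the \<Sigma>-induction in \<open>split_htpy\<close>, with the components
  of the pair as parameters, so that its computation on a pair is a mere change of
  arguments.\<close>

definition htpy_body :: "tm \<Rightarrow> tm \<Rightarrow> tm \<Rightarrow> tm \<Rightarrow> tm \<Rightarrow> tm \<Rightarrow> tm \<Rightarrow> tm \<Rightarrow> tm" where
  "htpy_body fe X f I c1 c2 a \<alpha> =
     (let A = split_type X f; rs = retraction_map X f I \<bullet> (section_map X f \<bullet> Pair a \<alpha>);
          b = Pair (b_seq f a) (beta_seq X f a \<alpha>)
      in path_concat A rs b (Pair a \<alpha>) (path_inv A b rs (path2 fe X f I c2 a \<alpha>)) (path1 fe X f I c1 a \<alpha>))"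

lemma htpy_body_subst [simp]: "subst \<sigma> (htpy_body fe X f I c1 c2 a \<alpha>) =
    htpy_body (subst \<sigma> fe) (subst \<sigma> X) (subst \<sigma> f) (subst \<sigma> I) (subst \<sigma> c1) (subst \<sigma> c2) (subst \<sigma> a) (subst \<sigma> \<alpha>)"
  by (simp add: htpy_body_def Let_def)

definition htpy_app :: "tm \<Rightarrow> tm \<Rightarrow> tm \<Rightarrow> tm \<Rightarrow> tm \<Rightarrow> tm \<Rightarrow> tm \<Rightarrow> tm" where
  "htpy_app fe X f I c1 c2 u =
     Split (IdT (split_type (X\<up>1) (f\<up>1)) (retraction_map (X\<up>1) (f\<up>1) (I\<up>1) \<bullet> (section_map (X\<up>1) (f\<up>1) \<bullet> Var 0)) (Var 0))
       (htpy_body (fe\<up>2) (X\<up>2) (f\<up>2) (I\<up>2) (c1\<up>2) (c2\<up>2) (Var 1) (Var 0)) u"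

lemma htpy_app_subst [simp]: "subst \<sigma> (htpy_app fe X f I c1 c2 u) =
    htpy_app (subst \<sigma> fe) (subst \<sigma> X) (subst \<sigma> f) (subst \<sigma> I) (subst \<sigma> c1) (subst \<sigma> c2) (subst \<sigma> u)"
  by (simp add: htpy_app_def)

lemma split_htpy_eq: "split_htpy fe X f I c1 c2 =
    Lam (split_type X f) (htpy_app (fe\<up>1) (X\<up>1) (f\<up>1) (I\<up>1) (c1\<up>1) (c2\<up>1) (Var 0))"
  by (simp add: split_htpy_def htpy_app_def htpy_body_def Let_def)

lemma split_htpy_weaken [simp]:
  "split_htpy fe X f I c1 c2 \<up> k = split_htpy (fe\<up>k) (X\<up>k) (f\<up>k) (I\<up>k) (c1\<up>k) (c2\<up>k)"
  by (simp add: split_htpy_eq)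

lemma htpy_body_ty:
  assumes fe: "\<Gamma> \<turnstile> fe \<^bold>: FunExt i" and X: "\<Gamma> \<turnstile> X \<^bold>: Univ i" and f: "\<Gamma> \<turnstile> f \<^bold>: arr X X"
    and I: "\<Gamma> \<turnstile> I \<^bold>: preidem_type X f"
    and c1: "\<Gamma> \<turnstile> c1 \<^bold>: comm1_type X f I" and c2: "\<Gamma> \<turnstile> c2 \<^bold>: comm2_type X f I"
    and a: "\<Gamma> \<turnstile> a \<^bold>: arr NatT X" and \<alpha>: "\<Gamma> \<turnstile> \<alpha> \<^bold>: compat X f a"
  shows "\<Gamma> \<turnstile> path2 fe X f I c2 a \<alpha> \<^bold>: IdT (split_type X f) (Pair (b_seq f a) (beta_seq X f a \<alpha>))
      (retraction_map X f I \<bullet> (section_map X f \<bullet> Pair a \<alpha>))"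
    and "\<Gamma> \<turnstile> htpy_body fe X f I c1 c2 a \<alpha> \<^bold>: IdT (split_type X f)
      (retraction_map X f I \<bullet> (section_map X f \<bullet> Pair a \<alpha>)) (Pair a \<alpha>)"
proof -
  note p2 = path2_ty[OF fe X f I c2 a \<alpha>]
  show p2': "\<Gamma> \<turnstile> path2 fe X f I c2 a \<alpha> \<^bold>: IdT (split_type X f) (Pair (b_seq f a) (beta_seq X f a \<alpha>))
      (retraction_map X f I \<bullet> (section_map X f \<bullet> Pair a \<alpha>))"
    by (rule conv_ty[OF p2] ty_eq_Id ty_eq_refl id_inv[OF p2] eq_refl eq_sym[OF retraction_section_pair[OF X f I a \<alpha>]])+
  show "\<Gamma> \<turnstile> htpy_body fe X f I c1 c2 a \<alpha> \<^bold>: IdT (split_type X f)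
      (retraction_map X f I \<bullet> (section_map X f \<bullet> Pair a \<alpha>)) (Pair a \<alpha>)"
    unfolding htpy_body_def Let_def
    by (rule path_concat_ty[OF path_inv_ty[OF p2'] path1_ty[OF fe X f I c1 a \<alpha>]])
qed

text \<open>For the computation \<open>u\<close> need only be judgementally a pair: the case of
  interest is \<open>r x\<close>, an application that reduces to one. The result is stated at the
  type that mentions \<open>u\<close> itself, as the conclusion about \<open>H (r x)\<close>
  requires.\<close>

lemma htpy_app:
  assumes fe: "\<Gamma> \<turnstile> fe \<^bold>: FunExt i" and X: "\<Gamma> \<turnstile> X \<^bold>: Univ i" and f: "\<Gamma> \<turnstile> f \<^bold>: arr X X"
    and I: "\<Gamma> \<turnstile> I \<^bold>: preidem_type X f"
    and c1: "\<Gamma> \<turnstile> c1 \<^bold>: comm1_type X f I" and c2: "\<Gamma> \<turnstile> c2 \<^bold>: comm2_type X f I"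
  shows htpy_app_ty: "\<Gamma> \<turnstile> u \<^bold>: split_type X f \<Longrightarrow> \<Gamma> \<turnstile> htpy_app fe X f I c1 c2 u \<^bold>:
      IdT (split_type X f) (retraction_map X f I \<bullet> (section_map X f \<bullet> u)) u"
    and htpy_app_pair: "\<Gamma> \<turnstile> u \<doteq> Pair a \<alpha> \<^bold>: split_type X f \<Longrightarrow> \<Gamma> \<turnstile> a \<^bold>: arr NatT X \<Longrightarrow> \<Gamma> \<turnstile> \<alpha> \<^bold>: compat X f a \<Longrightarrow>
      \<Gamma> \<turnstile> htpy_app fe X f I c1 c2 u \<doteq> htpy_body fe X f I c1 c2 a \<alpha> \<^bold>:
        IdT (split_type X f) (retraction_map X f I \<bullet> (section_map X f \<bullet> u)) u"
proof -
  let ?A = "split_type X f"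
  let ?C = "IdT (split_type (X\<up>1) (f\<up>1)) (retraction_map (X\<up>1) (f\<up>1) (I\<up>1) \<bullet> (section_map (X\<up>1) (f\<up>1) \<bullet> Var 0)) (Var 0)"
  let ?g = "htpy_body (fe\<up>2) (X\<up>2) (f\<up>2) (I\<up>2) (c1\<up>2) (c2\<up>2) (Var 1) (Var 0)"
  let ?\<Delta> = "compat (X\<up>1) (f\<up>1) (Var 0) # arr NatT X # \<Gamma>"
  have w1: "wf_ctx (?A # \<Gamma>)" by (rule wfI[OF is_ty_split[OF X f]])
  have X1: "?A # \<Gamma> \<turnstile> X\<up>1 \<^bold>: Univ i" and f1: "?A # \<Gamma> \<turnstile> f\<up>1 \<^bold>: arr (X\<up>1) (X\<up>1)"
    and I1: "?A # \<Gamma> \<turnstile> I\<up>1 \<^bold>: preidem_type (X\<up>1) (f\<up>1)"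
    by (rule weak1[OF w1 X] weak1[OF w1 f] weak1[OF w1 I], simp)+
  have v: "?A # \<Gamma> \<turnstile> Var 0 \<^bold>: split_type (X\<up>1) (f\<up>1)" by (rule var_ty[OF w1]) simp_all
  have "is_ty (?A # \<Gamma>) ?C"
    by (rule is_ty_Id is_ty_split[OF X1 f1] arr_app[OF retraction_ty[OF X1 f1 I1]] arr_app[OF section_ty[OF X1 f1]] v)+
  then obtain j where C: "SigT (arr NatT X) (compat (X\<up>1) (f\<up>1) (Var 0)) # \<Gamma> \<turnstile> ?C \<^bold>: Univ j"
    unfolding split_type_def[of X f] by (auto simp: is_ty_def)
  have w2: "wf_ctx ?\<Delta>" by (rule wfI is_tyI split_family X f)+
  have "?\<Delta> \<turnstile> ?g \<^bold>: IdT (split_type (X\<up>2) (f\<up>2))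
      (retraction_map (X\<up>2) (f\<up>2) (I\<up>2) \<bullet> (section_map (X\<up>2) (f\<up>2) \<bullet> Pair (Var 1) (Var 0))) (Pair (Var 1) (Var 0))"
    by (rule htpy_body_ty weak2[OF w2 fe] weak2[OF w2 X] weak2[OF w2 f] weak2[OF w2 I] weak2[OF w2 c1] weak2[OF w2 c2]
        var_ty[OF w2] | simp)+
  then have g: "?\<Delta> \<turnstile> ?g \<^bold>: subst (Pair (Var 1) (Var 0) \<rhd> (\<lambda>n. Var (n + 2))) ?C" by simp
  show "\<Gamma> \<turnstile> htpy_app fe X f I c1 c2 u \<^bold>: IdT ?A (retraction_map X f I \<bullet> (section_map X f \<bullet> u)) u" if "\<Gamma> \<turnstile> u \<^bold>: ?A"
    using sig_elim[OF C g that[unfolded split_type_def]] by (simp add: htpy_app_def)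
  assume u: "\<Gamma> \<turnstile> u \<doteq> Pair a \<alpha> \<^bold>: ?A" and a: "\<Gamma> \<turnstile> a \<^bold>: arr NatT X" and \<alpha>: "\<Gamma> \<turnstile> \<alpha> \<^bold>: compat X f a"
  have e: "\<Gamma> \<turnstile> htpy_app fe X f I c1 c2 u \<doteq> htpy_app fe X f I c1 c2 (Pair a \<alpha>) \<^bold>:
      IdT ?A (retraction_map X f I \<bullet> (section_map X f \<bullet> u)) u"
    using sig_elim_cong[OF eq_refl[OF C] eq_refl[OF g] u[unfolded split_type_def]] by (simp add: htpy_app_def)
  have "\<Gamma> \<turnstile> htpy_app fe X f I c1 c2 (Pair a \<alpha>) \<doteq> htpy_body fe X f I c1 c2 a \<alpha> \<^bold>:
      IdT ?A (retraction_map X f I \<bullet> (section_map X f \<bullet> Pair a \<alpha>)) (Pair a \<alpha>)"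
    using sig_comp[OF C g a, of \<alpha>] \<alpha> by (simp add: htpy_app_def)
  moreover have "ty_eq \<Gamma> (IdT ?A (retraction_map X f I \<bullet> (section_map X f \<bullet> Pair a \<alpha>)) (Pair a \<alpha>))
      (IdT ?A (retraction_map X f I \<bullet> (section_map X f \<bullet> u)) u)"
    by (rule ty_eq_Id ty_eq_refl is_ty_split[OF X f] arr_app_cong[OF eq_refl[OF retraction_ty[OF X f I]]]
        arr_app_cong[OF eq_refl[OF section_ty[OF X f]]] eq_sym[OF u])+
  ultimately show "\<Gamma> \<turnstile> htpy_app fe X f I c1 c2 u \<doteq> htpy_body fe X f I c1 c2 a \<alpha> \<^bold>:
      IdT ?A (retraction_map X f I \<bullet> (section_map X f \<bullet> u)) u"
    by (blast intro: eq_trans[OF e] eq_conv_ty)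
qed

lemma split_htpy_app:
  assumes fe: "\<Gamma> \<turnstile> fe \<^bold>: FunExt i" and X: "\<Gamma> \<turnstile> X \<^bold>: Univ i" and f: "\<Gamma> \<turnstile> f \<^bold>: arr X X"
    and I: "\<Gamma> \<turnstile> I \<^bold>: preidem_type X f"
    and c1: "\<Gamma> \<turnstile> c1 \<^bold>: comm1_type X f I" and c2: "\<Gamma> \<turnstile> c2 \<^bold>: comm2_type X f I"
    and u: "\<Gamma> \<turnstile> u \<doteq> Pair a \<alpha> \<^bold>: split_type X f" and a: "\<Gamma> \<turnstile> a \<^bold>: arr NatT X" and \<alpha>: "\<Gamma> \<turnstile> \<alpha> \<^bold>: compat X f a"
  shows "\<Gamma> \<turnstile> split_htpy fe X f I c1 c2 \<bullet> u \<doteq> htpy_body fe X f I c1 c2 a \<alpha> \<^bold>: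
        IdT (split_type X f) (retraction_map X f I \<bullet> (section_map X f \<bullet> u)) u"
proof -
  let ?A = "split_type X f"
  have w1: "wf_ctx (?A # \<Gamma>)" by (rule wfI[OF is_ty_split[OF X f]])
  have "?A # \<Gamma> \<turnstile> htpy_app (fe\<up>1) (X\<up>1) (f\<up>1) (I\<up>1) (c1\<up>1) (c2\<up>1) (Var 0) \<^bold>: IdT (split_type (X\<up>1) (f\<up>1))
      (retraction_map (X\<up>1) (f\<up>1) (I\<up>1) \<bullet> (section_map (X\<up>1) (f\<up>1) \<bullet> Var 0)) (Var 0)"
    by (rule htpy_app_ty weak1[OF w1 fe] weak1[OF w1 X] weak1[OF w1 f] weak1[OF w1 I] weak1[OF w1 c1] weak1[OF w1 c2]
        var_ty[OF w1] | simp)+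
  from pi_beta[OF this eq_left[OF u] refl refl]
  have "\<Gamma> \<turnstile> split_htpy fe X f I c1 c2 \<bullet> u \<doteq> htpy_app fe X f I c1 c2 u \<^bold>:
      IdT ?A (retraction_map X f I \<bullet> (section_map X f \<bullet> u)) u"
    by (simp add: split_htpy_eq)
  then show ?thesis by (rule eq_trans[OF _ htpy_app_pair[OF fe X f I c1 c2 u a \<alpha>]])
qed

section \<open>Cancellation\<close>

text \<open>
  Path induction on \<open>p2\<close>, with \<open>p1\<close>, \<open>w\<close> and the hypothesis generalised: if \<open>p2\<close> is
  reflexivity, the hypothesis and the conclusion are judgementally equal.
\<close>

lemma ap_inv_concat:
  assumes s: "\<Gamma> \<turnstile> s \<^bold>: arr A B" and p2: "\<Gamma> \<turnstile> p2 \<^bold>: IdT A b y" and p1: "\<Gamma> \<turnstile> p1 \<^bold>: IdT A b z"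
    and w: "\<Gamma> \<turnstile> w \<^bold>: IdT B (s \<bullet> y) (s \<bullet> z)"
    and hyp: "inh \<Gamma> (IdT (IdT B (s \<bullet> b) (s \<bullet> z)) (ap B s b z p1)
      (path_concat B (s \<bullet> b) (s \<bullet> y) (s \<bullet> z) (ap B s b y p2) w))"
  shows "inh \<Gamma> (IdT (IdT B (s \<bullet> y) (s \<bullet> z)) (ap B s y z (path_concat A y b z (path_inv A b y p2) p1)) w)"
proof -
  \<comment> \<open>All data are meta-level parameters, so that the motive, the reflexivity case and
    the final instance are the same expressions at different weakenings.\<close>
  let ?W = "\<lambda>B s y z. IdT B (s \<bullet> y) (s \<bullet> z)"
  let ?H = "\<lambda>A B s z b y p2 p1 w. IdT (IdT B (s \<bullet> b) (s \<bullet> z)) (ap B s b z p1)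
      (path_concat B (s \<bullet> b) (s \<bullet> y) (s \<bullet> z) (ap B s b y p2) w)"
  let ?G = "\<lambda>A B s z b y p2 p1 w. IdT (IdT B (s \<bullet> y) (s \<bullet> z)) (ap B s y z (path_concat A y b z (path_inv A b y p2) p1)) w"
  let ?C = "PiT (IdT (A\<up>3) (Var 2) (z\<up>3)) (PiT (?W (B\<up>4) (s\<up>4) (Var 2) (z\<up>4))
    (PiT (?H (A\<up>5) (B\<up>5) (s\<up>5) (z\<up>5) (Var 4) (Var 3) (Var 2) (Var 1) (Var 0))
      (?G (A\<up>6) (B\<up>6) (s\<up>6) (z\<up>6) (Var 5) (Var 4) (Var 3) (Var 2) (Var 1))))"
  note A = id_inv(1)[OF p1] and z = id_inv(3)[OF p1]
  have B: "is_ty \<Gamma> B" by (rule arr_inv_cod[OF s z])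
  have W: "is_ty \<Gamma> (?W B s y z)" if "\<Gamma> \<turnstile> s \<^bold>: arr A B" "\<Gamma> \<turnstile> y \<^bold>: A" "\<Gamma> \<turnstile> z \<^bold>: A" for \<Gamma> A B s y z
    by (rule is_ty_Id arr_inv_cod that arr_app[OF that(1)])+
  have H: "is_ty \<Gamma> (?H A B s z b y p2 p1 w)"
    if "\<Gamma> \<turnstile> s \<^bold>: arr A B" "\<Gamma> \<turnstile> p2 \<^bold>: IdT A b y" "\<Gamma> \<turnstile> p1 \<^bold>: IdT A b z" "\<Gamma> \<turnstile> w \<^bold>: ?W B s y z" for \<Gamma> A B s z b y p2 p1 w
    by (rule is_ty_Id W that(1) id_inv[OF that(3)] ap_ty[OF that(1)] path_concat_ty that)+
  have G: "is_ty \<Gamma> (?G A B s z b y p2 p1 w)"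
    if "\<Gamma> \<turnstile> s \<^bold>: arr A B" "\<Gamma> \<turnstile> p2 \<^bold>: IdT A b y" "\<Gamma> \<turnstile> p1 \<^bold>: IdT A b z" "\<Gamma> \<turnstile> w \<^bold>: ?W B s y z" for \<Gamma> A B s z b y p2 p1 w
    by (rule is_ty_Id W that(1) id_inv(3)[OF that(3)] id_inv(3)[OF that(2)] ap_ty[OF that(1)] path_concat_ty path_inv_ty that)+
  \<comment> \<open>With \<open>p2\<close> reflexivity, its inverse and its image under
    \<open>s\<close> compute to reflexivity, and concatenation on the left with reflexivity
    disappears. Both types then relate \<open>ap s p1\<close> to \<open>w\<close>.\<close>
  have HG: "ty_eq \<Gamma> (?H A B s z b b (Refl b) p1 w) (?G A B s z b b (Refl b) p1 w)"
    if s: "\<Gamma> \<turnstile> s \<^bold>: arr A B" and p1: "\<Gamma> \<turnstile> p1 \<^bold>: IdT A b z" and w: "\<Gamma> \<turnstile> w \<^bold>: ?W B s b z" for \<Gamma> A B s z b p1 w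
  proof -
    note b = id_inv(2)[OF p1] and z = id_inv(3)[OF p1]
    note sb = eq_refl[OF arr_app[OF s b]] and sz = eq_refl[OF arr_app[OF s z]]
    have 1: "\<Gamma> \<turnstile> path_concat A b b z (path_inv A b b (Refl b)) p1 \<doteq> p1 \<^bold>: IdT A b z"
      by (rule eq_trans[OF path_concat_cong[OF eq_refl[OF b] eq_refl[OF b] eq_refl[OF z] path_inv_refl[OF b] eq_refl[OF p1]]
            path_concat_refl[OF p1]])
    have 2: "\<Gamma> \<turnstile> path_concat B (s \<bullet> b) (s \<bullet> b) (s \<bullet> z) (ap B s b b (Refl b)) w \<doteq> w \<^bold>: ?W B s b z"
      by (rule eq_trans[OF path_concat_cong[OF sb sb sz ap_refl[OF s b] eq_refl[OF w]] path_concat_refl[OF w]])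
    show ?thesis
      by (rule ty_eq_Id[OF ty_eq_refl[OF has_is_ty[OF w]] eq_sym[OF ap_cong[OF s eq_refl[OF b] eq_refl[OF z] 1]] 2])
  qed
  have m: "is_ty (id_ctx A \<Gamma>) ?C"
  proof -
    let ?\<Gamma>3 = "id_ctx A \<Gamma>"
    let ?\<Gamma>4 = "IdT (A\<up>3) (Var 2) (z\<up>3) # ?\<Gamma>3"
    let ?\<Gamma>5 = "?W (B\<up>4) (s\<up>4) (Var 2) (z\<up>4) # ?\<Gamma>4"
    let ?\<Gamma>6 = "?H (A\<up>5) (B\<up>5) (s\<up>5) (z\<up>5) (Var 4) (Var 3) (Var 2) (Var 1) (Var 0) # ?\<Gamma>5"
    have w3: "wf_ctx ?\<Gamma>3" by (rule wf_id_ctx[OF A])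
    have w4: "wf_ctx ?\<Gamma>4" by (rule wfI is_ty_Id is_ty_weak3[OF w3 A] weak3[OF w3 z] var_ty[OF w3] | simp)+
    have w5: "wf_ctx ?\<Gamma>5"
      by (rule wfI W[OF weak4[OF w4 s, of "arr (A\<up>4) (B\<up>4)"]] weak4[OF w4 z] var_ty[OF w4] | simp)+
    have w6: "wf_ctx ?\<Gamma>6"
      by (rule wfI H[OF weak5[OF w5 s, of "arr (A\<up>5) (B\<up>5)"]] var_ty[OF w5] | simp)+
    show ?thesis
      by (rule is_ty_Pi G[OF weak6[OF w6 s, of "arr (A\<up>6) (B\<up>6)"]] var_ty[OF w6] | simp)+
  qed
  have base: "inh (A # \<Gamma>) (PiT (IdT (A\<up>1) (Var 0) (z\<up>1)) (PiT (?W (B\<up>2) (s\<up>2) (Var 1) (z\<up>2))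
    (PiT (?H (A\<up>3) (B\<up>3) (s\<up>3) (z\<up>3) (Var 2) (Var 2) (Refl (Var 2)) (Var 1) (Var 0))
      (?G (A\<up>4) (B\<up>4) (s\<up>4) (z\<up>4) (Var 3) (Var 3) (Refl (Var 3)) (Var 2) (Var 1)))))"
  proof -
    let ?\<Gamma>1 = "A # \<Gamma>"
    let ?\<Gamma>2 = "IdT (A\<up>1) (Var 0) (z\<up>1) # ?\<Gamma>1"
    let ?\<Gamma>3 = "?W (B\<up>2) (s\<up>2) (Var 1) (z\<up>2) # ?\<Gamma>2"
    let ?\<Gamma>4 = "?H (A\<up>3) (B\<up>3) (s\<up>3) (z\<up>3) (Var 2) (Var 2) (Refl (Var 2)) (Var 1) (Var 0) # ?\<Gamma>3"
    have w1: "wf_ctx ?\<Gamma>1" by (rule wfI[OF A])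
    have w2: "wf_ctx ?\<Gamma>2" by (rule wfI is_ty_Id is_ty_weak1[OF w1 A] weak1[OF w1 z] var_ty[OF w1] | simp)+
    have w3: "wf_ctx ?\<Gamma>3"
      by (rule wfI W[OF weak2[OF w2 s, of "arr (A\<up>2) (B\<up>2)"]] weak2[OF w2 z] var_ty[OF w2] | simp)+
    have w4: "wf_ctx ?\<Gamma>4"
      by (rule wfI H[OF weak3[OF w3 s, of "arr (A\<up>3) (B\<up>3)"]] refl_ty var_ty[OF w3] | simp)+
    have "?\<Gamma>4 \<turnstile> Var 0 \<^bold>: ?H (A\<up>4) (B\<up>4) (s\<up>4) (z\<up>4) (Var 3) (Var 3) (Refl (Var 3)) (Var 2) (Var 1)"
      by (rule var_ty[OF w4]) simp_all
    moreover have "ty_eq ?\<Gamma>4 (?H (A\<up>4) (B\<up>4) (s\<up>4) (z\<up>4) (Var 3) (Var 3) (Refl (Var 3)) (Var 2) (Var 1))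
        (?G (A\<up>4) (B\<up>4) (s\<up>4) (z\<up>4) (Var 3) (Var 3) (Refl (Var 3)) (Var 2) (Var 1))"
      by (rule HG weak4[OF w4 s] var_ty[OF w4] | simp)+
    ultimately show ?thesis by (intro inh_lam inhI[OF conv_ty])
  qed
  have "inh \<Gamma> (PiT (IdT A b z) (PiT (?W (B\<up>1) (s\<up>1) (y\<up>1) (z\<up>1))
    (PiT (?H (A\<up>2) (B\<up>2) (s\<up>2) (z\<up>2) (b\<up>2) (y\<up>2) (p2\<up>2) (Var 1) (Var 0))
      (?G (A\<up>3) (B\<up>3) (s\<up>3) (z\<up>3) (b\<up>3) (y\<up>3) (p2\<up>3) (Var 2) (Var 1)))))"
    by (rule inh_J[OF m base _ p2]) simp_all
  from inh_app[OF inh_app[OF this p1 refl, simplified] w refl, simplified] hyp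
  show ?thesis unfolding inh_def by (auto dest!: pi_app[OF _ _ refl])
qed

lemma coherence_app:
  assumes J: "\<Gamma> \<turnstile> J \<^bold>: coherence_type X f I" and x: "\<Gamma> \<turnstile> x \<^bold>: X"
  shows "\<Gamma> \<turnstile> J \<bullet> x \<^bold>: IdT (IdT X (f \<bullet> (f \<bullet> (f \<bullet> x))) (f \<bullet> (f \<bullet> x)))
    (ap X f (f \<bullet> (f \<bullet> x)) (f \<bullet> x) (I \<bullet> x)) (I \<bullet> (f \<bullet> x))"
  by (rule pi_app[OF J[unfolded coherence_type_def] x]) simp

lemma preidem_cong:
  assumes f: "\<Gamma> \<turnstile> f \<^bold>: arr X X" and I: "\<Gamma> \<turnstile> I \<^bold>: preidem_type X f" and x: "\<Gamma> \<turnstile> x \<doteq> y \<^bold>: X"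
  shows "\<Gamma> \<turnstile> I \<bullet> x \<doteq> I \<bullet> y \<^bold>: IdT X (f \<bullet> (f \<bullet> x)) (f \<bullet> x)"
  by (rule pi_app_cong[OF eq_refl[OF I[unfolded preidem_type_def]] x]) simp

text \<open>Obtained from \<open>ap_inv_concat\<close> with \<open>w\<close> taken as
  \<open>I x\<close>. This asks for \<open>ap s p1\<close> to equal \<open>ap s p2\<close> followed
  by \<open>I x\<close>, so no separate associativity or inverse laws have to be invoked.\<close>

lemma ap_section_split_htpy:
  assumes fe: "\<Gamma> \<turnstile> fe \<^bold>: FunExt i" and X: "\<Gamma> \<turnstile> X \<^bold>: Univ i" and f: "\<Gamma> \<turnstile> f \<^bold>: arr X X"
    and I: "\<Gamma> \<turnstile> I \<^bold>: preidem_type X f" and J: "\<Gamma> \<turnstile> J \<^bold>: coherence_type X f I"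
    and c1: "\<Gamma> \<turnstile> c1 \<^bold>: comm1_type X f I" and c2: "\<Gamma> \<turnstile> c2 \<^bold>: comm2_type X f I"
    and x: "\<Gamma> \<turnstile> x \<^bold>: X"
  defines "s \<equiv> section_map X f" and "r \<equiv> retraction_map X f I" and "H \<equiv> split_htpy fe X f I c1 c2"
  shows "inh \<Gamma> (IdT (IdT X (f \<bullet> (f \<bullet> x)) (f \<bullet> x))
    (ap X s (r \<bullet> (s \<bullet> (r \<bullet> x))) (r \<bullet> x) (H \<bullet> (r \<bullet> x))) (I \<bullet> x))"
proof -
  let ?A = "split_type X f"
  let ?a = "const_seq f x" and ?\<alpha> = "const_seq I x"
  let ?b = "b_seq f ?a" and ?\<beta> = "beta_seq X f ?a ?\<alpha>"
  let ?R = "rs_seq f ?a" and ?\<rho> = "rs_path I ?a"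
  let ?p1 = "path1 fe X f I c1 ?a ?\<alpha>" and ?p2 = "path2 fe X f I c2 ?a ?\<alpha>"
  let ?y = "r \<bullet> (s \<bullet> Pair ?a ?\<alpha>)"
  note tyX = ty_eq_refl[OF is_tyI[OF X]]
  have z: "\<Gamma> \<turnstile> Zero \<^bold>: NatT" by (rule nat_zero[OF wf_of_jdg(1)[OF X]])
  note fx = arr_app[OF f x] and Ix = preidem_app[OF I x]
  note ffx = arr_app[OF f fx]
  note fffx = arr_app[OF f ffx]
  note a = const_seq_ty[OF f x] and \<alpha> = const_path_ty[OF f I x]
  note b = b_seq_ty[OF f a] and \<beta> = beta_seq_ty[OF f a \<alpha>] and R = rs_ty[OF f I a]
  note s = section_ty[OF X f, folded s_def] and r = retraction_ty[OF X f I, folded r_def]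
  note p2 = htpy_body_ty(1)[OF fe X f I c1 c2 a \<alpha>, folded s_def r_def]
    and p1 = path1_ty[OF fe X f I c1 a \<alpha>]
  note y = retraction_section_pair[OF X f I a \<alpha>, folded s_def r_def]
  note sp = section_pair[OF X f, folded s_def]
  have az: "\<Gamma> \<turnstile> ?a \<bullet> Zero \<doteq> f \<bullet> x \<^bold>: X" and aS: "\<Gamma> \<turnstile> ?a \<bullet> Succ Zero \<doteq> f \<bullet> x \<^bold>: X"
    by (rule const_seq_app[OF f x] z nat_succ)+
  have faS: "\<Gamma> \<turnstile> f \<bullet> (?a \<bullet> Succ Zero) \<doteq> f \<bullet> (f \<bullet> x) \<^bold>: X" by (rule arr_app_cong[OF eq_refl[OF f] aS])
  have ffaS: "\<Gamma> \<turnstile> f \<bullet> (f \<bullet> (?a \<bullet> Succ Zero)) \<doteq> f \<bullet> (f \<bullet> (f \<bullet> x)) \<^bold>: X" by (rule arr_app_cong[OF eq_refl[OF f] faS])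
  have bz: "\<Gamma> \<turnstile> ?b \<bullet> Zero \<doteq> f \<bullet> (f \<bullet> (f \<bullet> x)) \<^bold>: X"
    by (rule eq_trans[OF b_seq_app[OF f a z] ffaS])
  have Rz: "\<Gamma> \<turnstile> ?R \<bullet> Zero \<doteq> f \<bullet> (f \<bullet> x) \<^bold>: X"
    unfolding rs_seq_eq
    by (rule eq_trans[OF const_seq_app[OF f arr_app[OF a z] z] arr_app_cong[OF eq_refl[OF f] az]])
  have \<alpha>z: "\<Gamma> \<turnstile> ?\<alpha> \<bullet> Zero \<doteq> I \<bullet> x \<^bold>: IdT X (f \<bullet> (f \<bullet> x)) (f \<bullet> x)"
    by (rule const_path_app[OF I x z])
  have sb: "\<Gamma> \<turnstile> s \<bullet> Pair ?b ?\<beta> \<doteq> f \<bullet> (f \<bullet> (f \<bullet> x)) \<^bold>: X" by (rule eq_trans[OF sp[OF b \<beta>] bz])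
  have sa: "\<Gamma> \<turnstile> s \<bullet> Pair ?a ?\<alpha> \<doteq> f \<bullet> x \<^bold>: X" by (rule eq_trans[OF sp[OF a \<alpha>] az])
  have sR: "\<Gamma> \<turnstile> s \<bullet> Pair ?R ?\<rho> \<doteq> f \<bullet> (f \<bullet> x) \<^bold>: X" by (rule eq_trans[OF sp[OF R] Rz])
  have sy: "\<Gamma> \<turnstile> s \<bullet> ?y \<doteq> f \<bullet> (f \<bullet> x) \<^bold>: X" by (rule eq_trans[OF arr_app_cong[OF eq_refl[OF s] y] sR])
  \<comment> \<open>The end points of \<open>I x\<close> are presented as values of
    \<open>s\<close>, the form in which the cancellation lemma states them.\<close>
  have w: "\<Gamma> \<turnstile> I \<bullet> x \<^bold>: IdT X (s \<bullet> ?y) (s \<bullet> Pair ?a ?\<alpha>)"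
    by (rule conv_ty[OF Ix ty_eq_Id[OF tyX eq_sym[OF sy] eq_sym[OF sa]]])

  \<comment> \<open>The family of \<open>p1\<close> at index 0 is \<open>I (a 1)\<close> followed by
    \<open>\<alpha> 0\<close>; here \<open>a 1\<close> reduces to \<open>f x\<close> and
    \<open>\<alpha> 0\<close> to \<open>I x\<close>.\<close>
  have 1: "inh \<Gamma> (IdT (IdT X (f \<bullet> (f \<bullet> (f \<bullet> x))) (f \<bullet> x)) (ap X s (Pair ?b ?\<beta>) (Pair ?a ?\<alpha>) ?p1)
      (path_concat X (f \<bullet> (f \<bullet> (f \<bullet> x))) (f \<bullet> (f \<bullet> x)) (f \<bullet> x) (I \<bullet> (f \<bullet> x)) (I \<bullet> x)))"
  proof -
    have T: "ty_eq \<Gamma> (IdT X (f \<bullet> (f \<bullet> (?a \<bullet> Succ Zero))) (?a \<bullet> Zero)) (IdT X (?b \<bullet> Zero) (?a \<bullet> Zero))"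
      by (rule ty_eq_Id[OF tyX eq_sym[OF b_seq_app[OF f a z]] eq_refl[OF arr_app[OF a z]]])
    have \<alpha>z': "\<Gamma> \<turnstile> ?\<alpha> \<bullet> Zero \<doteq> I \<bullet> x \<^bold>: IdT X (f \<bullet> (?a \<bullet> Succ Zero)) (?a \<bullet> Zero)"
      by (rule eq_conv_ty[OF \<alpha>z ty_eq_Id[OF tyX eq_sym[OF faS] eq_sym[OF az]]])
    have "\<Gamma> \<turnstile> xi1 X f I ?a ?\<alpha> \<bullet> Zero \<doteq>
        path_concat X (f \<bullet> (f \<bullet> (f \<bullet> x))) (f \<bullet> (f \<bullet> x)) (f \<bullet> x) (I \<bullet> (f \<bullet> x)) (I \<bullet> x)
        \<^bold>: IdT X (f \<bullet> (f \<bullet> (?a \<bullet> Succ Zero))) (?a \<bullet> Zero)"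
      by (rule eq_trans[OF xi1_app[OF f I a \<alpha> z] path_concat_cong[OF ffaS faS az preidem_cong[OF f I aS] \<alpha>z']])
    then have "\<Gamma> \<turnstile> xi1 X f I ?a ?\<alpha> \<bullet> Zero \<doteq>
        path_concat X (f \<bullet> (f \<bullet> (f \<bullet> x))) (f \<bullet> (f \<bullet> x)) (f \<bullet> x) (I \<bullet> (f \<bullet> x)) (I \<bullet> x) \<^bold>: IdT X (?b \<bullet> Zero) (?a \<bullet> Zero)"
      by (rule eq_conv_ty[OF _ T])
    then show ?thesis
      by (intro inh_conv[OF ap_section_path1[OF fe X f I c1 a \<alpha>, folded s_def]]
          ty_eq_Id[OF ty_eq_Id[OF tyX bz az]] eq_refl ap_section_ty'[OF X f b \<beta> a \<alpha> p1, folded s_def])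
  qed

  \<comment> \<open>The family of \<open>p2\<close> at index 0 reduces to \<open>ap f (I x)\<close>,
    which \<open>J x\<close> identifies with \<open>I (f x)\<close>.\<close>
  have 2: "inh \<Gamma> (IdT (IdT X (f \<bullet> (f \<bullet> (f \<bullet> x))) (f \<bullet> (f \<bullet> x))) (ap X s (Pair ?b ?\<beta>) ?y ?p2) (I \<bullet> (f \<bullet> x)))"
  proof -
    note q2 = path2_ty[OF fe X f I c2 a \<alpha>]
    have T: "ty_eq \<Gamma> (IdT X (f \<bullet> (f \<bullet> (?a \<bullet> Succ Zero))) (f \<bullet> (?a \<bullet> Zero))) (IdT X (?b \<bullet> Zero) (?R \<bullet> Zero))"
      unfolding rs_seq_eq
      by (rule ty_eq_Id[OF tyX eq_sym[OF b_seq_app[OF f a z]] eq_sym[OF const_seq_app[OF f arr_app[OF a z] z]]])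
    have \<alpha>z': "\<Gamma> \<turnstile> ?\<alpha> \<bullet> Zero \<doteq> I \<bullet> x \<^bold>: IdT X (f \<bullet> (?a \<bullet> Succ Zero)) (?a \<bullet> Zero)"
      by (rule eq_conv_ty[OF \<alpha>z ty_eq_Id[OF tyX eq_sym[OF faS] eq_sym[OF az]]])
    have "\<Gamma> \<turnstile> xi2 X f I ?a ?\<alpha> \<bullet> Zero \<doteq> ap X f (f \<bullet> (f \<bullet> x)) (f \<bullet> x) (I \<bullet> x)
        \<^bold>: IdT X (f \<bullet> (f \<bullet> (?a \<bullet> Succ Zero))) (f \<bullet> (?a \<bullet> Zero))"
      by (rule eq_trans[OF xi2_zero[OF X f I a \<alpha>] ap_cong[OF f faS az \<alpha>z']])
    then have e2: "\<Gamma> \<turnstile> xi2 X f I ?a ?\<alpha> \<bullet> Zero \<doteq> ap X f (f \<bullet> (f \<bullet> x)) (f \<bullet> x) (I \<bullet> x) \<^bold>: IdT X (?b \<bullet> Zero) (?R \<bullet> Zero)"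
      by (rule eq_conv_ty[OF _ T])
    \<comment> \<open>The path is unchanged; only the end point recorded in \<open>ap\<close> moves
      from the computed pair to the application \<open>r (s (a, \<alpha>))\<close> used in
      \<open>H\<close>.\<close>
    have "\<Gamma> \<turnstile> ap X s (Pair ?b ?\<beta>) (Pair ?R ?\<rho>) ?p2 \<doteq> ap X s (Pair ?b ?\<beta>) ?y ?p2
        \<^bold>: IdT X (s \<bullet> Pair ?b ?\<beta>) (s \<bullet> Pair ?R ?\<rho>)"
      by (rule ap_cong[OF s eq_refl[OF id_inv(2)[OF p1]] eq_sym[OF y] eq_refl[OF q2]])
    then have "\<Gamma> \<turnstile> ap X s (Pair ?b ?\<beta>) (Pair ?R ?\<rho>) ?p2 \<doteq> ap X s (Pair ?b ?\<beta>) ?y ?p2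
        \<^bold>: IdT X (?b \<bullet> Zero) (?R \<bullet> Zero)"
      by (rule eq_conv_ty[OF _ ty_eq_Id[OF tyX sp[OF b \<beta>] sp[OF R]]])
    then have "inh \<Gamma> (IdT (IdT X (f \<bullet> (f \<bullet> (f \<bullet> x))) (f \<bullet> (f \<bullet> x))) (ap X s (Pair ?b ?\<beta>) ?y ?p2)
        (ap X f (f \<bullet> (f \<bullet> x)) (f \<bullet> x) (I \<bullet> x)))"
      by (intro inh_conv[OF ap_section_path2[OF fe X f I c2 a \<alpha>, folded s_def]] ty_eq_Id[OF ty_eq_Id[OF tyX bz Rz]] e2)
    then show ?thesis by (rule inh_trans[OF _ inhI[OF coherence_app[OF J x]]])
  qed

  \<comment> \<open>The preceding path whiskered on the right by \<open>I x\<close>, so that it has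
    the right-hand side of fact 1.\<close>
  have 3: "inh \<Gamma> (IdT (IdT X (f \<bullet> (f \<bullet> (f \<bullet> x))) (f \<bullet> x))
      (path_concat X (f \<bullet> (f \<bullet> (f \<bullet> x))) (f \<bullet> (f \<bullet> x)) (f \<bullet> x) (ap X s (Pair ?b ?\<beta>) ?y ?p2) (I \<bullet> x))
      (path_concat X (f \<bullet> (f \<bullet> (f \<bullet> x))) (f \<bullet> (f \<bullet> x)) (f \<bullet> x) (I \<bullet> (f \<bullet> x)) (I \<bullet> x)))"
  proof -
    let ?T = "IdT X (f \<bullet> (f \<bullet> (f \<bullet> x))) (f \<bullet> (f \<bullet> x))"
    have wf: "wf_ctx (?T # \<Gamma>)" by (rule wfI is_ty_Id is_tyI[OF X] fffx ffx)+
    have v: "?T # \<Gamma> \<turnstile> Var 0 \<^bold>: IdT (X\<up>1) (f\<up>1 \<bullet> (f\<up>1 \<bullet> (f\<up>1 \<bullet> x\<up>1))) (f\<up>1 \<bullet> (f\<up>1 \<bullet> x\<up>1))"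
      by (rule var_ty[OF wf]) simp_all
    have i: "?T # \<Gamma> \<turnstile> (I \<bullet> x)\<up>1 \<^bold>: IdT (X\<up>1) (f\<up>1 \<bullet> (f\<up>1 \<bullet> x\<up>1)) (f\<up>1 \<bullet> x\<up>1)"
      by (rule weak1[OF wf Ix]) simp
    from inh_cong[OF 2, of _ "IdT X (f \<bullet> (f \<bullet> (f \<bullet> x))) (f \<bullet> x)"] path_concat_ty[OF v i]
    show ?thesis by fastforce
  qed

  have "\<Gamma> \<turnstile> ap X s (Pair ?b ?\<beta>) ?y ?p2 \<^bold>: IdT X (f \<bullet> (f \<bullet> (f \<bullet> x))) (f \<bullet> (f \<bullet> x))"
    by (rule conv_ty[OF ap_ty[OF s p2] ty_eq_Id[OF tyX sb sy]])
  from path_concat_cong[OF eq_sym[OF sb] eq_sym[OF sy] eq_sym[OF sa] eq_refl[OF this] eq_refl[OF Ix]]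
  have 4: "\<Gamma> \<turnstile> path_concat X (f \<bullet> (f \<bullet> (f \<bullet> x))) (f \<bullet> (f \<bullet> x)) (f \<bullet> x) (ap X s (Pair ?b ?\<beta>) ?y ?p2) (I \<bullet> x) \<doteq>
      path_concat X (s \<bullet> Pair ?b ?\<beta>) (s \<bullet> ?y) (s \<bullet> Pair ?a ?\<alpha>) (ap X s (Pair ?b ?\<beta>) ?y ?p2) (I \<bullet> x)
      \<^bold>: IdT X (f \<bullet> (f \<bullet> (f \<bullet> x))) (f \<bullet> x)" .
  have ap1: "\<Gamma> \<turnstile> ap X s (Pair ?b ?\<beta>) (Pair ?a ?\<alpha>) ?p1 \<^bold>: IdT X (f \<bullet> (f \<bullet> (f \<bullet> x))) (f \<bullet> x)"
    by (rule conv_ty[OF ap_ty[OF s p1] ty_eq_Id[OF tyX sb sa]])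
  \<comment> \<open>Both sides meet in \<open>I (f x)\<close> followed by \<open>I x\<close>;
    conversion along 4 restores the end points as values of \<open>s\<close>.\<close>
  have "inh \<Gamma> (IdT (IdT X (s \<bullet> Pair ?b ?\<beta>) (s \<bullet> Pair ?a ?\<alpha>)) (ap X s (Pair ?b ?\<beta>) (Pair ?a ?\<alpha>) ?p1)
      (path_concat X (s \<bullet> Pair ?b ?\<beta>) (s \<bullet> ?y) (s \<bullet> Pair ?a ?\<alpha>) (ap X s (Pair ?b ?\<beta>) ?y ?p2) (I \<bullet> x)))"
    by (rule inh_conv[OF inh_trans[OF 1 inh_sym[OF 3]] ty_eq_Id[OF ty_eq_Id[OF tyX eq_sym[OF sb] eq_sym[OF sa]] eq_refl[OF ap1] 4]])
  from ap_inv_concat[OF s p2 p1 w this]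
  have main: "inh \<Gamma> (IdT (IdT X (s \<bullet> ?y) (s \<bullet> Pair ?a ?\<alpha>)) (ap X s ?y (Pair ?a ?\<alpha>) (htpy_body fe X f I c1 c2 ?a ?\<alpha>)) (I \<bullet> x))"
    by (simp add: htpy_body_def s_def r_def Let_def)

  note rx = retraction_app[OF X f I x, folded r_def]
  have rsrx: "\<Gamma> \<turnstile> r \<bullet> (s \<bullet> (r \<bullet> x)) \<doteq> ?y \<^bold>: ?A"
    by (rule arr_app_cong[OF eq_refl[OF r]] arr_app_cong[OF eq_refl[OF s]] rx)+
  \<comment> \<open>Replacing \<open>r x\<close> by its pair changes the path and both recorded end
    points simultaneously, so congruence is needed in all three.\<close>
  have "\<Gamma> \<turnstile> ap X s (r \<bullet> (s \<bullet> (r \<bullet> x))) (r \<bullet> x) (H \<bullet> (r \<bullet> x)) \<doteq> ap X s ?y (Pair ?a ?\<alpha>) (htpy_body fe X f I c1 c2 ?a ?\<alpha>)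
      \<^bold>: IdT X (s \<bullet> (r \<bullet> (s \<bullet> (r \<bullet> x)))) (s \<bullet> (r \<bullet> x))"
    by (rule ap_cong[OF s rsrx rx split_htpy_app[OF fe X f I c1 c2 rx a \<alpha>, folded H_def s_def r_def]])
  moreover have "ty_eq \<Gamma> (IdT X (s \<bullet> (r \<bullet> (s \<bullet> (r \<bullet> x)))) (s \<bullet> (r \<bullet> x))) (IdT X (s \<bullet> ?y) (s \<bullet> Pair ?a ?\<alpha>))"
    by (rule ty_eq_Id[OF tyX] arr_app_cong[OF eq_refl[OF s]] rsrx rx)+
  ultimately have "\<Gamma> \<turnstile> ap X s ?y (Pair ?a ?\<alpha>) (htpy_body fe X f I c1 c2 ?a ?\<alpha>) \<doteq>
      ap X s (r \<bullet> (s \<bullet> (r \<bullet> x))) (r \<bullet> x) (H \<bullet> (r \<bullet> x)) \<^bold>: IdT X (s \<bullet> ?y) (s \<bullet> Pair ?a ?\<alpha>)"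
    by (rule eq_sym[OF eq_conv_ty])
  then show ?thesis
    by (rule inh_conv[OF main ty_eq_Id[OF ty_eq_Id[OF tyX sy sa] _ eq_refl[OF w]]])
qed

theorem theorem7p1:
  fixes \<Gamma> :: "tm list" and i :: nat and fe X f I J c1 c2 :: tm
  assumes "\<Gamma> \<turnstile> fe \<^bold>: FunExt i"
    and "\<Gamma> \<turnstile> X \<^bold>: Univ i"
    and "quasi_idempotent \<Gamma> X f I J"
    and "\<Gamma> \<turnstile> c1 \<^bold>: comm1_type X f I"
    and "\<Gamma> \<turnstile> c2 \<^bold>: comm2_type X f I"
  shows "let s = section_map X f; r = retraction_map X f I; H = split_htpy fe X f I c1 c2 in
    \<exists>t. \<Gamma> \<turnstile> t \<^bold>: PiT X
      (IdT (IdT (X\<up>1) (f\<up>1 \<bullet> (f\<up>1 \<bullet> Var 0)) (f\<up>1 \<bullet> Var 0))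
         (ap (X\<up>1) (s\<up>1) (r\<up>1 \<bullet> (s\<up>1 \<bullet> (r\<up>1 \<bullet> Var 0))) (r\<up>1 \<bullet> Var 0)
            (H\<up>1 \<bullet> (r\<up>1 \<bullet> Var 0)))
         (I\<up>1 \<bullet> Var 0))"
proof -
  have f: "\<Gamma> \<turnstile> f \<^bold>: arr X X" and I: "\<Gamma> \<turnstile> I \<^bold>: preidem_type X f" and J: "\<Gamma> \<turnstile> J \<^bold>: coherence_type X f I"
    using assms(3) by (auto simp: quasi_idempotent_def)
  have wf: "wf_ctx (X # \<Gamma>)" by (rule wfI[OF is_tyI[OF assms(2)]])
  have "X # \<Gamma> \<turnstile> fe\<up>1 \<^bold>: FunExt i" "X # \<Gamma> \<turnstile> X\<up>1 \<^bold>: Univ i" "X # \<Gamma> \<turnstile> f\<up>1 \<^bold>: arr (X\<up>1) (X\<up>1)"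
    "X # \<Gamma> \<turnstile> I\<up>1 \<^bold>: preidem_type (X\<up>1) (f\<up>1)" "X # \<Gamma> \<turnstile> J\<up>1 \<^bold>: coherence_type (X\<up>1) (f\<up>1) (I\<up>1)"
    "X # \<Gamma> \<turnstile> c1\<up>1 \<^bold>: comm1_type (X\<up>1) (f\<up>1) (I\<up>1)" "X # \<Gamma> \<turnstile> c2\<up>1 \<^bold>: comm2_type (X\<up>1) (f\<up>1) (I\<up>1)"
    by (rule weak1[OF wf assms(1)] weak1[OF wf assms(2)] weak1[OF wf f] weak1[OF wf I] weak1[OF wf J]
        weak1[OF wf assms(4)] weak1[OF wf assms(5)], simp)+
  \<comment> \<open>The pointwise result is used at the generic point \<open>Var 0\<close> of
    \<open>X\<close> and then abstracted.\<close>
  from inh_lam[OF ap_section_split_htpy[OF this var0[OF wf]]] show ?thesis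
    by (simp add: inh_def)
qed

end
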